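(* $\mathcal C^*$ is a countable $\mathbb Q$-subspace of $\mathcal S'$. Moreover, for every $\Phi\in\mathcal S^*$ there exists a sequence $(\Phi_n)$ in $\mathcal C^*$ converging pointwise to $\Phi$ with respect to the discrete topology on $\mathbb Q$, i.e., for every $\alpha\in\mathcal S$ one has $\Phi_n(\alpha)=\Phi(\alpha)$ for all sufficiently large $n$.
   Context: Let $\overline{\mathbb Q}$ be an algebraic closure of $\mathbb Q$, $A$ the ring of algebraic integers, $\mathcal S=\overline{\mathbb Q}^\times/A^\times$ (a $\mathbb Q$-vector space, written multiplicatively with scalar action $\alpha\mapsto\alpha^r$). $\mathcal S^*$ is the set of $\mathbb Q$-linear maps $\mathcal S\to\mathbb Q$. For a number field $K$ and non-Archimedean place $v$ of $K$, $p_v$ is the prime below $v$, $K_v$ the completion, $\|\cdot\|_v$ the extension to $K_v$ of the $p_v$-adic absolute value, and $|x|_v=\|x\|_v^{[K_v:\mathbb Q_{p_v}]/[K:\mathbb Q]}$. The norm on $\mathcal S$ is $\|\gamma\|_{\mathcal S}=\sum_v|\log|\gamma|_v|$ over non-Archimedean places of any number field $K\ni\gamma$; $\mathcal S'$ is the set of elements of $\mathcal S^*$ continuous for this norm and the usual absolute value on $\mathbb Q$. Let $\mathcal H_K$ be the image of $K^\times$ in $\mathcal S$, $\mathcal S_K=\{\alpha:\alpha^n\in\mathcal H_K\text{ for some }n\in\mathbb N\}$, $\|\alpha\|_v=\|\alpha^n\|_v^{1/n}$ when $\alpha^n\in\mathcal H_K$. Let $\mathcal J$ be the set of pairs $(K,v)$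 with $K$ a number field and $v$ a non-Archimedean place of $K$. A map $c:\mathcal J\to\mathbb Q$ is consistent if $c(K,v)=\sum_{w\mid v}c(L,w)$ for all number fields $K$, finite extensions $L/K$, non-Archimedean $v$ of $K$. For consistent $c$, $\Phi_c(\alpha)=\sum_v\frac{c(K,v)}{\log p_v}\log\|\alpha\|_v$ over non-Archimedean places of any $K$ with $\alpha\in\mathcal S_K$; every element of $\mathcal S^*$ is $\Phi_c$ for a unique consistent $c$. $G=\mathrm{Gal}(\overline{\mathbb Q}/\mathbb Q)$ acts on $\mathcal S$, and $\mathrm{Stab}_G(\Phi)=\{\sigma\in G:\Phi\circ\sigma=\Phi\}$; $\mathcal S^*_{\mathrm{fin}}=\{\Phi\in\mathcal S^*:[G:\mathrm{Stab}_G(\Phi)]<\infty\}$. A consistent map $c$ is supported on a set $\mathfrak P$ of primes if $c(K,v)=0$ whenever $v$ does not divide a prime in $\mathfrak P$; it (and $\Phi_c$) is compactly supported if it is supported on some finite $\mathfrak P$. $\mathcal S^*_{\mathrm{com}}$ is the set of compactly supported elements of $\mathcal S^*$, and $\mathcal C^*=\mathcal S^*_{\mathrm{fin}}\cap\mathcal S^*_{\mathrm{com}}$. *)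

theory Defs
  imports "HOL-Analysis.Analysis" "HOL-Computational_Algebra.Polynomial"
begin

definition Qbar :: "complex set" where
  "Qbar = {z. algebraic z}"

definition Qbar_units :: "complex set" where
  "Qbar_units = Qbar - {0}"

definition alg_int :: "complex \<Rightarrow> bool" where
  "alg_int z \<longleftrightarrow> (\<exists>p :: int poly. lead_coeff p = 1 \<and> poly (map_poly of_int p) z = 0)"

definition AInt :: "complex set" where
  "AInt = {z. alg_int z}"

definition AUnits :: "complex set" where
  "AUnits = {u. alg_int u \<and> u \<noteq> 0 \<and> alg_int (inverse u)}"

definition subfield :: "complex set \<Rightarrow> bool" where
  "subfield K \<longleftrightarrow> 0 \<in> K \<and> 1 \<in> K \<and> (\<forall>x\<in>K. \<forall>y\<in>K. x + y \<in> K \<and> x * y \<in> K)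
     \<and> (\<forall>x\<in>K. - x \<in> K \<and> inverse x \<in> K)"

definition is_Qbasis :: "complex set \<Rightarrow> nat \<Rightarrow> (nat \<Rightarrow> complex) \<Rightarrow> bool" where
  "is_Qbasis K n b \<longleftrightarrow> (\<forall>i<n. b i \<in> K) \<and>
     (\<forall>x\<in>K. \<exists>!q :: nat \<Rightarrow> rat. (\<forall>i\<ge>n. q i = 0) \<and> x = (\<Sum>i<n. of_rat (q i) * b i))"

definition number_field :: "complex set \<Rightarrow> bool" where
  "number_field K \<longleftrightarrow> subfield K \<and> K \<subseteq> Qbar \<and> (\<exists>n b. is_Qbasis K n b)"

definition nf_degree :: "complex set \<Rightarrow> nat" where
  "nf_degree K = (SOME n. \<exists>b. is_Qbasis K n b)"

definition OK :: "complex set \<Rightarrow> complex set" where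
  "OK K = K \<inter> AInt"

section \<open>Non-Archimedean places = nonzero prime ideals of the ring of integers\<close>

definition places :: "complex set \<Rightarrow> complex set set" where
  "places K = {P. P \<subseteq> OK K \<and> 0 \<in> P \<and> (\<forall>x\<in>P. \<forall>y\<in>P. x + y \<in> P) \<and> (\<forall>x\<in>P. - x \<in> P)
      \<and> (\<forall>a\<in>OK K. \<forall>x\<in>P. a * x \<in> P) \<and> P \<noteq> {0} \<and> P \<noteq> OK K
      \<and> (\<forall>a\<in>OK K. \<forall>b\<in>OK K. a * b \<in> P \<longrightarrow> a \<in> P \<or> b \<in> P)}"

definition JJ :: "(complex set \<times> complex set) set" where
  "JJ = {(K, P). number_field K \<and> P \<in> places K}"

definition prime_below :: "complex set \<Rightarrow> nat" where
  "prime_below P = (THE p. prime p \<and> of_nat p \<in> P)"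

definition ideal_mult :: "complex set \<Rightarrow> complex set \<Rightarrow> complex set" where
  "ideal_mult I J = {x. \<exists>(n::nat) a b. (\<forall>i<n. a i \<in> I \<and> b i \<in> J) \<and> x = (\<Sum>i<n. a i * b i)}"

fun ideal_pow :: "complex set \<Rightarrow> complex set \<Rightarrow> nat \<Rightarrow> complex set" where
  "ideal_pow K P 0 = OK K"
| "ideal_pow K P (Suc k) = ideal_mult (ideal_pow K P k) P"

definition vOK :: "complex set \<Rightarrow> complex set \<Rightarrow> complex \<Rightarrow> nat" where
  "vOK K P a = (GREATEST k. a \<in> ideal_pow K P k)"

definition ordv :: "complex set \<Rightarrow> complex set \<Rightarrow> complex \<Rightarrow> int" where
  "ordv K P x = (SOME m. \<exists>a b. a \<in> OK K - {0} \<and> b \<in> OK K - {0} \<and> x = a / b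
                          \<and> m = int (vOK K P a) - int (vOK K P b))"

text \<open>Ramification index, residue degree and local degree [K_v : Q_p] = e f.\<close>
definition ram_index :: "complex set \<Rightarrow> complex set \<Rightarrow> nat" where
  "ram_index K P = vOK K P (of_nat (prime_below P))"

definition res_degree :: "complex set \<Rightarrow> complex set \<Rightarrow> nat" where
  "res_degree K P = (THE f. prime_below P ^ f = card ((\<lambda>a. (+) a ` P) ` OK K))"

definition local_degree :: "complex set \<Rightarrow> complex set \<Rightarrow> nat" where
  "local_degree K P = ram_index K P * res_degree K P"

text \<open>\<open>\<parallel>x\<parallel>_v\<close>: the extension of the p-adic absolute value (normalised by \<open>\<parallel>p\<parallel>_v = 1/p\<close>),
  and \<open>|x|_v = \<parallel>x\<parallel>_v ^ ([K_v:Q_p]/[K:Q])\<close>.\<close>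
definition vnorm :: "complex set \<Rightarrow> complex set \<Rightarrow> complex \<Rightarrow> real" where
  "vnorm K P x = real (prime_below P) powr (- real_of_int (ordv K P x) / real (ram_index K P))"

definition vabs :: "complex set \<Rightarrow> complex set \<Rightarrow> complex \<Rightarrow> real" where
  "vabs K P x = vnorm K P x powr (real (local_degree K P) / real (nf_degree K))"

section \<open>The space S = Qbar^x / A^x and its norm\<close>

definition normS :: "complex \<Rightarrow> real" where
  "normS \<gamma> = (let K = (SOME K. number_field K \<and> \<gamma> \<in> K) in
     (\<Sum>P\<in>{P \<in> places K. ln (vabs K P \<gamma>) \<noteq> 0}. \<bar>ln (vabs K P \<gamma>)\<bar>))"

text \<open>Q-linear maps S \<rightarrow> Q, represented canonically as functions on complex numbers that
  are homomorphisms Qbar^x \<rightarrow> (Q,+) trivial on A^x, and 0 outside Qbar^x.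
  (Q-linearity on S is the same as additivity here since Q is torsion free.)\<close>
definition Sdual :: "(complex \<Rightarrow> rat) set" where
  "Sdual = {\<Phi>. (\<forall>x\<in>Qbar_units. \<forall>y\<in>Qbar_units. \<Phi> (x * y) = \<Phi> x + \<Phi> y)
               \<and> (\<forall>u\<in>AUnits. \<Phi> u = 0) \<and> (\<forall>z. z \<notin> Qbar_units \<longrightarrow> \<Phi> z = 0)}"

definition Sprime :: "(complex \<Rightarrow> rat) set" where
  "Sprime = {\<Phi> \<in> Sdual. \<forall>\<alpha>\<in>Qbar_units. \<forall>\<epsilon>>0. \<exists>\<delta>>0. \<forall>\<beta>\<in>Qbar_units.
               normS (\<beta> / \<alpha>) < \<delta> \<longrightarrow> \<bar>real_of_rat (\<Phi> \<beta>) - real_of_rat (\<Phi> \<alpha>)\<bar> < \<epsilon>}"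

definition consistent :: "(complex set \<times> complex set \<Rightarrow> rat) \<Rightarrow> bool" where
  "consistent c \<longleftrightarrow> (\<forall>K L P. number_field K \<and> number_field L \<and> K \<subseteq> L \<and> P \<in> places K \<longrightarrow>
      c (K, P) = (\<Sum>Q\<in>{Q \<in> places L. Q \<inter> OK K = P}. c (L, Q)))"

definition in_SK_wit :: "complex set \<Rightarrow> complex \<Rightarrow> nat \<Rightarrow> complex \<Rightarrow> bool" where
  "in_SK_wit K \<alpha> n x \<longleftrightarrow> n \<ge> 1 \<and> x \<in> K - {0} \<and> (\<exists>u\<in>AUnits. \<alpha> ^ n = x * u)"

definition Phi_c :: "(complex set \<times> complex set \<Rightarrow> rat) \<Rightarrow> complex \<Rightarrow> real" where
  "Phi_c c \<alpha> = (if \<alpha> \<notin> Qbar_units then 0 else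
     (let K = (SOME K. number_field K \<and> (\<exists>n x. in_SK_wit K \<alpha> n x));
          nx = (SOME nx. in_SK_wit K \<alpha> (fst nx) (snd nx));
          term = (\<lambda>P. real_of_rat (c (K, P)) / ln (real (prime_below P))
                        * ln (vnorm K P (snd nx) powr (1 / real (fst nx))))
      in (\<Sum>P\<in>{P \<in> places K. term P \<noteq> 0}. term P)))"

definition supported_on :: "(complex set \<times> complex set \<Rightarrow> rat) \<Rightarrow> nat set \<Rightarrow> bool" where
  "supported_on c \<PP> \<longleftrightarrow> (\<forall>K P. (K, P) \<in> JJ \<and> prime_below P \<notin> \<PP> \<longrightarrow> c (K, P) = 0)"

definition Sdual_com :: "(complex \<Rightarrow> rat) set" where
  "Sdual_com = {\<Phi> \<in> Sdual. \<exists>c \<PP>. consistent c \<and> finite \<PP> \<and> supported_on c \<PP>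
                   \<and> (\<forall>\<alpha>. real_of_rat (\<Phi> \<alpha>) = Phi_c c \<alpha>)}"

definition GalQ :: "(complex \<Rightarrow> complex) set" where
  "GalQ = {\<sigma>. bij_betw \<sigma> Qbar Qbar \<and> (\<forall>x\<in>Qbar. \<forall>y\<in>Qbar. \<sigma> (x + y) = \<sigma> x + \<sigma> y \<and> \<sigma> (x * y) = \<sigma> x * \<sigma> y)
             \<and> (\<forall>z. z \<notin> Qbar \<longrightarrow> \<sigma> z = z)}"

definition Stab :: "(complex \<Rightarrow> rat) \<Rightarrow> (complex \<Rightarrow> complex) set" where
  "Stab \<Phi> = {\<sigma> \<in> GalQ. \<Phi> \<circ> \<sigma> = \<Phi>}"

definition Sdual_fin :: "(complex \<Rightarrow> rat) set" where
  "Sdual_fin = {\<Phi> \<in> Sdual. finite {(\<lambda>\<tau>. \<sigma> \<circ> \<tau>) ` Stab \<Phi> | \<sigma>. \<sigma> \<in> GalQ}}"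

definition Cstar :: "(complex \<Rightarrow> rat) set" where
  "Cstar = Sdual_fin \<inter> Sdual_com"

end

theory Submission
  imports Defs "Jordan_Normal_Form.Char_Poly"
begin

text \<open>
  Some power \<open>P\<^sup>h\<close> of a place \<open>P\<close> of a number field \<open>K\<close> is generated by an element
  \<open>\<gamma>\<^sub>P\<close>, and \<open>\<Phi>(x) = (\<Sum>P. ord\<^sub>P(x) \<Phi>(\<gamma>\<^sub>P) / h\<^sub>P)\<close> for \<open>x \<in> K\<^sup>\<times>\<close> and every functional
  \<open>\<Phi>\<close>.  Hence \<open>\<Phi>\<close> is represented by \<open>c(K,P) = - e\<^sub>P \<Phi>(\<gamma>\<^sub>P) / h\<^sub>P\<close>, and \<open>\<Phi>\<close> is compactly
  supported iff, for almost all primes \<open>p\<close>, it vanishes on the algebraic integers dividing a power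
  of \<open>p\<close>.  The stabilizer of \<open>\<Phi>\<close> is closed, so it has finite index iff it contains the Galois group
  of some number field \<open>K\<close>; then \<open>\<Phi>\<close> is determined by its values on norms to \<open>K\<close>.  Thus an element
  of \<open>\<C>\<^sup>*\<close> is given by a number field and finitely many rationals \<open>\<Phi>(\<gamma>\<^sub>P)\<close>, which gives
  countability.  Continuity follows by comparing \<open>|\<Phi>|\<close>, via norms to \<open>K\<close>, with the normalized
  logarithmic norm \<open>ln |N(a)| / deg a\<close>, and the latter, by a pigeonhole argument, with the norm on
  \<open>\<S>\<close>.  For density, average \<open>\<Phi>\<close> over the Galois group of the \<open>n\<close>-th field of an exhausting
  sequence and discard the places over primes larger than \<open>n\<close>.
\<close>

section \<open>Algebraic integers\<close>

text \<open>The difficulty lies in the choice of fields. \<open>normS\<close> and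
  \<open>Phi_c\<close> compute in one chosen number field that depends on the argument, while a
  functional in \<open>Cstar\<close> is controlled over the field whose Galois group fixes it.
  Quantities that mention no field connect the two: \<open>lnorm\<close> for continuity, and the
  elements with property \<open>pelem\<close> for compact support, since these single out a prime
  without naming a place.

  A place is a prime ideal, so neither completions nor uniformizers are at hand. The generator
  \<open>gam P\<close> of \<open>P^h\<close> takes over: multiplication by it shifts the powers of
  \<open>P\<close> by \<open>h\<close>, and its valuation is \<open>h\<close> at \<open>P\<close>
  and 0 at every other place. Nakayama's lemma provides the cancellation of ideals that leads to
  this generator.

  Finiteness of residue rings and principality of some \<open>P^h\<close> both go back to Dirichlet
  approximation in the coordinates of a rational basis made of integers. The sign and the factor
  \<open>e_P\<close> in the representing \<open>c\<close> only undo the normalization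
  \<open>log |x|_P = - (ord_P(x) / e_P) log p\<close> of the extended p-adic absolute value.\<close>

lemma alg_int_iff: "alg_int z \<longleftrightarrow> algebraic_int z"
  unfolding alg_int_def algebraic_int_altdef_ipoly by blast

text \<open>The determinant trick: \<open>v\<close> exhibits \<open>x\<close> as an eigenvalue of an
  integer matrix, whose characteristic polynomial is monic and integral. The entries of
  \<open>v\<close> may be linearly dependent; one nonzero entry makes it an eigenvector.\<close>

lemma alg_int_eigenvector:
  fixes v :: "'b \<Rightarrow> complex"
  assumes fin: "finite S" and i0: "i0 \<in> S" "v i0 \<noteq> 0"
    and ev: "\<And>i. i \<in> S \<Longrightarrow> x * v i = (\<Sum>j\<in>S. of_int (A i j) * v j)"
  shows "alg_int x"
proof -
  obtain e where e: "bij_betw e {0..<card S} S"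
    using ex_bij_betw_nat_finite[OF fin] by blast
  define n where "n = card S"
  have e_in: "e k \<in> S" if "k < n" for k
    using e that by (auto simp: bij_betw_def n_def)
  define M where "M = mat n n (\<lambda>(i,j). A (e i) (e j))"
  define w where "w = vec n (\<lambda>i. v (e i))"
  have M: "M \<in> carrier_mat n n" by (simp add: M_def)
  let ?C = "map_mat (of_int :: int \<Rightarrow> complex) M"
  have C: "?C \<in> carrier_mat n n" using M by simp
  have sum_e: "(\<Sum>j\<in>S. f j) = (\<Sum>k = 0..<n. f (e k))" for f :: "'b \<Rightarrow> complex"
    using sum.reindex_bij_betw[OF e, of f] by (simp add: n_def)
  have "?C *\<^sub>v w = x \<cdot>\<^sub>v w"
  proof (rule eq_vecI)
    show "dim_vec (?C *\<^sub>v w) = dim_vec (x \<cdot>\<^sub>v w)" by (simp add: M_def w_def)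
    fix i assume "i < dim_vec (x \<cdot>\<^sub>v w)"
    then have i: "i < n" by (simp add: w_def)
    have "(?C *\<^sub>v w) $ i = (\<Sum>j = 0..<n. of_int (A (e i) (e j)) * v (e j))"
      using i by (simp add: M_def w_def scalar_prod_def)
    also have "\<dots> = x * v (e i)"
      using ev[OF e_in[OF i]] sum_e by simp
    finally show "(?C *\<^sub>v w) $ i = (x \<cdot>\<^sub>v w) $ i" using i by (simp add: w_def)
  qed
  moreover have "w \<noteq> 0\<^sub>v n"
  proof
    assume w0: "w = 0\<^sub>v n"
    obtain k where "k < n" "e k = i0"
      using e i0(1) unfolding bij_betw_def n_def by (metis atLeastLessThan_iff imageE)
    then have "w $ k = v i0" by (simp add: w_def)
    with w0 \<open>k < n\<close> i0 show False by simp
  qed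
  moreover have "w \<in> carrier_vec n" by (simp add: w_def)
  ultimately have "eigenvalue ?C x"
    unfolding eigenvalue_def eigenvector_def using C M by auto
  then have "poly (char_poly ?C) x = 0" using eigenvalue_root_char_poly[OF C] by simp
  moreover have "char_poly ?C = map_poly of_int (char_poly M)"
    by (rule of_int_hom.char_poly_hom[OF M])
  moreover have "lead_coeff (char_poly M) = 1" using degree_monic_char_poly[OF M] by simp
  ultimately show ?thesis unfolding alg_int_def by auto
qed

lemma alg_int_power_reduction:
  assumes "alg_int a"
  obtains d :: nat and c :: "nat \<Rightarrow> int"
  where "d > 0" "a ^ d = (\<Sum>k<d. of_int (c k) * a ^ k)"
proof -
  obtain p :: "int poly" where p: "lead_coeff p = 1" "poly (map_poly of_int p) a = 0"
    using assms unfolding alg_int_def by blast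
  have deg: "degree (map_poly (of_int :: int \<Rightarrow> complex) p) = degree p"
    by (simp add: degree_map_poly)
  have "degree p > 0"
  proof (rule ccontr)
    assume "\<not> degree p > 0"
    then have "p = [:lead_coeff p:]" by (metis degree_eq_zeroE coeff_pCons_0 neq0_conv)
    then have "p = 1" using p(1) by (simp add: one_pCons)
    with p(2) show False by simp
  qed
  moreover have "0 = (\<Sum>k\<le>degree p. of_int (coeff p k) * a ^ k)"
    using p(2) by (simp add: poly_altdef deg coeff_map_poly)
  then have "0 = (\<Sum>k<degree p. of_int (coeff p k) * a ^ k) + a ^ degree p"
    using p(1) by (simp add: lessThan_Suc_atMost[symmetric])
  then have "a ^ degree p = (\<Sum>k<degree p. of_int (- coeff p k) * a ^ k)"
    by (simp add: sum_negf eq_neg_iff_add_eq_0 add.commute)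
  ultimately show thesis by (rule that)
qed

text \<open>The monomials themselves form the eigenvector; the pair \<open>(0,0)\<close> contributes
  the entry 1, so the vector is nonzero.\<close>

lemma alg_int_of_monomial_stable:
  fixes a b x :: complex
  assumes "finite S" and one: "(0,0) \<in> S"
    and "\<And>i j. (i,j) \<in> S \<Longrightarrow> \<exists>A. x * (a ^ i * b ^ j) = (\<Sum>s\<in>S. of_int (A s) * (a ^ fst s * b ^ snd s))"
  shows "alg_int x"
proof -
  have "\<exists>A. x * (a ^ fst s * b ^ snd s) = (\<Sum>t\<in>S. of_int (A t) * (a ^ fst t * b ^ snd t))"
    if "s \<in> S" for s
    using assms(3)[of "fst s" "snd s"] that by auto
  then obtain A where A: "\<And>s. s \<in> S \<Longrightarrow>
      x * (a ^ fst s * b ^ snd s) = (\<Sum>t\<in>S. of_int (A s t) * (a ^ fst t * b ^ snd t))"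
    by metis
  show ?thesis
    by (rule alg_int_eigenvector[where S = S and ?i0.0 = "(0,0)" and v = "\<lambda>s. a ^ fst s * b ^ snd s" and A = A])
       (use assms A in auto)
qed

text \<open>The additive group generated by \<open>a^i b^j\<close> with \<open>i < d\<close> and
  \<open>j < e\<close> is stable under multiplication by \<open>a\<close> and \<open>b\<close>,
  because the monic equations rewrite \<open>a^d\<close> and \<open>b^e\<close> in lower
  powers.\<close>

lemma alg_int_add_mult:
  assumes "alg_int a" "alg_int b"
  shows "alg_int (a + b)" "alg_int (a * b)"
proof -
  obtain d c where d: "d > 0" "a ^ d = (\<Sum>k<d. of_int (c k) * a ^ k)"
    by (rule alg_int_power_reduction[OF assms(1)])
  obtain e f where e: "e > 0" "b ^ e = (\<Sum>k<e. of_int (f k) * b ^ k)"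
    by (rule alg_int_power_reduction[OF assms(2)])
  define S where "S = {..<d} \<times> {..<e}"
  define comb where "comb z \<longleftrightarrow> (\<exists>A. z = (\<Sum>s\<in>S. of_int (A s) * (a ^ fst s * b ^ snd s)))" for z
  have fin: "finite S" by (simp add: S_def)
  have comb_add: "comb (y + z)" if yz: "comb y" "comb z" for y z
  proof -
    obtain A B where "y = (\<Sum>s\<in>S. of_int (A s) * (a ^ fst s * b ^ snd s))"
      "z = (\<Sum>s\<in>S. of_int (B s) * (a ^ fst s * b ^ snd s))" using yz unfolding comb_def by blast
    then show ?thesis unfolding comb_def
      by (intro exI[of _ "\<lambda>s. A s + B s"]) (simp add: sum.distrib[symmetric] case_prod_beta algebra_simps)
  qed
  have comb_scale: "comb (of_int m * y)" if y: "comb y" for y m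
  proof -
    obtain A where "y = (\<Sum>s\<in>S. of_int (A s) * (a ^ fst s * b ^ snd s))"
      using y unfolding comb_def by blast
    then show ?thesis unfolding comb_def
      by (intro exI[of _ "\<lambda>s. m * A s"]) (simp add: sum_distrib_left case_prod_beta algebra_simps)
  qed
  have comb_0: "comb 0" unfolding comb_def by (intro exI[of _ "\<lambda>_. 0"]) simp
  have comb_sum: "comb (\<Sum>i\<in>I. g i)" if "\<And>i. i \<in> I \<Longrightarrow> comb (g i)" for I :: "nat set" and g
    using that by (induction I rule: infinite_finite_induct) (auto simp: comb_0 comb_add)
  have comb_mono: "comb (a ^ i * b ^ j)" if "i < d" "j < e" for i j
  proof -
    have "a ^ i * b ^ j = (\<Sum>s\<in>S. if s = (i,j) then a ^ fst s * b ^ snd s else 0)"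
      using fin that by (subst sum.delta) (auto simp: S_def)
    also have "\<dots> = (\<Sum>s\<in>S. of_int (if s = (i,j) then 1 else 0) * (a ^ fst s * b ^ snd s))"
      by (intro sum.cong) auto
    finally show ?thesis unfolding comb_def by (intro exI[of _ "\<lambda>s. if s = (i,j) then 1 else 0"])
  qed
  \<comment> \<open>Multiplication raises each exponent by at most one, so it suffices to reduce an
    exponent equal to \<open>d\<close>, and after that one equal to \<open>e\<close>.\<close>
  have comb_a: "comb (a ^ i * b ^ j)" if "i \<le> d" "j < e" for i j
  proof (cases "i = d")
    case True
    have "a ^ i * b ^ j = (\<Sum>k<d. of_int (c k) * (a ^ k * b ^ j))"
      by (simp add: True d(2) sum_distrib_right mult.assoc)
    then show ?thesis using that by (auto intro!: comb_sum comb_scale comb_mono)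
  qed (use that comb_mono in auto)
  have comb_ab: "comb (a ^ i * b ^ j)" if "i \<le> d" "j \<le> e" for i j
  proof (cases "j = e")
    case True
    have "a ^ i * b ^ j = (\<Sum>k<e. of_int (f k) * (a ^ i * b ^ k))"
      by (simp add: True e(2) sum_distrib_left mult.left_commute)
    then show ?thesis using that by (auto intro!: comb_sum comb_scale comb_a)
  qed (use that comb_a in auto)
  have 0: "(0,0) \<in> S" using d e by (simp add: S_def)
  show "alg_int (a + b)"
  proof (rule alg_int_of_monomial_stable[OF fin 0])
    fix i j assume "(i,j) \<in> S"
    then have "comb (a ^ Suc i * b ^ j + a ^ i * b ^ Suc j)"
      by (intro comb_add comb_ab) (auto simp: S_def)
    then show "\<exists>A. (a + b) * (a ^ i * b ^ j) = (\<Sum>s\<in>S. of_int (A s) * (a ^ fst s * b ^ snd s))"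
      unfolding comb_def by (simp add: algebra_simps)
  qed
  show "alg_int (a * b)"
  proof (rule alg_int_of_monomial_stable[OF fin 0])
    fix i j assume "(i,j) \<in> S"
    then have "comb (a ^ Suc i * b ^ Suc j)"
      by (intro comb_ab) (auto simp: S_def)
    then show "\<exists>A. (a * b) * (a ^ i * b ^ j) = (\<Sum>s\<in>S. of_int (A s) * (a ^ fst s * b ^ snd s))"
      unfolding comb_def by (simp add: algebra_simps)
  qed
qed

lemmas alg_int_add = alg_int_add_mult(1) and alg_int_mult = alg_int_add_mult(2)

lemma alg_int_of_int [simp]: "alg_int (of_int m)"
  and alg_int_of_nat [simp]: "alg_int (of_nat k)"
  and alg_int_0 [simp]: "alg_int 0"
  and alg_int_1 [simp]: "alg_int 1"
  by (simp_all add: alg_int_iff)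

lemma alg_int_uminus: "alg_int a \<Longrightarrow> alg_int (- a)"
  by (simp add: alg_int_iff)

lemma alg_int_diff: "alg_int a \<Longrightarrow> alg_int b \<Longrightarrow> alg_int (a - b)"
  using alg_int_add[of a "- b"] alg_int_uminus[of b] by simp

lemma alg_int_power: "alg_int a \<Longrightarrow> alg_int (a ^ n)"
  by (induction n) (auto intro: alg_int_mult)

lemma alg_int_prod: "(\<And>i. i \<in> I \<Longrightarrow> alg_int (f i)) \<Longrightarrow> alg_int (\<Prod>i\<in>I. f i)"
  by (induction I rule: infinite_finite_induct) (auto intro: alg_int_mult)

text \<open>If \<open>p\<close> is a monic equation for \<open>q(x)\<close>, then the composite of
  \<open>p\<close> and \<open>q\<close> is one for \<open>x\<close>. This turns integrality of a
  difference of two powers into integrality of the base.\<close>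

lemma alg_int_if_monic_value:
  fixes q :: "int poly"
  assumes "alg_int (poly (map_poly of_int q) x)" "lead_coeff q = 1" "degree q > 0"
  shows "alg_int x"
proof -
  obtain p :: "int poly" where p: "lead_coeff p = 1"
      "poly (map_poly of_int p) (poly (map_poly of_int q) x) = (0::complex)"
    using assms(1) unfolding alg_int_def by blast
  have "lead_coeff (p \<circ>\<^sub>p q) = 1"
    using lead_coeff_comp[of q p] p(1) assms(2,3) by simp
  moreover have "poly (map_poly of_int (p \<circ>\<^sub>p q)) x = (0::complex)"
    using p(2) by (simp add: of_int_hom.map_poly_pcompose poly_pcompose)
  ultimately show ?thesis unfolding alg_int_def by blast
qed

lemma alg_int_imp_Qbar: "alg_int z \<Longrightarrow> z \<in> Qbar"
  by (auto simp: alg_int_iff Qbar_def)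

lemma rational_alg_int_is_int: "alg_int z \<Longrightarrow> z \<in> \<rat> \<Longrightarrow> z \<in> \<int>"
  using rational_algebraic_int_is_int by (simp add: alg_int_iff)

section \<open>Number fields inside the algebraic numbers\<close>

interpretation rv: vector_space "\<lambda>(q::rat) (z::complex). of_rat q * z"
  by unfold_locales (simp_all add: algebra_simps of_rat_add of_rat_mult)

lemma of_rat_in_Rats_E: assumes "z \<in> \<rat>" obtains q :: rat where "z = of_rat q"
  using assms by (auto simp: Rats_def)

lemma poly_in_subring:
  fixes x :: "'a :: comm_semiring_0"
  assumes "0 \<in> R" "\<And>x y. x \<in> R \<Longrightarrow> y \<in> R \<Longrightarrow> x + y \<in> R" "\<And>x y. x \<in> R \<Longrightarrow> y \<in> R \<Longrightarrow> x * y \<in> R"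
    and "\<And>i. coeff p i \<in> R" "x \<in> R"
  shows "poly p x \<in> R"
  using assms(4)
proof (induction p)
  case 0
  then show ?case using assms by simp
next
  case (pCons a p)
  have "a \<in> R" using pCons.prems[of 0] by simp
  moreover have "\<And>i. coeff p i \<in> R" using pCons.prems[of "Suc i" for i] by simp
  ultimately show ?case using pCons.IH assms by simp
qed

text \<open>An integer equation with nonzero constant term \<open>c\<close> reads
  \<open>c + x r(x) = 0\<close>, so the inverse is \<open>- r(x) / c\<close>. Hence a ring of
  algebraic numbers containing the rationals is already a field.\<close>

lemma inverse_algebraic_eq_poly:
  assumes "algebraic (x :: complex)" "x \<noteq> 0"
  obtains q where "\<And>i. coeff q i \<in> \<rat>" "inverse x = poly q x"
proof -
  obtain p :: "int poly" where p: "coeff p 0 \<noteq> 0" "poly (map_poly of_int p) x = 0"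
    using algebraicE'_nonzero[OF assms] by metis
  obtain c r where r: "p = pCons c r" by (cases p)
  have c: "c \<noteq> 0" using p(1) r by simp
  have "of_int c + x * poly (map_poly of_int r) x = 0"
    using p(2) r by (simp add: of_int_hom.map_poly_pCons_hom)
  then have "x * poly (map_poly of_int r) x = - of_int c" by (simp add: eq_neg_iff_add_eq_0 add.commute)
  then have "inverse x = poly (Polynomial.smult (- 1 / of_int c) (map_poly of_int r)) x"
    using c assms(2) by (simp add: field_simps)
  moreover have "coeff (Polynomial.smult (- 1 / of_int c :: complex) (map_poly of_int r)) i \<in> \<rat>" for i
    by (simp add: coeff_map_poly)
  ultimately show thesis by (rule that[rotated])
qed

text \<open>Among \<open>card S + 1\<close> powers in a span of \<open>card S\<close> vectors there
  is a linear relation. Dependence is a property of the set of powers, so a coincidence of two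
  powers is treated separately.\<close>

lemma algebraic_if_powers_in_span:
  assumes "finite S" "\<And>k. x ^ k \<in> rv.span S"
  shows "algebraic x"
proof (cases "inj_on (\<lambda>k. x ^ k) {..card S}")
  case False
  then obtain i j where ij: "i \<noteq> j" "x ^ i = x ^ j" by (auto simp: inj_on_def)
  let ?p = "monom 1 i - monom 1 j :: complex poly"
  have "coeff ?p i \<noteq> 0" using ij by simp
  then have "?p \<noteq> 0" by (metis coeff_0)
  then show ?thesis
    by (rule algebraicI'[rotated]) (use ij in \<open>auto simp: poly_monom\<close>)
next
  case True
  let ?B = "(\<lambda>k. x ^ k) ` {..card S}"
  have "card ?B = Suc (card S)" using True by (simp add: card_image)
  then have "rv.dependent ?B"
    using rv.independent_span_bound[OF assms(1), of ?B] assms(2) by auto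
  then obtain u v where u: "v \<in> ?B" "u v \<noteq> 0" "(\<Sum>v\<in>?B. of_rat (u v) * v) = 0"
    using rv.dependent_finite[of ?B] by auto
  then obtain k where k: "k \<le> card S" "u (x ^ k) \<noteq> 0" by auto
  define p where "p = (\<Sum>k\<le>card S. monom (of_rat (u (x ^ k))) k :: complex poly)"
  have coeff_p: "coeff p i = (if i \<le> card S then of_rat (u (x ^ i)) else 0)" for i
    by (simp add: p_def coeff_sum)
  show ?thesis
  proof (rule algebraicI')
    show "coeff p i \<in> \<rat>" for i by (simp add: coeff_p)
    have "coeff p k \<noteq> 0" using k by (simp add: coeff_p)
    then show "p \<noteq> 0" by (metis coeff_0)
    show "poly p x = 0"
      using u(3) True by (simp add: p_def poly_sum poly_monom sum.reindex)
  qed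
qed

text \<open>A finite, possibly dependent spanning family of a rational algebra. In this form
  elements can be adjoined by just taking products; independence is restored when a basis in the
  sense of \<open>is_Qbasis\<close> is extracted.\<close>

definition ring_basis :: "complex set \<Rightarrow> bool" where
  "ring_basis S \<longleftrightarrow> finite S \<and> 1 \<in> S \<and> (\<forall>s\<in>S. \<forall>t\<in>S. s * t \<in> rv.span S)"

lemma ring_basis_span_mult:
  assumes "ring_basis S" "x \<in> rv.span S" "y \<in> rv.span S"
  shows "x * y \<in> rv.span S"
proof -
  have 1: "rv.span S \<subseteq> {x. s * x \<in> rv.span S}" if "s \<in> S" for s
  proof (rule rv.span_minimal)
    show "S \<subseteq> {x. s * x \<in> rv.span S}" using assms(1) \<open>s \<in> S\<close> by (auto simp: ring_basis_def)
    show "rv.subspace {x. s * x \<in> rv.span S}"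
    proof (rule rv.subspaceI)
      fix c x assume "x \<in> {x. s * x \<in> rv.span S}"
      then show "of_rat c * x \<in> {x. s * x \<in> rv.span S}"
        using rv.span_scale[of "s * x" S c] by (simp add: mult.left_commute)
    qed (auto simp: rv.span_zero distrib_left intro: rv.span_add)
  qed
  have "rv.span S \<subseteq> {x. x * y \<in> rv.span S}"
  proof (rule rv.span_minimal)
    show "S \<subseteq> {x. x * y \<in> rv.span S}" using 1 assms(3) by auto
    show "rv.subspace {x. x * y \<in> rv.span S}"
    proof (rule rv.subspaceI)
      fix c x assume "x \<in> {x. x * y \<in> rv.span S}"
      then show "of_rat c * x \<in> {x. x * y \<in> rv.span S}"
        using rv.span_scale[of "x * y" S c] by (simp add: mult.assoc)
    qed (auto simp: rv.span_zero distrib_right intro: rv.span_add)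
  qed
  then show ?thesis using assms(2) by auto
qed

lemma ring_basis_span_one: "ring_basis S \<Longrightarrow> 1 \<in> rv.span S"
  by (simp add: ring_basis_def rv.span_base)

lemma ring_basis_span_power:
  "ring_basis S \<Longrightarrow> x \<in> rv.span S \<Longrightarrow> x ^ k \<in> rv.span S"
  by (induction k) (auto intro: ring_basis_span_mult ring_basis_span_one)

lemma ring_basis_algebraic: "ring_basis S \<Longrightarrow> x \<in> rv.span S \<Longrightarrow> algebraic x"
  by (rule algebraic_if_powers_in_span[of S]) (auto simp: ring_basis_span_power, simp add: ring_basis_def)

lemma ring_basis_subfield:
  assumes "ring_basis S"
  shows "Defs.subfield (rv.span S)"
proof -
  have rat: "q \<in> rv.span S" if "q \<in> \<rat>" for q
    using that rv.span_scale[OF ring_basis_span_one[OF assms]] by (auto elim: of_rat_in_Rats_E)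
  have "inverse x \<in> rv.span S" if x: "x \<in> rv.span S" for x
  proof (cases "x = 0")
    case False
    obtain q where q: "\<And>i. coeff q i \<in> \<rat>" "inverse x = poly q x"
      using inverse_algebraic_eq_poly[OF ring_basis_algebraic[OF assms x] False] by metis
    have "poly q x \<in> rv.span S"
      by (rule poly_in_subring)
         (auto intro: rv.span_zero rv.span_add ring_basis_span_mult[OF assms] rat q x)
    then show ?thesis using q by simp
  qed (auto simp: rv.span_zero)
  then show ?thesis unfolding Defs.subfield_def
    by (auto intro: rv.span_zero rv.span_add ring_basis_span_mult[OF assms] rv.span_neg
        ring_basis_span_one[OF assms])
qed

lemma ring_basis_number_field:
  assumes S: "ring_basis S"
  shows "number_field (rv.span S)"
proof -
  obtain B where B: "B \<subseteq> rv.span S" "rv.independent B" "rv.span S \<subseteq> rv.span B"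
    using rv.maximal_independent_subset by metis
  have finS: "finite S" using S by (simp add: ring_basis_def)
  have fin: "finite B" using rv.independent_span_bound[OF finS B(2,1)] by simp
  obtain b where b: "bij_betw b {..<card B} B"
    using ex_bij_betw_nat_finite[OF fin] by (metis atLeast0LessThan)
  let ?n = "card B"
  have inj: "inj_on b {..<?n}" and im: "b ` {..<?n} = B" using b by (auto simp: bij_betw_def)
  have reindex: "(\<Sum>v\<in>B. f v) = (\<Sum>i<?n. f (b i))" for f :: "complex \<Rightarrow> complex"
    using sum.reindex_bij_betw[OF b, of f] by simp
  have "is_Qbasis (rv.span S) ?n b"
    unfolding is_Qbasis_def
  proof (intro conjI allI impI ballI)
    show "b i \<in> rv.span S" if "i < ?n" for i using B(1) im that by auto
    fix x assume "x \<in> rv.span S"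
    then have "x \<in> rv.span B" using B(3) by auto
    then obtain u where u: "x = (\<Sum>v\<in>B. of_rat (u v) * v)"
      using rv.span_finite[OF fin] by auto
    show "\<exists>!q :: nat \<Rightarrow> rat. (\<forall>i\<ge>?n. q i = 0) \<and> x = (\<Sum>i<?n. of_rat (q i) * b i)"
    proof (rule ex_ex1I)
      show "\<exists>q :: nat \<Rightarrow> rat. (\<forall>i\<ge>?n. q i = 0) \<and> x = (\<Sum>i<?n. of_rat (q i) * b i)"
        \<comment> \<open>Coordinates beyond the basis get the value 0, which makes \<open>q\<close>
          unique as a function on all natural numbers.\<close>
        by (rule exI[of _ "\<lambda>i. if i < ?n then u (b i) else 0"]) (simp add: u reindex)
    next
      fix q r :: "nat \<Rightarrow> rat"
      assume q: "(\<forall>i\<ge>?n. q i = 0) \<and> x = (\<Sum>i<?n. of_rat (q i) * b i)"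
        and r: "(\<forall>i\<ge>?n. r i = 0) \<and> x = (\<Sum>i<?n. of_rat (r i) * b i)"
      \<comment> \<open>The difference of the two coordinate functions is moved from indices to the
        vectors of \<open>B\<close>, where independence applies.\<close>
      define g where "g v = (let i = the_inv_into {..<?n} b v in q i - r i)" for v
      have g: "g (b i) = q i - r i" if "i < ?n" for i
        using the_inv_into_f_f[OF inj] that by (simp add: g_def)
      have "(\<Sum>v\<in>B. of_rat (g v) * v) = (\<Sum>i<?n. of_rat (q i - r i) * b i)"
        unfolding reindex by (intro sum.cong) (auto simp: g)
      also have "\<dots> = 0"
        using q r by (simp add: of_rat_diff algebra_simps sum_subtractf)
      finally have "\<forall>v\<in>B. g v = 0"
        using B(2) rv.dependent_finite[OF fin] by auto
      then have "q i = r i" if "i < ?n" for i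
      proof -
        have "b i \<in> B" using im that by blast
        then show ?thesis using g[OF that] \<open>\<forall>v\<in>B. g v = 0\<close> by simp
      qed
      then show "q = r" using q r by (metis ext not_less)
    qed
  qed
  moreover have "rv.span S \<subseteq> Qbar"
    using ring_basis_algebraic[OF S] by (auto simp: Qbar_def)
  ultimately show ?thesis
    unfolding number_field_def using ring_basis_subfield[OF S] by blast
qed

text \<open>If \<open>z\<close> satisfies a rational equation of degree \<open>d\<close>, the
  products of \<open>S\<close> with \<open>1, z, ..., z^(d-1)\<close> span an algebra, since the
  equation lowers all higher powers.\<close>

lemma ring_basis_adjoin:
  assumes S: "ring_basis S" and z: "z \<in> Qbar"
  obtains T where "ring_basis T" "S \<subseteq> T" "z \<in> rv.span T"
proof -
  have "algebraic z" using z by (simp add: Qbar_def)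
  then obtain p where p: "\<And>i. coeff p i \<in> \<rat>" "p \<noteq> 0" "poly p z = 0"
    unfolding algebraic_altdef by blast
  define d where "d = degree p"
  have "d > 0" using p(2,3) unfolding d_def
    by (metis degree_eq_zeroE neq0_conv pCons_0_0 poly_pCons mult_zero_right add.right_neutral poly_0)
  define T where "T = (\<lambda>(s,j). s * z ^ j) ` (S \<times> {..<d})"
  have finT: "finite T" using S by (simp add: T_def ring_basis_def)
  have lt: "s * z ^ j \<in> rv.span T" if "s \<in> S" "j < d" for s j
    using that by (intro rv.span_base) (auto simp: T_def)
  have spanS: "x * z ^ j \<in> rv.span T" if "x \<in> rv.span S" "j < d" for x j
  proof -
    have "rv.span S \<subseteq> {x. x * z ^ j \<in> rv.span T}"
    proof (rule rv.span_minimal)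
      show "S \<subseteq> {x. x * z ^ j \<in> rv.span T}" using lt \<open>j < d\<close> by auto
      show "rv.subspace {x. x * z ^ j \<in> rv.span T}"
      proof (rule rv.subspaceI)
        fix c x assume "x \<in> {x. x * z ^ j \<in> rv.span T}"
        then show "of_rat c * x \<in> {x. x * z ^ j \<in> rv.span T}"
          using rv.span_scale[of "x * z ^ j" T c] by (simp add: mult.assoc)
      qed (auto simp: rv.span_zero distrib_right intro: rv.span_add)
    qed
    then show ?thesis using \<open>x \<in> rv.span S\<close> by auto
  qed
  have zd: "z ^ d = (\<Sum>i<d. (- coeff p i / lead_coeff p) * z ^ i)"
  proof -
    have "0 = (\<Sum>i<d. coeff p i * z ^ i) + lead_coeff p * z ^ d"
      using p(3) by (simp add: poly_altdef d_def lessThan_Suc_atMost[symmetric])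
    then have "lead_coeff p * z ^ d = - (\<Sum>i<d. coeff p i * z ^ i)"
      by (metis add.commute add_eq_0_iff)
    then have "z ^ d = - (\<Sum>i<d. coeff p i * z ^ i) / lead_coeff p"
      using p(2) by (simp add: field_simps)
    then show ?thesis by (simp add: sum_divide_distrib sum_negf[symmetric])
  qed
  \<comment> \<open>Strong induction on the exponent; \<open>x\<close> is general because the
    rational coefficients of the equation are absorbed into it.\<close>
  have all: "x * z ^ j \<in> rv.span T" if "x \<in> rv.span S" for x j
    using that
  proof (induction j arbitrary: x rule: less_induct)
    case (less j)
    show ?case
    proof (cases "j < d")
      case False
      have "x * z ^ j = x * (z ^ (j - d) * z ^ d)"
        using False by (simp flip: power_add)
      also have "\<dots> = (\<Sum>i<d. ((- coeff p i / lead_coeff p) * x) * z ^ (j - d + i))"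
        unfolding zd by (simp add: sum_distrib_left power_add mult_ac)
      also have "\<dots> \<in> rv.span T"
      proof (rule rv.span_sum)
        fix i assume "i \<in> {..<d}"
        have "- coeff p i / lead_coeff p \<in> \<rat>" using p(1) by (intro Rats_divide) auto
        then obtain q where q: "- coeff p i / lead_coeff p = of_rat q" by (rule of_rat_in_Rats_E)
        have "of_rat q * x \<in> rv.span S" using rv.span_scale less.prems by blast
        then show "((- coeff p i / lead_coeff p) * x) * z ^ (j - d + i) \<in> rv.span T"
          unfolding q using \<open>i \<in> {..<d}\<close> False by (intro less.IH) auto
      qed
      finally show ?thesis .
    qed (use spanS less.prems in auto)
  qed
  have "S \<subseteq> T"
  proof
    fix s assume "s \<in> S"
    then show "s \<in> T" using \<open>d > 0\<close> unfolding T_def by (intro image_eqI[of _ _ "(s,0)"]) auto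
  qed
  moreover have "ring_basis T"
    unfolding ring_basis_def
  proof (intro conjI ballI)
    show "finite T" by (fact finT)
    show "1 \<in> T" using S \<open>S \<subseteq> T\<close> by (auto simp: ring_basis_def)
    fix s t assume "s \<in> T" "t \<in> T"
    then obtain a i b j where st: "s = a * z ^ i" "a \<in> S" "t = b * z ^ j" "b \<in> S"
      by (auto simp: T_def)
    then have "a * b \<in> rv.span S" using S by (auto simp: ring_basis_def)
    from all[OF this, of "i + j"] show "s * t \<in> rv.span T"
      unfolding st by (simp add: power_add mult_ac)
  qed
  moreover have "z \<in> rv.span T" using all[OF ring_basis_span_one[OF S], of 1] by simp
  ultimately show thesis by (intro that)
qed

lemma ex_number_field_superset:
  assumes "finite F" "F \<subseteq> Qbar"
  obtains K where "number_field K" "F \<subseteq> K"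
proof -
  have "\<exists>S. ring_basis S \<and> F \<subseteq> rv.span S"
    using assms
  proof (induction F rule: finite_induct)
    case empty
    have "ring_basis {1}" by (auto simp: ring_basis_def intro: rv.span_base)
    then show ?case by blast
  next
    case (insert z F)
    then obtain S where S: "ring_basis S" "F \<subseteq> rv.span S" by auto
    obtain T where T: "ring_basis T" "S \<subseteq> T" "z \<in> rv.span T"
      using ring_basis_adjoin[OF S(1), of z] insert.prems by auto
    then show ?case using rv.span_mono[OF T(2)] S(2) by blast
  qed
  then show thesis using that ring_basis_number_field by blast
qed

lemma number_field_Rats: "number_field \<rat>"
proof -
  have "rv.span {1} = \<rat>"
    by (auto simp: rv.span_singleton Rats_def)
  moreover have "ring_basis {1}" by (auto simp: ring_basis_def intro: rv.span_base)
  ultimately show ?thesis using ring_basis_number_field by metis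
qed

section \<open>Closure properties of subfields\<close>

lemma number_field_subfield: "number_field K \<Longrightarrow> Defs.subfield K"
  by (simp add: number_field_def)

lemma number_field_Qbar: "number_field K \<Longrightarrow> K \<subseteq> Qbar"
  by (simp add: number_field_def)

lemma subfield_closed:
  assumes "Defs.subfield K"
  shows "0 \<in> K" "1 \<in> K" "x \<in> K \<Longrightarrow> y \<in> K \<Longrightarrow> x + y \<in> K" "x \<in> K \<Longrightarrow> y \<in> K \<Longrightarrow> x * y \<in> K"
    "x \<in> K \<Longrightarrow> - x \<in> K" "x \<in> K \<Longrightarrow> inverse x \<in> K" "x \<in> K \<Longrightarrow> y \<in> K \<Longrightarrow> x - y \<in> K"
    "x \<in> K \<Longrightarrow> y \<in> K \<Longrightarrow> x / y \<in> K"
  using assms unfolding Defs.subfield_def diff_conv_add_uminus divide_inverse by blast+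

lemma subfield_power: "Defs.subfield K \<Longrightarrow> x \<in> K \<Longrightarrow> x ^ n \<in> K"
  by (induction n) (auto intro: subfield_closed)

lemma subfield_sum: "Defs.subfield K \<Longrightarrow> (\<And>i. i \<in> I \<Longrightarrow> f i \<in> K) \<Longrightarrow> (\<Sum>i\<in>I. f i) \<in> K"
  by (induction I rule: infinite_finite_induct) (auto intro: subfield_closed)

lemma subfield_prod: "Defs.subfield K \<Longrightarrow> (\<And>i. i \<in> I \<Longrightarrow> f i \<in> K) \<Longrightarrow> (\<Prod>i\<in>I. f i) \<in> K"
  by (induction I rule: infinite_finite_induct) (auto intro: subfield_closed)

lemma subfield_of_nat: "Defs.subfield K \<Longrightarrow> of_nat n \<in> K"
  by (induction n) (auto intro: subfield_closed)

lemma subfield_of_int: "Defs.subfield K \<Longrightarrow> of_int n \<in> K"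
  by (cases n) (auto intro: subfield_closed subfield_of_nat simp del: of_nat_Suc)

lemma subfield_powi: "Defs.subfield K \<Longrightarrow> x \<in> K \<Longrightarrow> x powi n \<in> K"
  by (auto simp: power_int_def intro: subfield_power subfield_closed)

lemma subfield_Rats: "Defs.subfield K \<Longrightarrow> \<rat> \<subseteq> K"
proof
  fix z :: complex assume K: "Defs.subfield K" and "z \<in> \<rat>"
  then obtain a b where "z = of_int a / of_int b" by (auto elim!: Rats_cases')
  then show "z \<in> K" using K by (auto intro: subfield_closed subfield_of_int)
qed

text \<open>Two algebraic numbers lie in a common number field, which is closed under the operations
  and consists of algebraic numbers.\<close>

lemma subfield_Qbar: "Defs.subfield Qbar"
proof -
  have "x + y \<in> Qbar \<and> x * y \<in> Qbar \<and> - x \<in> Qbar \<and> inverse x \<in> Qbar" if xy: "x \<in> Qbar" "y \<in> Qbar" for x y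
  proof -
    obtain K where K: "number_field K" "{x,y} \<subseteq> K"
      using ex_number_field_superset[of "{x,y}"] xy by auto
    note sf = number_field_subfield[OF K(1)]
    show ?thesis using K number_field_Qbar[OF K(1)] by (auto intro: subfield_closed[OF sf])
  qed
  then show ?thesis unfolding Defs.subfield_def by (auto simp: Qbar_def)
qed

section \<open>Extending partial embeddings to Galois automorphisms\<close>

text \<open>A field embedding of a subfield of \<open>Qbar\<close> is handled through its graph, a single-valued
  subring of \<open>\<complex> \<times> \<complex>\<close>.  Closure under inverses is automatic because the domain is algebraic.\<close>

definition pemb :: "(complex \<times> complex) set \<Rightarrow> bool" where
  "pemb g \<longleftrightarrow> (\<forall>x y. (x,y) \<in> g \<longrightarrow> x \<in> Qbar) \<and> (\<forall>q\<in>\<rat>. (q,q) \<in> g)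
     \<and> (\<forall>x y x' y'. (x,y) \<in> g \<longrightarrow> (x',y') \<in> g \<longrightarrow> (x + x', y + y') \<in> g \<and> (x * x', y * y') \<in> g)
     \<and> (\<forall>y. (0,y) \<in> g \<longrightarrow> y = 0)"

lemma pembD:
  assumes "pemb g"
  shows "(x,y) \<in> g \<Longrightarrow> x \<in> Qbar" "q \<in> \<rat> \<Longrightarrow> (q,q) \<in> g"
    "(x,y) \<in> g \<Longrightarrow> (x',y') \<in> g \<Longrightarrow> (x + x', y + y') \<in> g"
    "(x,y) \<in> g \<Longrightarrow> (x',y') \<in> g \<Longrightarrow> (x * x', y * y') \<in> g"
    "(0,y) \<in> g \<Longrightarrow> y = 0"
  using assms unfolding pemb_def by blast+

lemma pemb_diff:
  assumes "pemb g" "(x,y) \<in> g" "(x',y') \<in> g"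
  shows "(x - x', y - y') \<in> g"
proof -
  have "(-1,-1) \<in> g" using pembD(2)[OF assms(1)] by simp
  from pembD(4)[OF assms(1) this assms(3)] have "(- x', - y') \<in> g" by simp
  from pembD(3)[OF assms(1,2) this] show ?thesis by simp
qed

lemma pemb_unique:
  assumes "pemb g" "(x,y) \<in> g" "(x,y') \<in> g"
  shows "y = y'"
  using pembD(5)[OF assms(1), of "y - y'"] pemb_diff[OF assms] by simp

lemma pemb_poly_rat:
  assumes "pemb g" "(x,y) \<in> g" "\<And>i. coeff p i \<in> \<rat>"
  shows "(poly p x, poly p y) \<in> g"
  using assms(3)
proof (induction p)
  case 0
  then show ?case using pembD(2)[OF assms(1), of 0] by simp
next
  case (pCons a p)
  have "a \<in> \<rat>" using pCons.prems[of 0] by simp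
  moreover have "\<And>i. coeff p i \<in> \<rat>" using pCons.prems[of "Suc i" for i] by simp
  ultimately show ?case using pCons.IH by (auto intro: pembD[OF assms(1)] assms(2))
qed

lemma pemb_root:
  assumes "pemb g" "(x,y) \<in> g" "\<And>i. coeff p i \<in> \<rat>" "poly p x = 0"
  shows "poly p y = 0"
  using pemb_poly_rat[OF assms(1-3)] assms(4) pembD(5)[OF assms(1)] by simp

text \<open>The inverse of \<open>x\<close> is a rational polynomial \<open>q\<close> in
  \<open>x\<close>, and the graph is closed under rational polynomials; the image \<open>y\<close>
  then satisfies \<open>y q(y) = 1\<close>.\<close>

lemma pemb_inverse:
  assumes g: "pemb g" and xy: "(x,y) \<in> g"
  shows "(inverse x, inverse y) \<in> g"
proof (cases "x = 0")
  case True
  then have "y = 0" using pembD(5)[OF g] xy by simp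
  then show ?thesis using True xy by simp
next
  case False
  have "algebraic x" using pembD(1)[OF g xy] by (simp add: Qbar_def)
  from inverse_algebraic_eq_poly[OF this False] obtain q where
    q: "\<And>i. coeff q i \<in> \<rat>" "inverse x = poly q x" by blast
  have 1: "(inverse x, poly q y) \<in> g" using pemb_poly_rat[OF g xy q(1)] q(2) by simp
  have "(x * inverse x, y * poly q y) \<in> g" using pembD(4)[OF g xy 1] .
  then have "(1, y * poly q y) \<in> g" using False by simp
  then have "y * poly q y = 1" using pemb_unique[OF g] pembD(2)[OF g, of 1] by auto
  then have "poly q y = inverse y" by (metis inverse_unique)
  with 1 show ?thesis by simp
qed

lemma pemb_inj:
  assumes g: "pemb g" and "(x,0) \<in> g"
  shows "x = 0"
proof (rule ccontr)
  assume "x \<noteq> 0"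
  have "(x * inverse x, 0 * inverse 0) \<in> g"
    using pembD(4)[OF g assms(2) pemb_inverse[OF g assms(2)]] .
  then have "(1, 0) \<in> g" using \<open>x \<noteq> 0\<close> by simp
  then show False using pemb_unique[OF g, of 1 0 1] pembD(2)[OF g, of 1] by simp
qed

text \<open>\<open>q\<close> arises from \<open>p\<close> by applying the embedding to the
  coefficients. Carrying both polynomials as a pair postpones the passage from the graph to a
  function.\<close>

definition polypair :: "(complex \<times> complex) set \<Rightarrow> complex poly \<Rightarrow> complex poly \<Rightarrow> bool" where
  "polypair g p q \<longleftrightarrow> (\<forall>i. (coeff p i, coeff q i) \<in> g)"

lemma polypair_const: "pemb g \<Longrightarrow> (x,y) \<in> g \<Longrightarrow> polypair g [:x:] [:y:]"
  using pembD(2)[of g 0] by (auto simp: polypair_def coeff_pCons split: nat.splits)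

lemma polypair_X: "pemb g \<Longrightarrow> polypair g [:0,1:] [:0,1:]"
  using pembD(2)[of g 0] pembD(2)[of g 1] by (auto simp: polypair_def coeff_pCons split: nat.splits)

lemma polypair_add: "pemb g \<Longrightarrow> polypair g p q \<Longrightarrow> polypair g p' q' \<Longrightarrow> polypair g (p + p') (q + q')"
  by (simp add: polypair_def pembD)

lemma polypair_diff: "pemb g \<Longrightarrow> polypair g p q \<Longrightarrow> polypair g p' q' \<Longrightarrow> polypair g (p - p') (q - q')"
  by (simp add: polypair_def pemb_diff)

lemma pemb_sum:
  assumes g: "pemb g"
  shows "(\<And>i. i \<in> I \<Longrightarrow> (f i, h i) \<in> g) \<Longrightarrow> ((\<Sum>i\<in>I. f i), (\<Sum>i\<in>I. h i)) \<in> g"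
  using pembD(2)[OF g, of 0]
  by (induction I rule: infinite_finite_induct) (auto intro: pembD(3)[OF g])

lemma polypair_mult: "pemb g \<Longrightarrow> polypair g p q \<Longrightarrow> polypair g p' q' \<Longrightarrow> polypair g (p * p') (q * q')"
  unfolding polypair_def coeff_mult by (auto intro!: pemb_sum intro: pembD)

lemma polypair_monom: "pemb g \<Longrightarrow> (x,y) \<in> g \<Longrightarrow> polypair g (monom x k) (monom y k)"
  using pembD(2)[of g 0] by (auto simp: polypair_def)

text \<open>A minimal polynomial of \<open>z\<close> over the domain of \<open>g\<close>, not
  normalized to be monic, together with its image under the embedding.\<close>

definition minpair where
  "minpair g z p q \<longleftrightarrow> polypair g p q \<and> p \<noteq> 0 \<and> poly p z = 0 \<and>
     (\<forall>r s. polypair g r s \<and> r \<noteq> 0 \<and> poly r z = 0 \<longrightarrow> degree p \<le> degree r)"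

lemma ex_minpair:
  assumes g: "pemb g" and z: "z \<in> Qbar"
  shows "\<exists>p q. minpair g z p q"
proof -
  let ?A = "\<lambda>pq. polypair g (fst pq) (snd pq) \<and> fst pq \<noteq> 0 \<and> poly (fst pq) z = 0"
  obtain p where "\<And>i. coeff p i \<in> \<rat>" "p \<noteq> 0" "poly p z = 0"
    using z unfolding Qbar_def mem_Collect_eq algebraic_altdef by blast
  then have "?A (p, p)" by (simp add: polypair_def pembD[OF g])
  from ex_has_least_nat[of ?A, OF this, of "\<lambda>pq. degree (fst pq)"]
  show ?thesis unfolding minpair_def by (metis fst_conv snd_conv)
qed

lemma minpair_degree_pos: "minpair g z p q \<Longrightarrow> degree p > 0"
  unfolding minpair_def by (rule ccontr) (auto elim!: degree_eq_zeroE)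

text \<open>Long division, one leading term at a time and simultaneously on both sides:
  \<open>p\<close> divides \<open>r\<close>, hence its image \<open>q\<close> divides
  \<open>s\<close>. This makes the assignment of \<open>w\<close> to \<open>z\<close> well
  defined.\<close>

lemma minpair_root:
  assumes g: "pemb g" and m: "minpair g z p q" and w: "poly q w = 0"
    and rs: "polypair g r s" "poly r z = 0"
  shows "poly s w = 0"
  using rs
proof (induction "degree r" arbitrary: r s rule: less_induct)
  case less
  show ?case
  proof (cases "r = 0")
    case True
    then have "coeff s i = 0" for i using less.prems(1) pembD(5)[OF g] by (auto simp: polypair_def)
    then have "s = 0" by (simp add: poly_eq_iff)
    then show ?thesis by simp
  next
    case False
    have pq: "polypair g p q" and p0: "p \<noteq> 0" and pz: "poly p z = 0"
      and le: "degree p \<le> degree r"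
      using m False less.prems unfolding minpair_def by blast+
    have dp: "degree p > 0" by (rule minpair_degree_pos[OF m])
    define k where "k = degree r - degree p"
    define a where "a = lead_coeff r * inverse (lead_coeff p)"
    define a' where "a' = coeff s (degree r) * inverse (coeff q (degree p))"
    have aa: "(a, a') \<in> g" unfolding a_def a'_def
      using less.prems(1) pq by (auto simp: polypair_def intro: pembD(4)[OF g] pemb_inverse[OF g])
    define r1 where "r1 = r - monom a k * p"
    define s1 where "s1 = s - monom a' k * q"
    have 1: "polypair g r1 s1" unfolding r1_def s1_def
      by (intro polypair_diff polypair_mult polypair_monom g aa pq less.prems)
    have 2: "poly r1 z = 0" using less.prems pz by (simp add: r1_def)
    have "coeff r1 i = 0" if "i \<ge> degree r" for i
    proof (cases "i = degree r")
      case True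
      have "coeff (monom a k * p) i = a * coeff p (degree p)"
        using le True by (simp add: coeff_monom_mult k_def)
      then show ?thesis using p0 True by (simp add: r1_def a_def)
    next
      case False
      then have "coeff p (i - k) = 0" using that le by (intro coeff_eq_0) (simp add: k_def)
      moreover have "coeff r i = 0" using that False by (intro coeff_eq_0) simp
      ultimately show ?thesis by (simp add: r1_def coeff_monom_mult)
    qed
    then have "degree r1 \<le> degree r - 1" by (intro degree_le) auto
    \<comment> \<open>The degree of \<open>r\<close> is at least that of \<open>p\<close>, hence
      positive, so the natural subtraction really decreases it.\<close>
    then have "degree r1 < degree r" using dp le by linarith
    from less.hyps[OF this 1 2] show ?thesis using w by (simp add: s1_def)
  qed
qed

text \<open>When \<open>w\<close> is a root of the transported minimal polynomial of
  \<open>z\<close>, this is the graph of the extension of \<open>g\<close> that adjoins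
  \<open>z\<close> to the domain and sends \<open>z\<close> to \<open>w\<close>.\<close>

definition adj_graph :: "(complex \<times> complex) set \<Rightarrow> complex \<Rightarrow> complex \<Rightarrow> (complex \<times> complex) set" where
  "adj_graph g z w = {(poly r z, poly s w) | r s. polypair g r s}"

lemma adj_graphI: "polypair g r s \<Longrightarrow> x = poly r z \<Longrightarrow> y = poly s w \<Longrightarrow> (x,y) \<in> adj_graph g z w"
  unfolding adj_graph_def by blast

lemma pemb_adj_graph:
  assumes g: "pemb g" and z: "z \<in> Qbar" and m: "minpair g z p q" and w: "poly q w = 0"
  shows "pemb (adj_graph g z w)" "g \<subseteq> adj_graph g z w" "(z,w) \<in> adj_graph g z w"
proof -
  show sub: "g \<subseteq> adj_graph g z w"
    by (auto intro!: adj_graphI[OF polypair_const[OF g]])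
  show "(z,w) \<in> adj_graph g z w"
    by (rule adj_graphI[OF polypair_X[OF g]]) simp_all
  show "pemb (adj_graph g z w)"
    unfolding pemb_def
  proof (intro conjI allI impI ballI)
    fix x y assume "(x,y) \<in> adj_graph g z w"
    then obtain r s where "x = poly r z" "polypair g r s" by (auto simp: adj_graph_def)
    then show "x \<in> Qbar"
      by (auto intro!: poly_in_subring subfield_closed[OF subfield_Qbar] z simp: polypair_def
          dest: pembD(1)[OF g])
  next
    fix q :: complex assume "q \<in> \<rat>"
    then show "(q,q) \<in> adj_graph g z w" using sub pembD(2)[OF g] by auto
  next
    fix x y x' y' assume "(x,y) \<in> adj_graph g z w" "(x',y') \<in> adj_graph g z w"
    then obtain r s r' s' where "x = poly r z" "y = poly s w" "polypair g r s"
      "x' = poly r' z" "y' = poly s' w" "polypair g r' s'" by (auto simp: adj_graph_def)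
    then show "(x + x', y + y') \<in> adj_graph g z w" "(x * x', y * y') \<in> adj_graph g z w"
      using adj_graphI[OF polypair_add[OF g, of r s r' s']] adj_graphI[OF polypair_mult[OF g, of r s r' s']]
      by auto
  next
    fix y assume "(0,y) \<in> adj_graph g z w"
    then show "y = 0" by (auto simp: adj_graph_def intro: minpair_root[OF g m w])
  qed
qed

text \<open>An embedding is injective, so the leading coefficient survives the transport and
  \<open>q\<close> is not constant.\<close>

lemma minpair_has_root:
  assumes g: "pemb g" and m: "minpair g z p q"
  shows "\<exists>w. poly q w = 0"
proof -
  have "coeff q (degree p) \<noteq> 0"
    using m pemb_inj[OF g] by (auto simp: minpair_def polypair_def) (metis leading_coeff_0_iff)
  then have "degree q \<ge> degree p" by (rule le_degree)
  then have "degree q > 0" using minpair_degree_pos[OF m] by linarith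
  then have "\<not> constant (poly q)" by (simp add: constant_degree)
  then show ?thesis by (rule fundamental_theorem_of_algebra)
qed

text \<open>Zorn's lemma gives a maximal extension. It is defined on all of \<open>Qbar\<close>, as
  otherwise a further element could be adjoined.\<close>

theorem pemb_extends_to_GalQ:
  assumes g: "pemb g"
  obtains \<sigma> where "\<sigma> \<in> GalQ" "\<And>x y. (x,y) \<in> g \<Longrightarrow> \<sigma> x = y"
proof -
  let ?A = "{h. pemb h \<and> g \<subseteq> h}"
  have ex: "\<exists>M\<in>?A. \<forall>X\<in>?A. M \<subseteq> X \<longrightarrow> X = M"
  proof (rule subset_Zorn_nonempty)
    show "?A \<noteq> {}" using g by blast
    fix C assume C0: "C \<noteq> {}" and C: "subset.chain ?A C"
    have pC: "pemb h" "g \<subseteq> h" if "h \<in> C" for h using C that by (auto simp: subset.chain_def)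
    have lin: "\<exists>h\<in>C. a \<in> h \<and> b \<in> h" if ab: "a \<in> \<Union>C" "b \<in> \<Union>C" for a b
    proof -
      obtain h h' where h: "h \<in> C" "a \<in> h" "h' \<in> C" "b \<in> h'" using ab by blast
      then have "h \<subseteq> h' \<or> h' \<subseteq> h" using C unfolding subset.chain_def by blast
      then show ?thesis using h by blast
    qed
    have "pemb (\<Union>C)"
      unfolding pemb_def
    proof (intro conjI allI impI ballI)
      fix x y assume "(x,y) \<in> \<Union>C"
      then show "x \<in> Qbar" using pC pembD(1) by blast
    next
      fix q :: complex assume "q \<in> \<rat>"
      then show "(q,q) \<in> \<Union>C" using C0 pC pembD(2) by blast
    next
      fix x y x' y' assume "(x,y) \<in> \<Union>C" "(x',y') \<in> \<Union>C"
      then obtain h where h: "h \<in> C" "(x,y) \<in> h" "(x',y') \<in> h" using lin by blast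
      show "(x + x', y + y') \<in> \<Union>C" using pembD(3)[OF pC(1)[OF h(1)] h(2,3)] h(1) by blast
      show "(x * x', y * y') \<in> \<Union>C" using pembD(4)[OF pC(1)[OF h(1)] h(2,3)] h(1) by blast
    next
      fix y assume "(0,y) \<in> \<Union>C"
      then show "y = 0" using pC pembD(5) by blast
    qed
    moreover have "g \<subseteq> \<Union>C" using C0 pC by blast
    ultimately show "\<Union>C \<in> ?A" by blast
  qed
  obtain M where M: "pemb M" "g \<subseteq> M" and max: "\<And>X. pemb X \<Longrightarrow> M \<subseteq> X \<Longrightarrow> X = M"
  proof -
    assume *: "\<And>M. pemb M \<Longrightarrow> g \<subseteq> M \<Longrightarrow> (\<And>X. pemb X \<Longrightarrow> M \<subseteq> X \<Longrightarrow> X = M) \<Longrightarrow> thesis"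
    from ex obtain M where M: "pemb M" "g \<subseteq> M" "\<forall>X\<in>?A. M \<subseteq> X \<longrightarrow> X = M" by blast
    show thesis by (rule *[OF M(1,2)]) (use M in blast)
  qed
  have total: "\<exists>y. (z,y) \<in> M" if z: "z \<in> Qbar" for z
  proof -
    obtain p q where m: "minpair M z p q" using ex_minpair[OF M(1) z] by blast
    obtain w where w: "poly q w = 0" using minpair_has_root[OF M(1) m] by blast
    note a = pemb_adj_graph[OF M(1) z m w]
    show ?thesis using max[OF a(1,2)] a(3) by blast
  qed
  \<comment> \<open>Outside \<open>Qbar\<close> the map is the identity, the normal form that
    \<open>GalQ\<close> prescribes.\<close>
  define \<sigma> where "\<sigma> x = (if x \<in> Qbar then THE y. (x,y) \<in> M else x)" for x
  have graph: "\<sigma> x = y" if "(x,y) \<in> M" for x y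
    using that pemb_unique[OF M(1)] pembD(1)[OF M(1)] by (auto simp: \<sigma>_def intro!: the_equality)
  have in_M: "(x, \<sigma> x) \<in> M" if "x \<in> Qbar" for x using total[OF that] graph by blast
  have root: "poly p (\<sigma> x) = 0" if "x \<in> Qbar" "\<And>i. coeff p i \<in> \<rat>" "poly p x = 0" for p x
    using pemb_root[OF M(1) in_M[OF that(1)] that(2,3)] .
  have inj: "inj_on \<sigma> Qbar"
  proof (rule inj_onI)
    fix x y assume xy: "x \<in> Qbar" "y \<in> Qbar" "\<sigma> x = \<sigma> y"
    then have "(x - y, 0) \<in> M" using pemb_diff[OF M(1) in_M[OF xy(1)] in_M[OF xy(2)]] by simp
    from pemb_inj[OF M(1) this] show "x = y" by simp
  qed
  \<comment> \<open>An injective map of the finite root set of a rational polynomial into itself is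
    onto.\<close>
  have surj: "\<exists>x\<in>Qbar. \<sigma> x = y \<and> \<sigma> y \<in> Qbar" if y: "y \<in> Qbar" for y
  proof -
    obtain p where p: "\<And>i. coeff p i \<in> \<rat>" "p \<noteq> 0" "poly p y = 0"
      using y unfolding Qbar_def mem_Collect_eq algebraic_altdef by blast
    let ?R = "{x. poly p x = 0}"
    have R: "?R \<subseteq> Qbar" using p algebraicI' by (auto simp: Qbar_def)
    have fin: "finite ?R" using poly_roots_finite[OF p(2)] .
    have "\<sigma> ` ?R \<subseteq> ?R" using root R p(1) by auto
    moreover have "inj_on \<sigma> ?R" using inj R by (rule inj_on_subset)
    ultimately have "\<sigma> ` ?R = ?R" using endo_inj_surj[OF fin] by blast
    moreover have "y \<in> ?R" using p(3) by simp
    ultimately obtain x where "x \<in> ?R" "\<sigma> x = y" by (metis (no_types, lifting) imageE)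
    moreover have "\<sigma> y \<in> ?R" using \<open>\<sigma> ` ?R = ?R\<close> \<open>y \<in> ?R\<close> by blast
    ultimately show ?thesis using R by blast
  qed
  have "\<sigma> \<in> GalQ"
    unfolding GalQ_def
  proof (intro CollectI conjI ballI allI impI)
    have "\<sigma> ` Qbar = Qbar" using surj by blast
    then show "bij_betw \<sigma> Qbar Qbar" using inj unfolding bij_betw_def by blast
    fix x y assume xy: "x \<in> Qbar" "y \<in> Qbar"
    show "\<sigma> (x + y) = \<sigma> x + \<sigma> y" "\<sigma> (x * y) = \<sigma> x * \<sigma> y"
      using graph pembD(3,4)[OF M(1) in_M[OF xy(1)] in_M[OF xy(2)]] by auto
  qed (simp add: \<sigma>_def)
  then show thesis using that graph M(2) by blast
qed

section \<open>The Galois group of a number field\<close>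

definition GalOver :: "complex set \<Rightarrow> (complex \<Rightarrow> complex) set" where
  "GalOver K = {\<sigma> \<in> GalQ. \<forall>k\<in>K. \<sigma> k = k}"

section \<open>Arithmetic of Galois automorphisms\<close>

lemma GalQ_D:
  assumes "\<sigma> \<in> GalQ"
  shows "bij_betw \<sigma> Qbar Qbar" "x \<in> Qbar \<Longrightarrow> y \<in> Qbar \<Longrightarrow> \<sigma> (x + y) = \<sigma> x + \<sigma> y"
    "x \<in> Qbar \<Longrightarrow> y \<in> Qbar \<Longrightarrow> \<sigma> (x * y) = \<sigma> x * \<sigma> y" "z \<notin> Qbar \<Longrightarrow> \<sigma> z = z"
  using assms unfolding GalQ_def by blast+

lemma GalQ_Qbar: "\<sigma> \<in> GalQ \<Longrightarrow> \<sigma> x \<in> Qbar \<longleftrightarrow> x \<in> Qbar"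
  using GalQ_D(1,4)[of \<sigma>] unfolding bij_betw_def by (metis image_eqI)

lemma GalQ_inj: "\<sigma> \<in> GalQ \<Longrightarrow> \<sigma> x = \<sigma> y \<Longrightarrow> x = y"
  using GalQ_D(1,4)[of \<sigma>] GalQ_Qbar[of \<sigma>] unfolding bij_betw_def inj_on_def by metis

lemma GalQ_0: "\<sigma> \<in> GalQ \<Longrightarrow> \<sigma> 0 = 0"
  using GalQ_D(2)[of \<sigma> 0 0] subfield_closed(1)[OF subfield_Qbar] by simp

lemma GalQ_eq_0: "\<sigma> \<in> GalQ \<Longrightarrow> \<sigma> x = 0 \<longleftrightarrow> x = 0"
  using GalQ_0 GalQ_inj by metis

lemma GalQ_1: "\<sigma> \<in> GalQ \<Longrightarrow> \<sigma> 1 = 1"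
  using GalQ_D(3)[of \<sigma> 1 1] subfield_closed(2)[OF subfield_Qbar] GalQ_eq_0[of \<sigma> 1] by simp

lemma GalQ_sum: "\<sigma> \<in> GalQ \<Longrightarrow> (\<And>i. i \<in> I \<Longrightarrow> f i \<in> Qbar) \<Longrightarrow> \<sigma> (\<Sum>i\<in>I. f i) = (\<Sum>i\<in>I. \<sigma> (f i))"
  by (induction I rule: infinite_finite_induct)
     (auto simp: GalQ_0 GalQ_D subfield_sum[OF subfield_Qbar])

lemma GalQ_prod: "\<sigma> \<in> GalQ \<Longrightarrow> (\<And>i. i \<in> I \<Longrightarrow> f i \<in> Qbar) \<Longrightarrow> \<sigma> (\<Prod>i\<in>I. f i) = (\<Prod>i\<in>I. \<sigma> (f i))"
  by (induction I rule: infinite_finite_induct)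
     (auto simp: GalQ_1 GalQ_D subfield_prod[OF subfield_Qbar])

lemma GalQ_uminus: "\<sigma> \<in> GalQ \<Longrightarrow> x \<in> Qbar \<Longrightarrow> \<sigma> (- x) = - \<sigma> x"
  using GalQ_D(2)[of \<sigma> x "- x"] GalQ_0[of \<sigma>] subfield_closed(5)[OF subfield_Qbar, of x]
  by (simp add: eq_neg_iff_add_eq_0 add.commute)

lemma GalQ_inverse: "\<sigma> \<in> GalQ \<Longrightarrow> x \<in> Qbar \<Longrightarrow> \<sigma> (inverse x) = inverse (\<sigma> x)"
proof (cases "x = 0")
  case False
  assume "\<sigma> \<in> GalQ" "x \<in> Qbar"
  then have "\<sigma> x * \<sigma> (inverse x) = 1"
    using GalQ_D(3)[of \<sigma> x "inverse x"] GalQ_1[of \<sigma>] subfield_closed(6)[OF subfield_Qbar, of x] False by simp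
  then show ?thesis by (metis inverse_unique)
qed (simp add: GalQ_0)

lemma GalQ_of_nat: "\<sigma> \<in> GalQ \<Longrightarrow> \<sigma> (of_nat n) = of_nat n"
  by (induction n) (auto simp: GalQ_0 GalQ_1 GalQ_D subfield_of_nat[OF subfield_Qbar] subfield_closed[OF subfield_Qbar])

lemma GalQ_of_int: "\<sigma> \<in> GalQ \<Longrightarrow> \<sigma> (of_int n) = of_int n"
proof (cases n)
  case (neg m)
  assume "\<sigma> \<in> GalQ"
  then have "\<sigma> (- of_nat (Suc m)) = - of_nat (Suc m)"
    using GalQ_uminus GalQ_of_nat subfield_of_nat[OF subfield_Qbar] by metis
  then show ?thesis using neg by simp
qed (simp add: GalQ_of_nat)

lemma GalQ_Rats: "\<sigma> \<in> GalQ \<Longrightarrow> q \<in> \<rat> \<Longrightarrow> \<sigma> q = q"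
proof (elim Rats_cases')
  fix a b assume "\<sigma> \<in> GalQ" "q = of_int a / of_int b"
  then show "\<sigma> q = q"
    by (simp add: divide_inverse GalQ_D GalQ_of_int GalQ_inverse
        subfield_of_int[OF subfield_Qbar] subfield_closed[OF subfield_Qbar])
qed

lemma GalQ_poly:
  assumes "\<sigma> \<in> GalQ" "\<And>i. coeff p i \<in> \<rat>" "x \<in> Qbar"
  shows "\<sigma> (poly p x) = poly p (\<sigma> x)"
  using assms(2)
proof (induction p)
  case (pCons a p)
  have a: "a \<in> \<rat>" using pCons.prems[of 0] by simp
  have p: "\<And>i. coeff p i \<in> \<rat>" using pCons.prems[of "Suc i" for i] by simp
  have Qb: "poly p x \<in> Qbar"
    using p subfield_Rats[OF subfield_Qbar]
    by (auto intro!: poly_in_subring subfield_closed[OF subfield_Qbar] assms(3))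
  have aQ: "a \<in> Qbar" using a subfield_Rats[OF subfield_Qbar] by auto
  show ?case
    using pCons.IH p a aQ Qb assms
    by (simp add: GalQ_D GalQ_Rats subfield_closed[OF subfield_Qbar])
qed (simp add: GalQ_0 assms)

lemma GalQ_alg_int: "\<sigma> \<in> GalQ \<Longrightarrow> alg_int x \<Longrightarrow> alg_int (\<sigma> x)"
proof -
  assume s: "\<sigma> \<in> GalQ" and x: "alg_int x"
  obtain p :: "int poly" where p: "lead_coeff p = 1" "poly (map_poly of_int p) x = 0"
    using x unfolding alg_int_def by blast
  have "poly (map_poly of_int p) (\<sigma> x) = 0"
    using GalQ_poly[OF s, of "map_poly of_int p" x] p(2) alg_int_imp_Qbar[OF x] GalQ_0[OF s]
    by (simp add: coeff_map_poly)
  with p(1) show ?thesis unfolding alg_int_def by blast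
qed

lemma GalQ_comp:
  assumes "\<sigma> \<in> GalQ" "\<tau> \<in> GalQ"
  shows "\<sigma> \<circ> \<tau> \<in> GalQ"
  using bij_betw_trans[OF GalQ_D(1)[OF assms(2)] GalQ_D(1)[OF assms(1)]]
  by (subst GalQ_def) (auto simp: GalQ_D(2-4)[OF assms(1)] GalQ_D(2-4)[OF assms(2)] GalQ_Qbar[OF assms(2)])

text \<open>Automorphisms are the identity off \<open>Qbar\<close>, hence bijections of all complex
  numbers, and the cancellation laws hold for every \<open>x\<close>.\<close>

lemma GalQ_inv:
  assumes s: "\<sigma> \<in> GalQ"
  obtains \<tau> where "\<tau> \<in> GalQ" "\<And>x. \<tau> (\<sigma> x) = x" "\<And>x. \<sigma> (\<tau> x) = x"
proof -
  have bij: "bij \<sigma>"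
  proof (rule bijI)
    show "inj \<sigma>" using GalQ_inj[OF s] by (auto intro: injI)
    have "\<exists>x. y = \<sigma> x" for y
    proof (cases "y \<in> Qbar")
      case True
      then show ?thesis using GalQ_D(1)[OF s] unfolding bij_betw_def by blast
    next
      case False
      then show ?thesis using GalQ_D(4)[OF s, of y] by (intro exI[of _ y]) simp
    qed
    then show "surj \<sigma>" by (simp add: surj_def)
  qed
  let ?\<tau> = "inv_into UNIV \<sigma>"
  have st: "\<sigma> (?\<tau> x) = x" for x using bij by (simp add: bij_is_surj surj_f_inv_f)
  have ts: "?\<tau> (\<sigma> x) = x" for x using bij by (simp add: bij_is_inj)
  have Qb: "?\<tau> x \<in> Qbar \<longleftrightarrow> x \<in> Qbar" for x using GalQ_Qbar[OF s, of "?\<tau> x"] st by simp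
  have "?\<tau> \<in> GalQ"
    unfolding GalQ_def
  proof (intro CollectI conjI ballI allI impI)
    show "bij_betw ?\<tau> Qbar Qbar"
      by (rule bij_betw_byWitness[where f' = \<sigma>]) (use st ts Qb GalQ_Qbar[OF s] in auto)
    fix x y assume xy: "x \<in> Qbar" "y \<in> Qbar"
    show "?\<tau> (x + y) = ?\<tau> x + ?\<tau> y" "?\<tau> (x * y) = ?\<tau> x * ?\<tau> y"
      using GalQ_D(2,3)[OF s, of "?\<tau> x" "?\<tau> y"] xy Qb st ts by metis+
  next
    fix z assume "z \<notin> Qbar"
    then show "?\<tau> z = z" using GalQ_D(4)[OF s] ts by metis
  qed
  then show thesis using that st ts by blast
qed

lemma GalQ_id: "id \<in> GalQ"
  by (simp add: GalQ_def)

lemma GalOver_GalQ: "\<sigma> \<in> GalOver K \<Longrightarrow> \<sigma> \<in> GalQ"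
  by (simp add: GalOver_def)

lemma GalOver_comp: "\<sigma> \<in> GalOver K \<Longrightarrow> \<tau> \<in> GalOver K \<Longrightarrow> \<sigma> \<circ> \<tau> \<in> GalOver K"
  by (simp add: GalOver_def GalQ_comp)

lemma GalOver_id: "id \<in> GalOver K"
  by (simp add: GalOver_def GalQ_id)

lemma GalOver_inv:
  assumes "\<sigma> \<in> GalOver K"
  obtains \<tau> where "\<tau> \<in> GalOver K" "\<And>x. \<tau> (\<sigma> x) = x" "\<And>x. \<sigma> (\<tau> x) = x"
proof -
  obtain \<tau> where "\<tau> \<in> GalQ" "\<And>x. \<tau> (\<sigma> x) = x" "\<And>x. \<sigma> (\<tau> x) = x"
    using GalQ_inv[OF GalOver_GalQ[OF assms]] by blast
  moreover from this have "\<tau> \<in> GalOver K" using assms by (auto simp: GalOver_def) metis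
  ultimately show thesis using that by blast
qed

lemma GalOver_Rats: "GalOver \<rat> = GalQ"
  by (auto simp: GalOver_def GalQ_Rats)

text \<open>The minimal polynomial of an element outside \<open>K\<close> is separable, so it has a second root.\<close>

lemma fixed_by_GalOver_imp_in:
  assumes K: "Defs.subfield K" "K \<subseteq> Qbar" and x: "x \<in> Qbar"
    and fixed: "\<And>\<sigma>. \<sigma> \<in> GalOver K \<Longrightarrow> \<sigma> x = x"
  shows "x \<in> K"
proof (rule ccontr)
  assume nx: "x \<notin> K"
  define g where "g = {(k,k) | k. k \<in> K}"
  have g: "pemb g"
    unfolding pemb_def g_def using K subfield_Rats[OF K(1)] by (auto intro: subfield_closed)
  obtain p q where m: "minpair g x p q" using ex_minpair[OF g x] by blast
  have "q = p" using m by (auto simp: minpair_def polypair_def g_def poly_eq_iff)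
  note m = m[unfolded this]
  have pp: "polypair g p p" and p0: "p \<noteq> 0" and px: "poly p x = 0"
    and min: "\<And>r s. polypair g r s \<Longrightarrow> r \<noteq> 0 \<Longrightarrow> poly r x = 0 \<Longrightarrow> degree p \<le> degree r"
    using m unfolding minpair_def by blast+
  have cK: "coeff p i \<in> K" for i using pp by (auto simp: polypair_def g_def)
  have dp: "degree p > 0" by (rule minpair_degree_pos[OF m])
  \<comment> \<open>The second root comes from the cofactor \<open>r\<close>. It is nonconstant,
    since otherwise \<open>x\<close> would lie in \<open>K\<close>, and its value at
    \<open>x\<close> is that of the derivative of \<open>p\<close>, nonzero by minimality of the
    degree.\<close>
  obtain r where r: "p = [:-x, 1:] * r" using px by (auto simp: poly_eq_0_iff_dvd elim: dvdE)
  have "r \<noteq> 0" using r p0 by auto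
  then have dr: "degree p = Suc (degree r)" unfolding r by (subst degree_mult_eq) auto
  have "degree r > 0"
  proof (rule ccontr)
    assume "\<not> degree r > 0"
    then obtain c where c: "r = [:c:]" using degree_eq_zeroE by blast
    then have "p = [:- x * c, c:]" using r by simp
    then have "- x * c \<in> K" "c \<in> K" using cK[of 0] cK[of 1] by auto
    moreover have "c \<noteq> 0" using c \<open>r \<noteq> 0\<close> by auto
    moreover have "x = - ((- x * c) / c)" using \<open>c \<noteq> 0\<close> by simp
    ultimately have "x \<in> K" using subfield_closed(5,8)[OF K(1)] by metis
    then show False using nx by simp
  qed
  have "poly r x \<noteq> 0"
  proof
    assume "poly r x = 0"
    moreover have "poly (pderiv p) x = poly r x"
      unfolding r pderiv_mult by (simp add: pderiv_pCons)
    ultimately have "poly (pderiv p) x = 0" by simp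
    moreover have "polypair g (pderiv p) (pderiv p)"
      using cK subfield_of_nat[OF K(1)] subfield_closed(4)[OF K(1)]
      by (auto simp: polypair_def g_def coeff_pderiv simp del: of_nat_Suc)
    moreover have "pderiv p \<noteq> 0" using dp by (simp add: pderiv_eq_0_iff)
    ultimately have "degree p \<le> degree (pderiv p)" using min by blast
    then show False using dp by (simp add: degree_pderiv)
  qed
  have "\<not> constant (poly r)" using \<open>degree r > 0\<close> by (simp add: constant_degree)
  then obtain x' where x': "poly r x' = 0" using fundamental_theorem_of_algebra by blast
  then have "poly p x' = 0" by (simp add: r)
  note a = pemb_adj_graph[OF g x m this]
  obtain \<sigma> where s: "\<sigma> \<in> GalQ" "\<And>u v. (u,v) \<in> adj_graph g x x' \<Longrightarrow> \<sigma> u = v"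
    using pemb_extends_to_GalQ[OF a(1)] by blast
  have "\<sigma> k = k" if "k \<in> K" for k using s(2) a(2) that by (auto simp: g_def)
  then have "\<sigma> \<in> GalOver K" using s(1) by (simp add: GalOver_def)
  then have "\<sigma> x = x" by (rule fixed)
  moreover have "\<sigma> x = x'" using s(2) a(3) by blast
  ultimately show False using x' \<open>poly r x \<noteq> 0\<close> by simp
qed

section \<open>Conjugates, relative norms and the normalized logarithmic norm\<close>

text \<open>The leading coefficient \<open>c\<close> of an integer equation clears the denominator:
  multiplication by \<open>c x\<close> preserves the additive group generated by
  \<open>1, x, ..., x^(d-1)\<close>.\<close>

lemma ex_multiple_alg_int:
  assumes "x \<in> Qbar"
  obtains m :: nat where "m > 0" "alg_int (of_nat m * x)"
proof -
  obtain p :: "int poly" where p: "p \<noteq> 0" "poly (map_poly of_int p) x = 0"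
    using assms algebraicE' unfolding Qbar_def by blast
  define d where "d = degree p"
  have "d > 0"
  proof (rule ccontr)
    assume "\<not> d > 0"
    then have "degree p = 0" by (simp add: d_def)
    then obtain c where "p = [:c:]" by (elim degree_eq_zeroE)
    with p show False by (simp add: of_int_hom.map_poly_pCons_hom)
  qed
  define c where "c = lead_coeff p"
  have "0 = (\<Sum>k\<le>d. of_int (coeff p k) * x ^ k)"
    using p(2) by (simp add: poly_altdef coeff_map_poly d_def degree_map_poly)
  then have "0 = (\<Sum>k<d. of_int (coeff p k) * x ^ k) + of_int c * x ^ d"
    by (simp add: lessThan_Suc_atMost[symmetric] c_def d_def)
  then have top: "of_int c * x ^ d = (\<Sum>k<d. of_int (- coeff p k) * x ^ k)"
    by (simp add: sum_negf eq_neg_iff_add_eq_0 add.commute)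
  \<comment> \<open>The matrix of multiplication by \<open>c x\<close>: a shift multiplied by
    \<open>c\<close>, with the equation for \<open>x\<close> in the last row.\<close>
  define A where "A i j = (if Suc i = d then - coeff p j else if j = Suc i then c else 0)" for i j
  have "alg_int (of_int c * x)"
  proof (rule alg_int_eigenvector[where S = "{..<d}" and ?i0.0 = 0 and v = "\<lambda>i. x ^ i" and A = A])
    fix i assume "i \<in> {..<d}"
    show "of_int c * x * x ^ i = (\<Sum>j\<in>{..<d}. of_int (A i j) * x ^ j)"
    proof (cases "Suc i = d")
      case True
      then show ?thesis using top by (simp add: A_def mult.assoc flip: power_Suc)
    next
      case False
      then have "Suc i < d" using \<open>i \<in> {..<d}\<close> by simp
      have "(\<Sum>j\<in>{..<d}. of_int (A i j) * x ^ j) = (\<Sum>j\<in>{..<d}. if j = Suc i then of_int c * x ^ Suc i else 0)"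
        using False by (intro sum.cong) (auto simp: A_def)
      also have "\<dots> = of_int c * x ^ Suc i" using \<open>Suc i < d\<close> by (subst sum.delta) auto
      finally show ?thesis by (simp add: mult.assoc)
    qed
  qed (use \<open>d > 0\<close> in auto)
  then have "alg_int (of_nat (nat \<bar>c\<bar>) * x)"
    using alg_int_uminus[of "of_int c * x"] by (cases "c \<ge> 0") auto
  moreover have "nat \<bar>c\<bar> > 0" using p(1) by (simp add: c_def)
  ultimately show thesis by (rule that[rotated])
qed

section \<open>Galois orbits and relative norms\<close>

definition conj_orb :: "complex set \<Rightarrow> complex \<Rightarrow> complex set" where
  "conj_orb K x = (\<lambda>\<sigma>. \<sigma> x) ` GalOver K"

text \<open>The norm to \<open>K\<close> from the field generated by \<open>x\<close> over
  \<open>K\<close>, each conjugate counted once. It is not multiplicative in \<open>x\<close>;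
  dividing by the size of the orbit repairs this for additive functions of the norm.\<close>

definition relnorm :: "complex set \<Rightarrow> complex \<Rightarrow> complex" where
  "relnorm K x = (\<Prod>y\<in>conj_orb K x. y)"

lemma conj_orb_self: "x \<in> conj_orb K x"
  unfolding conj_orb_def using GalOver_id by (intro image_eqI[of _ _ id]) auto

lemma conj_orb_ne: "conj_orb K x \<noteq> {}" using conj_orb_self by blast

lemma conj_orb_Qbar: "x \<in> Qbar \<Longrightarrow> conj_orb K x \<subseteq> Qbar"
  by (auto simp: conj_orb_def GalQ_Qbar dest: GalOver_GalQ)

lemma conj_orb_nonzero: "x \<noteq> 0 \<Longrightarrow> y \<in> conj_orb K x \<Longrightarrow> y \<noteq> 0"
  by (auto simp: conj_orb_def GalQ_eq_0 dest: GalOver_GalQ)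

lemma finite_conj_orb: "x \<in> Qbar \<Longrightarrow> finite (conj_orb K x)"
proof -
  assume x: "x \<in> Qbar"
  then obtain p where p: "\<And>i. coeff p i \<in> \<rat>" "p \<noteq> 0" "poly p x = 0"
    unfolding Qbar_def mem_Collect_eq algebraic_altdef by blast
  have "conj_orb K x \<subseteq> {y. poly p y = 0}"
    using GalQ_poly[OF _ p(1) x] p(3) GalQ_0 by (auto simp: conj_orb_def dest!: GalOver_GalQ)
  then show ?thesis using poly_roots_finite[OF p(2)] finite_subset by blast
qed

lemma card_conj_orb_pos: "x \<in> Qbar \<Longrightarrow> card (conj_orb K x) > 0"
  using finite_conj_orb conj_orb_ne by (simp add: card_gt_0_iff)

lemma conj_orb_image:
  assumes "\<sigma> \<in> GalOver K"
  shows "\<sigma> ` conj_orb K x = conj_orb K x" "conj_orb K (\<sigma> x) = conj_orb K x"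
proof -
  obtain \<tau> where t: "\<tau> \<in> GalOver K" "\<And>x. \<tau> (\<sigma> x) = x" "\<And>x. \<sigma> (\<tau> x) = x"
    using GalOver_inv[OF assms] by blast
  have "\<sigma> (\<rho> x) \<in> conj_orb K x" if "\<rho> \<in> GalOver K" for \<rho>
    using GalOver_comp[OF assms that] unfolding conj_orb_def by (intro image_eqI[of _ _ "\<sigma> \<circ> \<rho>"]) auto
  moreover have "\<exists>\<rho>'\<in>GalOver K. \<rho> x = \<sigma> (\<rho>' x)" if "\<rho> \<in> GalOver K" for \<rho>
    using GalOver_comp[OF t(1) that] t(3) by (intro bexI[of _ "\<tau> \<circ> \<rho>"]) auto
  ultimately show "\<sigma> ` conj_orb K x = conj_orb K x"
    unfolding conj_orb_def by (auto simp: image_iff) 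
  have "\<rho> (\<sigma> x) \<in> conj_orb K x" if "\<rho> \<in> GalOver K" for \<rho>
    using GalOver_comp[OF that assms] unfolding conj_orb_def by (intro image_eqI[of _ _ "\<rho> \<circ> \<sigma>"]) auto
  moreover have "\<exists>\<rho>'\<in>GalOver K. \<rho> x = \<rho>' (\<sigma> x)" if "\<rho> \<in> GalOver K" for \<rho>
    using GalOver_comp[OF that t(1)] t(2) by (intro bexI[of _ "\<rho> \<circ> \<tau>"]) auto
  ultimately show "conj_orb K (\<sigma> x) = conj_orb K x"
    unfolding conj_orb_def by (auto simp: image_iff)
qed

lemma relnorm_GalOver: "\<sigma> \<in> GalOver K \<Longrightarrow> relnorm K (\<sigma> x) = relnorm K x"
  by (simp add: relnorm_def conj_orb_image)

lemma conj_orb_in: "x \<in> K \<Longrightarrow> conj_orb K x = {x}"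
  using conj_orb_self[of x K] by (auto simp: conj_orb_def GalOver_def)

lemma relnorm_in: "x \<in> K \<Longrightarrow> relnorm K x = x"
  by (simp add: relnorm_def conj_orb_in)

lemma relnorm_nonzero: "x \<in> Qbar \<Longrightarrow> x \<noteq> 0 \<Longrightarrow> relnorm K x \<noteq> 0"
  by (auto simp: relnorm_def finite_conj_orb dest: conj_orb_nonzero)

text \<open>Automorphisms over \<open>K\<close> permute the orbit and so fix the product, which then
  lies in \<open>K\<close> by the Galois correspondence.\<close>

lemma relnorm_mem:
  assumes "Defs.subfield K" "K \<subseteq> Qbar" "x \<in> Qbar"
  shows "relnorm K x \<in> K"
proof (rule fixed_by_GalOver_imp_in[OF assms(1,2)])
  show "relnorm K x \<in> Qbar" unfolding relnorm_def
    using conj_orb_Qbar[OF assms(3)] by (auto intro: subfield_prod[OF subfield_Qbar])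
  fix \<sigma> assume s: "\<sigma> \<in> GalOver K"
  have "inj_on \<sigma> (conj_orb K x)" using GalQ_inj[OF GalOver_GalQ[OF s]] by (auto intro: inj_onI)
  then have "(\<Prod>y\<in>\<sigma> ` conj_orb K x. y) = (\<Prod>y\<in>conj_orb K x. \<sigma> y)" by (simp add: prod.reindex)
  then show "\<sigma> (relnorm K x) = relnorm K x"
    using conj_orb_Qbar[OF assms(3), of K] unfolding relnorm_def conj_orb_image[OF s]
    by (subst GalQ_prod[OF GalOver_GalQ[OF s]]) auto
qed

lemma alg_int_conj_orb: "alg_int x \<Longrightarrow> y \<in> conj_orb K x \<Longrightarrow> alg_int y"
  by (auto simp: conj_orb_def intro: GalQ_alg_int GalOver_GalQ)

lemma alg_int_relnorm: "alg_int x \<Longrightarrow> alg_int (relnorm K x)"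
  unfolding relnorm_def by (auto intro: alg_int_prod alg_int_conj_orb)

text \<open>\<open>x\<close> is one of its own conjugates and the remaining factors are integral.
  Over the rationals, this makes every nonzero algebraic integer a divisor of a nonzero rational
  integer.\<close>

lemma alg_int_relnorm_div: "alg_int x \<Longrightarrow> alg_int (relnorm K x / x)"
proof -
  assume x: "alg_int x"
  have "relnorm K x = x * (\<Prod>y\<in>conj_orb K x - {x}. y)"
    unfolding relnorm_def using finite_conj_orb[OF alg_int_imp_Qbar[OF x]] conj_orb_self
    by (subst prod.remove) auto
  moreover have "alg_int (\<Prod>y\<in>conj_orb K x - {x}. y)"
    using x by (auto intro: alg_int_prod alg_int_conj_orb)
  ultimately show ?thesis by (cases "x = 0") auto
qed

text \<open>All fibres of the equivariant map \<open>\<pi>\<close> from the orbit of the pair \<open>(x,y)\<close> onto the orbit of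
  \<open>u\<close> have the same cardinality.\<close>

lemma relnorm_pair_orbit:
  fixes K :: "complex set" and x y u :: complex and \<pi> :: "complex \<times> complex \<Rightarrow> complex"
  defines "P \<equiv> (\<lambda>\<sigma>. (\<sigma> x, \<sigma> y)) ` GalOver K"
  assumes x: "x \<in> Qbar" and y: "y \<in> Qbar"
    and eqv: "\<And>\<sigma>. \<sigma> \<in> GalOver K \<Longrightarrow> \<pi> (\<sigma> x, \<sigma> y) = \<sigma> u"
  obtains k where "(\<Prod>p\<in>P. \<pi> p) = relnorm K u ^ k" "card P = k * card (conj_orb K u)"
proof -
  have "P \<subseteq> conj_orb K x \<times> conj_orb K y" by (auto simp: P_def conj_orb_def)
  then have finP: "finite P" using finite_conj_orb x y by (meson finite_SigmaI finite_subset)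
  have img: "\<pi> ` P = conj_orb K u" by (auto simp: P_def conj_orb_def eqv image_image)
  then have finu: "finite (conj_orb K u)" using finP by (metis finite_imageI)
  let ?F = "\<lambda>v. {p \<in> P. \<pi> p = v}"
  \<comment> \<open>An automorphism maps the fibre over \<open>v\<close> injectively into the fibre
    over its image; with the inverse automorphism, all fibres over the orbit of \<open>u\<close>
    become equally large.\<close>
  have le: "card (?F v) \<le> card (?F (\<sigma> v))" if s: "\<sigma> \<in> GalOver K" for \<sigma> v
  proof (rule card_inj_on_le[where f = "map_prod \<sigma> \<sigma>"])
    show "inj_on (map_prod \<sigma> \<sigma>) (?F v)"
      using GalQ_inj[OF GalOver_GalQ[OF s]] by (auto intro!: inj_onI)
    show "map_prod \<sigma> \<sigma> ` ?F v \<subseteq> ?F (\<sigma> v)"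
    proof
      fix p assume "p \<in> map_prod \<sigma> \<sigma> ` ?F v"
      then obtain \<rho> where r: "\<rho> \<in> GalOver K" "p = (\<sigma> (\<rho> x), \<sigma> (\<rho> y))" "\<rho> u = v"
        by (auto simp: P_def eqv)
      have "\<sigma> \<circ> \<rho> \<in> GalOver K" using GalOver_comp[OF s r(1)] .
      then show "p \<in> ?F (\<sigma> v)" using r eqv[of "\<sigma> \<circ> \<rho>"]
        by (auto simp: P_def intro!: image_eqI[of _ _ "\<sigma> \<circ> \<rho>"])
    qed
    show "finite (?F (\<sigma> v))" using finP by simp
  qed
  define k where "k = card (?F u)"
  have fib: "card (?F v) = k" if v: "v \<in> conj_orb K u" for v
  proof -
    obtain \<sigma> where s: "\<sigma> \<in> GalOver K" "v = \<sigma> u" using v by (auto simp: conj_orb_def)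
    obtain \<tau> where t: "\<tau> \<in> GalOver K" "\<And>x. \<tau> (\<sigma> x) = x" "\<And>x. \<sigma> (\<tau> x) = x"
      using GalOver_inv[OF s(1)] by metis
    have "\<tau> v = u" using s(2) t(2) by simp
    then have "card (?F v) \<le> card (?F u)" using le[OF t(1), of v] by metis
    moreover have "card (?F u) \<le> card (?F v)" using le[OF s(1), of u] s(2) by metis
    ultimately show ?thesis unfolding k_def by (rule le_antisym)
  qed
  have "(\<Prod>p\<in>P. \<pi> p) = (\<Prod>v\<in>conj_orb K u. \<Prod>p\<in>?F v. \<pi> p)"
    using prod.group[OF finP finu, of \<pi> \<pi>] img by simp
  also have "\<dots> = (\<Prod>v\<in>conj_orb K u. v ^ k)"
  proof (rule prod.cong)
    fix v assume v: "v \<in> conj_orb K u"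
    have "(\<Prod>p\<in>?F v. \<pi> p) = (\<Prod>p\<in>?F v. v)" by (rule prod.cong) auto
    then show "(\<Prod>p\<in>?F v. \<pi> p) = v ^ k" by (simp add: fib[OF v])
  qed simp
  finally have 1: "(\<Prod>p\<in>P. \<pi> p) = relnorm K u ^ k" by (simp add: relnorm_def prod_power_distrib)
  have "card P = (\<Sum>v\<in>conj_orb K u. \<Sum>p\<in>?F v. 1)"
    using sum.group[OF finP finu, of \<pi> "\<lambda>_. 1 :: nat"] img by simp
  also have "\<dots> = (\<Sum>v\<in>conj_orb K u. k)" by (intro sum.cong) (auto simp: fib)
  finally have 2: "card P = k * card (conj_orb K u)" by simp
  show thesis by (rule that[OF 1 2])
qed

lemma additive_power:
  fixes T :: "complex \<Rightarrow> 'a :: field_char_0"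
  assumes K: "Defs.subfield K" and T: "\<And>x y. x \<in> K - {0} \<Longrightarrow> y \<in> K - {0} \<Longrightarrow> T (x * y) = T x + T y"
    and x: "x \<in> K - {0}"
  shows "T (x ^ n) = of_nat n * T x"
proof (induction n)
  case 0
  have "T (1 * 1) = T 1 + T 1" using T[of 1 1] subfield_closed(2)[OF K] by simp
  then show ?case by simp
next
  case (Suc n)
  then show ?case using T[of x "x ^ n"] x subfield_power[OF K, of x n] by (simp add: algebra_simps)
qed

text \<open>The Galois-invariant extension to \<open>Qbar\<close> of an additive function
  \<open>T\<close> on \<open>K\<close>. It is used twice: with the logarithmic absolute value over
  the rationals, and with a truncated functional over a number field.\<close>

definition normalized_trace :: "complex set \<Rightarrow> (complex \<Rightarrow> 'a :: field_char_0) \<Rightarrow> complex \<Rightarrow> 'a" where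
  "normalized_trace K T x = T (relnorm K x) / of_nat (card (conj_orb K x))"

text \<open>The orbits of \<open>x\<close>, \<open>y\<close> and \<open>x y\<close> have different
  sizes, so all three are compared on the orbit \<open>P\<close> of the pair: there the product of
  values is a power of the respective norm, and the exponent cancels against
  \<open>card P\<close>.\<close>

lemma normalized_trace_mult:
  fixes T :: "complex \<Rightarrow> 'a :: field_char_0"
  assumes K: "Defs.subfield K" "K \<subseteq> Qbar"
    and T: "\<And>x y. x \<in> K - {0} \<Longrightarrow> y \<in> K - {0} \<Longrightarrow> T (x * y) = T x + T y"
    and xy: "x \<in> Qbar_units" "y \<in> Qbar_units"
  shows "normalized_trace K T (x * y) = normalized_trace K T x + normalized_trace K T y"
proof -
  define P where "P = (\<lambda>\<sigma>. (\<sigma> x, \<sigma> y)) ` GalOver K"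
  have x: "x \<in> Qbar" "x \<noteq> 0" and y: "y \<in> Qbar" "y \<noteq> 0" using xy by (auto simp: Qbar_units_def)
  have cardP: "card P > 0"
  proof -
    have "P \<subseteq> conj_orb K x \<times> conj_orb K y" by (auto simp: P_def conj_orb_def)
    then have "finite P" using finite_conj_orb x y by (meson finite_SigmaI finite_subset)
    moreover have "P \<noteq> {}" using GalOver_id by (auto simp: P_def)
    ultimately show ?thesis by (simp add: card_gt_0_iff)
  qed
  have key: "normalized_trace K T u = T (\<Prod>p\<in>P. \<pi> p) / of_nat (card P) \<and> (\<Prod>p\<in>P. \<pi> p) \<in> K - {0}"
    if u: "u \<in> Qbar" "u \<noteq> 0" and eqv: "\<And>\<sigma>. \<sigma> \<in> GalOver K \<Longrightarrow> \<pi> (\<sigma> x, \<sigma> y) = \<sigma> u" for u \<pi>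
  proof -
    obtain k where k: "(\<Prod>p\<in>P. \<pi> p) = relnorm K u ^ k" "card P = k * card (conj_orb K u)"
      using relnorm_pair_orbit[OF x(1) y(1) eqv] unfolding P_def by blast
    have r: "relnorm K u \<in> K - {0}" using relnorm_mem[OF K u(1)] relnorm_nonzero[OF u] by simp
    have "T (\<Prod>p\<in>P. \<pi> p) = of_nat k * T (relnorm K u)"
      unfolding k(1) by (rule additive_power[OF K(1) T r])
    moreover have "k \<noteq> 0" using k(2) cardP by auto
    ultimately show ?thesis
      using k subfield_power[OF K(1)] r by (auto simp: normalized_trace_def)
  qed
  have xyQ: "x * y \<in> Qbar" "x * y \<noteq> 0" using x y subfield_closed[OF subfield_Qbar] by auto
  have 1: "normalized_trace K T x = T (\<Prod>p\<in>P. fst p) / of_nat (card P) \<and> (\<Prod>p\<in>P. fst p) \<in> K - {0}"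
    by (rule key) (use x in auto)
  have 2: "normalized_trace K T y = T (\<Prod>p\<in>P. snd p) / of_nat (card P) \<and> (\<Prod>p\<in>P. snd p) \<in> K - {0}"
    by (rule key) (use y in auto)
  have 3: "normalized_trace K T (x * y) = T (\<Prod>p\<in>P. fst p * snd p) / of_nat (card P)
      \<and> (\<Prod>p\<in>P. fst p * snd p) \<in> K - {0}"
    by (rule key) (use xyQ x y in \<open>auto simp: GalQ_D dest: GalOver_GalQ\<close>)
  show ?thesis
    using 1 2 3 T[of "\<Prod>p\<in>P. fst p" "\<Prod>p\<in>P. snd p"] by (simp add: prod.distrib add_divide_distrib)
qed

lemma normalized_trace_in: "x \<in> K \<Longrightarrow> normalized_trace K T x = T x"
  by (simp add: normalized_trace_def conj_orb_in relnorm_in)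

lemma normalized_trace_GalOver: "\<sigma> \<in> GalOver K \<Longrightarrow> normalized_trace K T (\<sigma> x) = normalized_trace K T x"
  by (simp add: normalized_trace_def conj_orb_image relnorm_GalOver)

section \<open>Additive functions on the nonzero algebraic numbers\<close>

lemma subfield_of_Rats: "Defs.subfield \<rat>"
  using number_field_subfield[OF number_field_Rats] .

lemma Rats_Qbar: "\<rat> \<subseteq> Qbar"
  using number_field_Qbar[OF number_field_Rats] .

lemma additive_one:
  fixes f :: "complex \<Rightarrow> 'a :: field_char_0"
  assumes "\<And>x y. x \<in> Qbar_units \<Longrightarrow> y \<in> Qbar_units \<Longrightarrow> f (x * y) = f x + f y"
  shows "f 1 = 0"
  using assms[of 1 1] subfield_closed(2)[OF subfield_Qbar] by (simp add: Qbar_units_def)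

lemma Qbar_units_closed:
  "x \<in> Qbar_units \<Longrightarrow> y \<in> Qbar_units \<Longrightarrow> x * y \<in> Qbar_units"
  "x \<in> Qbar_units \<Longrightarrow> y \<in> Qbar_units \<Longrightarrow> x / y \<in> Qbar_units"
  "x \<in> Qbar_units \<Longrightarrow> inverse x \<in> Qbar_units" "1 \<in> Qbar_units"
  "x \<in> Qbar_units \<Longrightarrow> x ^ n \<in> Qbar_units"
  using subfield_closed[OF subfield_Qbar] subfield_power[OF subfield_Qbar] by (auto simp: Qbar_units_def)

lemma additive_prod:
  fixes f :: "complex \<Rightarrow> 'a :: field_char_0"
  assumes f: "\<And>x y. x \<in> Qbar_units \<Longrightarrow> y \<in> Qbar_units \<Longrightarrow> f (x * y) = f x + f y"
  shows "(\<And>i. i \<in> I \<Longrightarrow> h i \<in> Qbar_units) \<Longrightarrow> f (\<Prod>i\<in>I. h i) = (\<Sum>i\<in>I. f (h i)) \<and> (\<Prod>i\<in>I. h i) \<in> Qbar_units"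
  by (induction I rule: infinite_finite_induct)
     (auto simp: additive_one[OF f] f Qbar_units_closed)

lemma additive_relnorm:
  fixes f :: "complex \<Rightarrow> 'a :: field_char_0"
  assumes f: "\<And>x y. x \<in> Qbar_units \<Longrightarrow> y \<in> Qbar_units \<Longrightarrow> f (x * y) = f x + f y"
    and inv: "\<And>\<sigma>. \<sigma> \<in> GalOver K \<Longrightarrow> f (\<sigma> x) = f x" and x: "x \<in> Qbar_units"
  shows "f (relnorm K x) = of_nat (card (conj_orb K x)) * f x"
proof -
  have "conj_orb K x \<subseteq> Qbar_units"
    using x conj_orb_Qbar conj_orb_nonzero by (force simp: Qbar_units_def)
  then have "f (relnorm K x) = (\<Sum>y\<in>conj_orb K x. f y)"
    unfolding relnorm_def using additive_prod[OF f, of "conj_orb K x" "\<lambda>y. y"] by auto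
  also have "\<dots> = (\<Sum>y\<in>conj_orb K x. f x)" by (intro sum.cong) (auto simp: conj_orb_def inv)
  finally show ?thesis by simp
qed

text \<open>By the product formula this is minus the sum of \<open>log |x|_v\<close> over the
  non-Archimedean places of any number field containing \<open>x\<close>, a size that refers to no
  particular field.\<close>

definition lnorm :: "complex \<Rightarrow> real" where
  "lnorm = normalized_trace \<rat> (\<lambda>x. ln (cmod x))"

lemma lnorm_mult: "x \<in> Qbar_units \<Longrightarrow> y \<in> Qbar_units \<Longrightarrow> lnorm (x * y) = lnorm x + lnorm y"
  unfolding lnorm_def
  by (rule normalized_trace_mult[OF subfield_of_Rats Rats_Qbar]) (auto simp: norm_mult ln_mult)

lemma lnorm_GalQ: "\<sigma> \<in> GalQ \<Longrightarrow> lnorm (\<sigma> x) = lnorm x"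
  unfolding lnorm_def by (rule normalized_trace_GalOver) (simp add: GalOver_Rats)

lemma relnorm_Rats_Ints:
  assumes "alg_int x"
  shows "relnorm \<rat> x \<in> \<int>"
  using rational_alg_int_is_int[OF alg_int_relnorm[OF assms]]
    relnorm_mem[OF subfield_of_Rats Rats_Qbar alg_int_imp_Qbar[OF assms]] by blast

lemma cmod_Ints_ge_1: "z \<in> \<int> \<Longrightarrow> z \<noteq> 0 \<Longrightarrow> cmod z \<ge> 1"
  by (elim Ints_cases) (auto simp: norm_of_int simp flip: of_int_abs)

lemma lnorm_nonneg: "alg_int x \<Longrightarrow> x \<noteq> 0 \<Longrightarrow> lnorm x \<ge> 0"
  using cmod_Ints_ge_1[OF relnorm_Rats_Ints] relnorm_nonzero[OF alg_int_imp_Qbar]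
  unfolding lnorm_def normalized_trace_def by (intro divide_nonneg_nonneg ln_ge_zero) auto

text \<open>A vanishing value forces the rational integer \<open>N(x)\<close> to be 1 or -1, and
  then the integral element \<open>N(x) / x\<close> is the inverse of \<open>x\<close> up to
  sign.\<close>

lemma lnorm_pos:
  assumes x: "alg_int x" "x \<noteq> 0" "\<not> alg_int (inverse x)"
  shows "lnorm x > 0"
proof (rule ccontr)
  assume "\<not> lnorm x > 0"
  have xQ: "x \<in> Qbar" by (rule alg_int_imp_Qbar[OF x(1)])
  let ?r = "relnorm \<rat> x"
  have "?r \<in> \<int>" "?r \<noteq> 0" using relnorm_Rats_Ints[OF x(1)] relnorm_nonzero[OF xQ x(2)] by auto
  then have ge: "cmod ?r \<ge> 1" by (rule cmod_Ints_ge_1)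
  have "ln (cmod ?r) \<le> 0"
    using \<open>\<not> lnorm x > 0\<close> card_conj_orb_pos[OF xQ, of \<rat>] ge unfolding lnorm_def normalized_trace_def
    by (auto simp: divide_le_0_iff not_less zero_less_divide_iff)
  then have "cmod ?r = 1" using ge by (metis antisym ln_gt_zero less_le not_less)
  obtain m where m: "?r = of_int m" using \<open>?r \<in> \<int>\<close> by (elim Ints_cases)
  with \<open>cmod ?r = 1\<close> have "real_of_int \<bar>m\<bar> = 1" by (simp add: norm_of_int)
  then have "m = 1 \<or> m = - 1" by linarith
  then have "?r = 1 \<or> ?r = - 1" unfolding m by auto
  then have "alg_int (inverse x) \<or> alg_int (- inverse x)"
    using alg_int_relnorm_div[OF x(1), of \<rat>] by (auto simp: divide_inverse)
  then show False using alg_int_uminus[of "- inverse x"] x(3) by auto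
qed

lemma AUnitsD: "u \<in> AUnits \<Longrightarrow> alg_int u" "u \<in> AUnits \<Longrightarrow> u \<noteq> 0" "u \<in> AUnits \<Longrightarrow> alg_int (inverse u)"
  "u \<in> AUnits \<Longrightarrow> u \<in> Qbar_units"
  by (auto simp: AUnits_def Qbar_units_def alg_int_imp_Qbar)

lemma lnorm_unit:
  assumes "u \<in> AUnits"
  shows "lnorm u = 0"
proof -
  note u = AUnitsD[OF assms]
  have "lnorm 1 = 0" by (rule additive_one) (rule lnorm_mult)
  then have "lnorm u + lnorm (inverse u) = 0"
    using lnorm_mult[of u "inverse u"] u(2,4) Qbar_units_closed(3) by simp
  then show ?thesis using lnorm_nonneg[OF u(1,2)] lnorm_nonneg[OF u(3)] u(2) by simp
qed

text \<open>\<open>lnorm\<close> is the mean of \<open>ln |y|\<close> over the conjugates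
  \<open>y\<close> of \<open>x\<close>.\<close>

lemma lnorm_le:
  assumes x: "x \<in> Qbar_units" and B: "\<And>\<sigma>. \<sigma> \<in> GalQ \<Longrightarrow> cmod (\<sigma> x) \<le> B"
  shows "lnorm x \<le> ln B"
proof -
  have xQ: "x \<in> Qbar" "x \<noteq> 0" using x by (auto simp: Qbar_units_def)
  have nz: "y \<noteq> 0" if "y \<in> conj_orb \<rat> x" for y using conj_orb_nonzero[OF xQ(2) that] .
  have "ln (cmod (relnorm \<rat> x)) = (\<Sum>y\<in>conj_orb \<rat> x. ln (cmod y))"
    unfolding relnorm_def prod_norm[symmetric] by (rule ln_prod) (auto simp: finite_conj_orb[OF xQ(1)] nz)
  also have "\<dots> \<le> (\<Sum>y\<in>conj_orb \<rat> x. ln B)"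
  proof (rule sum_mono)
    fix y assume y: "y \<in> conj_orb \<rat> x"
    then have "cmod y \<le> B" using B by (auto simp: conj_orb_def GalOver_Rats)
    then show "ln (cmod y) \<le> ln B" using nz[OF y] by (intro ln_mono) auto
  qed
  also have "\<dots> = real (card (conj_orb \<rat> x)) * ln B" by simp
  finally show ?thesis
    unfolding lnorm_def normalized_trace_def using card_conj_orb_pos[OF xQ(1), of \<rat>]
    by (simp add: divide_le_eq mult.commute)
qed

section \<open>The ring of integers of a number field\<close>

lemma cmod_of_rat: "cmod (of_rat q) = \<bar>real_of_rat q\<bar>"
proof (cases q)
  case (Fract a b)
  then have "complex_of_rat q = of_real (real_of_rat q)" by (simp add: of_rat_rat)
  then show ?thesis by (metis norm_of_real)
qed

locale nfield =
  fixes K :: "complex set"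
  assumes nf: "number_field K"
begin

section \<open>Bases, lattices and approximation in a fixed number field\<close>

abbreviation R :: "complex set" where "R \<equiv> OK K"

lemma sf: "Defs.subfield K" using number_field_subfield[OF nf] .

lemma KQ: "K \<subseteq> Qbar" using number_field_Qbar[OF nf] .

lemma K_units: "x \<in> K \<Longrightarrow> x \<noteq> 0 \<Longrightarrow> x \<in> Qbar_units" using KQ by (auto simp: Qbar_units_def)

lemma R_iff: "x \<in> R \<longleftrightarrow> x \<in> K \<and> alg_int x" by (simp add: OK_def AInt_def)

lemma R_K: "x \<in> R \<Longrightarrow> x \<in> K" by (simp add: R_iff)

lemma R_0: "0 \<in> R" and R_1: "1 \<in> R" and R_of_int: "of_int m \<in> R" and R_of_nat: "of_nat k \<in> R"
  by (simp_all add: R_iff subfield_closed[OF sf] subfield_of_int[OF sf] subfield_of_nat[OF sf])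

lemma R_add: "x \<in> R \<Longrightarrow> y \<in> R \<Longrightarrow> x + y \<in> R"
  and R_mult: "x \<in> R \<Longrightarrow> y \<in> R \<Longrightarrow> x * y \<in> R"
  and R_diff: "x \<in> R \<Longrightarrow> y \<in> R \<Longrightarrow> x - y \<in> R"
  and R_uminus: "x \<in> R \<Longrightarrow> - x \<in> R"
  by (simp_all add: R_iff subfield_closed[OF sf] alg_int_add alg_int_mult alg_int_diff alg_int_uminus)

lemma R_power: "x \<in> R \<Longrightarrow> x ^ k \<in> R"
  by (simp add: R_iff subfield_power[OF sf] alg_int_power)

lemma R_sum: "(\<And>i. i \<in> I \<Longrightarrow> f i \<in> R) \<Longrightarrow> (\<Sum>i\<in>I. f i) \<in> R"
  by (induction I rule: infinite_finite_induct) (auto intro: R_add R_0)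

abbreviation deg :: nat where "deg \<equiv> nf_degree K"

text \<open>A rational basis of \<open>K\<close> consisting of integers, which is weaker than a
  basis of \<open>R\<close> over the rational integers.\<close>

definition int_basis :: "(nat \<Rightarrow> complex) \<Rightarrow> bool" where
  "int_basis b \<longleftrightarrow> (\<forall>i<deg. b i \<in> R)
     \<and> (\<forall>x\<in>K. \<exists>q::nat \<Rightarrow> rat. x = (\<Sum>i<deg. of_rat (q i) * b i))
     \<and> (\<forall>q::nat \<Rightarrow> rat. (\<Sum>i<deg. of_rat (q i) * b i) = 0 \<longrightarrow> (\<forall>i<deg. q i = 0))"

lemma ex_int_basis: "\<exists>b. int_basis b"
proof -
  obtain n b where "is_Qbasis K n b" using nf by (auto simp: number_field_def)
  then have "\<exists>b. is_Qbasis K deg b"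
    unfolding nf_degree_def by (intro someI_ex[of "\<lambda>n. \<exists>b. is_Qbasis K n b"]) blast
  then obtain b where b: "is_Qbasis K deg b" by blast
  have bK: "b i \<in> K" if "i < deg" for i using b that by (simp add: is_Qbasis_def)
  have uniq: "\<exists>!q :: nat \<Rightarrow> rat. (\<forall>i\<ge>deg. q i = 0) \<and> x = (\<Sum>i<deg. of_rat (q i) * b i)" if "x \<in> K" for x
    using b that by (simp add: is_Qbasis_def)
  have "\<exists>m::nat. i < deg \<longrightarrow> m > 0 \<and> alg_int (of_nat m * b i)" for i
    using ex_multiple_alg_int bK KQ by (metis subsetD)
  then obtain m :: "nat \<Rightarrow> nat" where m: "\<And>i. i < deg \<Longrightarrow> m i > 0 \<and> alg_int (of_nat (m i) * b i)"
    by metis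
  have "int_basis (\<lambda>i. of_nat (m i) * b i)"
    unfolding int_basis_def
  proof (intro conjI allI impI ballI)
    fix i assume "i < deg"
    then show "of_nat (m i) * b i \<in> R"
      using m bK by (simp add: R_iff subfield_closed[OF sf] subfield_of_nat[OF sf])
  next
    fix x assume "x \<in> K"
    then obtain q :: "nat \<Rightarrow> rat" where q: "x = (\<Sum>i<deg. of_rat (q i) * b i)" using uniq by blast
    have "x = (\<Sum>i<deg. of_rat (q i / of_nat (m i)) * (of_nat (m i) * b i))"
      unfolding q using m by (intro sum.cong) (force simp: of_rat_divide)+
    then show "\<exists>q::nat \<Rightarrow> rat. x = (\<Sum>i<deg. of_rat (q i) * (of_nat (m i) * b i))"
      by (rule exI[of _ "\<lambda>i. q i / of_nat (m i)"])
  next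
    fix q :: "nat \<Rightarrow> rat" and i
    assume z: "(\<Sum>i<deg. of_rat (q i) * (of_nat (m i) * b i)) = 0" and i: "i < deg"
    \<comment> \<open>The rescaled relation \<open>r\<close> represents 0, and so does the zero
      function; uniqueness of coordinates in \<open>is_Qbasis\<close> identifies them.\<close>
    define r where "r i = (if i < deg then q i * of_nat (m i) else 0)" for i
    have "(0::complex) = (\<Sum>i<deg. of_rat (r i) * b i)"
      unfolding z[symmetric] r_def by (intro sum.cong) (auto simp: of_rat_mult)
    moreover have "\<forall>i\<ge>deg. r i = 0" by (simp add: r_def)
    ultimately have 1: "(\<forall>i\<ge>deg. r i = 0) \<and> (0::complex) = (\<Sum>i<deg. of_rat (r i) * b i)" by blast
    have 2: "(\<forall>i\<ge>deg. (\<lambda>_. 0 :: rat) i = 0) \<and> (0::complex) = (\<Sum>i<deg. of_rat ((\<lambda>_. 0) i) * b i)" by simp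
    have "r = (\<lambda>_. 0)"
    proof -
      obtain q0 where q0: "\<forall>q. (\<forall>i\<ge>deg. q i = 0) \<and> (0::complex) = (\<Sum>i<deg. of_rat (q i) * b i) \<longrightarrow> q = q0"
        using uniq[OF subfield_closed(1)[OF sf]] by (elim ex1E) (rule that)
      have "r = q0" by (rule mp[OF spec[OF q0] 1])
      moreover have "(\<lambda>_. 0) = q0" by (rule mp[OF spec[OF q0] 2])
      ultimately show ?thesis by simp
    qed
    then have "r i = 0" by simp
    then show "q i = 0" using m[OF i] i by (simp add: r_def)
  qed
  then show ?thesis by blast
qed

definition ib :: "nat \<Rightarrow> complex" where "ib = (SOME b. int_basis b)"

lemma int_basis_ib: "int_basis ib"
  unfolding ib_def using ex_int_basis by (rule someI_ex)

lemma ib_R: "i < deg \<Longrightarrow> ib i \<in> R"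
  using int_basis_ib by (simp add: int_basis_def)

lemma ib_Qbar: "i < deg \<Longrightarrow> ib i \<in> Qbar"
  using ib_R R_K KQ by blast

lemma ib_span: assumes "x \<in> K" obtains q :: "nat \<Rightarrow> rat" where "x = (\<Sum>i<deg. of_rat (q i) * ib i)"
  using int_basis_ib assms unfolding int_basis_def by blast

lemma ib_indep: "(\<Sum>i<deg. of_rat (q i) * ib i) = 0 \<Longrightarrow> i < deg \<Longrightarrow> q i = 0"
  using int_basis_ib unfolding int_basis_def by blast

lemma deg_pos: "deg > 0"
proof (rule ccontr)
  assume "\<not> deg > 0"
  moreover obtain q :: "nat \<Rightarrow> rat" where "1 = (\<Sum>i<deg. of_rat (q i) * ib i)"
    using ib_span[OF subfield_closed(2)[OF sf]] by blast
  ultimately show False by simp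
qed

lemma of_rat_Qbar: "of_rat q \<in> Qbar"
  using Rats_Qbar by auto

lemma ib_comb_Qbar: "(\<Sum>i<deg. of_rat (q i) * ib i) \<in> Qbar"
  by (intro subfield_sum[OF subfield_Qbar] subfield_closed(4)[OF subfield_Qbar] of_rat_Qbar ib_Qbar) simp

text \<open>Conjugates depend linearly on the coordinates, and each conjugate of a basis element is
  bounded by the sum of the absolute values of all its conjugates. The summand 1 in \<open>C\<close>
  secures positivity.\<close>

lemma conj_bound:
  obtains C :: real where "C > 0"
    "\<And>q \<epsilon> \<sigma>. (\<And>i. i < deg \<Longrightarrow> \<bar>real_of_rat (q i)\<bar> \<le> \<epsilon>) \<Longrightarrow> \<sigma> \<in> GalQ
      \<Longrightarrow> cmod (\<sigma> (\<Sum>i<deg. of_rat (q i) * ib i)) \<le> C * \<epsilon>"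
proof -
  define B where "B i = (\<Sum>y\<in>conj_orb \<rat> (ib i). cmod y)" for i
  define C where "C = 1 + (\<Sum>i<deg. B i)"
  have B0: "B i \<ge> 0" for i by (simp add: B_def sum_nonneg)
  then have "C > 0" unfolding C_def by (intro add_pos_nonneg sum_nonneg) auto
  moreover have "cmod (\<sigma> (\<Sum>i<deg. of_rat (q i) * ib i)) \<le> C * \<epsilon>"
    if q: "\<And>i. i < deg \<Longrightarrow> \<bar>real_of_rat (q i)\<bar> \<le> \<epsilon>" and s: "\<sigma> \<in> GalQ" for q \<epsilon> \<sigma>
  proof -
    have e: "\<epsilon> \<ge> 0" using q[OF deg_pos] by linarith
    have cb: "cmod (\<sigma> (ib i)) \<le> B i" if "i < deg" for i
      unfolding B_def using s that
      by (intro member_le_sum finite_conj_orb ib_Qbar) (auto simp: conj_orb_def GalOver_Rats)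
    have "\<sigma> (\<Sum>i<deg. of_rat (q i) * ib i) = (\<Sum>i<deg. of_rat (q i) * \<sigma> (ib i))"
      using s by (subst GalQ_sum)
        (auto simp: GalQ_D GalQ_Rats of_rat_Qbar ib_Qbar subfield_closed[OF subfield_Qbar])
    also have "cmod \<dots> \<le> (\<Sum>i<deg. cmod (of_rat (q i) * \<sigma> (ib i)))" by (rule norm_sum)
    also have "\<dots> \<le> (\<Sum>i<deg. \<epsilon> * B i)"
    proof (rule sum_mono)
      fix i assume "i \<in> {..<deg}"
      then show "cmod (of_rat (q i) * \<sigma> (ib i)) \<le> \<epsilon> * B i"
        using q[of i] cb e by (auto simp: norm_mult cmod_of_rat simp del: abs_of_rat intro!: mult_mono)
    qed
    also have "\<dots> = (\<Sum>i<deg. B i) * \<epsilon>" by (simp add: sum_distrib_left mult.commute)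
    also have "\<dots> \<le> C * \<epsilon>" using e by (intro mult_right_mono) (auto simp: C_def)
    finally show ?thesis .
  qed
  ultimately show thesis by (rule that)
qed

text \<open>A lattice inside \<open>R\<close> that may be smaller than \<open>R\<close>; the
  constant \<open>D\<close> of \<open>hurwitz_ideal\<close> bounds the gap.\<close>

definition lat :: "complex set" where
  "lat = {(\<Sum>i<deg. of_int (z i) * ib i) | z :: nat \<Rightarrow> int. True}"

lemma lat_R: "w \<in> lat \<Longrightarrow> w \<in> R"
  by (auto simp: lat_def intro!: R_sum R_mult R_of_int ib_R)

lemma lat_mult_int: "w \<in> lat \<Longrightarrow> of_int m * w \<in> lat"
proof -
  assume "w \<in> lat"
  then obtain z :: "nat \<Rightarrow> int" where "w = (\<Sum>i<deg. of_int (z i) * ib i)" by (auto simp: lat_def)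
  then have "of_int m * w = (\<Sum>i<deg. of_int (m * z i) * ib i)" by (simp add: sum_distrib_left mult.assoc)
  then show ?thesis unfolding lat_def by (intro CollectI exI[of _ "\<lambda>i. m * z i"] conjI TrueI)
qed

text \<open>Dirichlet approximation in the coordinates with respect to an integral basis.\<close>

lemma hurwitz_approximation:
  obtains M :: nat where "M > 0"
    "\<And>x. x \<in> K \<Longrightarrow> \<exists>t\<in>{1..M}. \<exists>w\<in>lat. of_nat t * x = w \<or> lnorm (of_nat t * x - w) \<le> - ln 2"
proof -
  obtain C where C: "C > 0"
    "\<And>q \<epsilon> \<sigma>. (\<And>i. i < deg \<Longrightarrow> \<bar>real_of_rat (q i)\<bar> \<le> \<epsilon>) \<Longrightarrow> \<sigma> \<in> GalQ
      \<Longrightarrow> cmod (\<sigma> (\<Sum>i<deg. of_rat (q i) * ib i)) \<le> C * \<epsilon>"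
    using conj_bound by metis
  \<comment> \<open>With coordinates of size at most \<open>1 / N\<close>, every conjugate of the
    error is at most \<open>C / N\<close>, hence at most one half.\<close>
  obtain N :: nat where N: "real N \<ge> 2 * C" using real_arch_simple by blast
  then have N0: "N > 0" using C(1) by (cases N) auto
  have "\<exists>t\<in>{1..N ^ deg}. \<exists>w\<in>lat. of_nat t * x = w \<or> lnorm (of_nat t * x - w) \<le> - ln 2"
    if x: "x \<in> K" for x
  proof -
    obtain q :: "nat \<Rightarrow> rat" where q: "x = (\<Sum>i<deg. of_rat (q i) * ib i)" by (rule ib_span[OF x])
    \<comment> \<open>\<open>F t\<close> names the one of the \<open>N^deg\<close> subcubes of the
      unit cube that contains the fractional coordinates of \<open>t x\<close>. Among
      \<open>N^deg + 1\<close> values of \<open>t\<close> two share a subcube, and their difference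
      is the multiplier sought.\<close>
    define F where "F t = (\<lambda>i\<in>{..<deg}. nat \<lfloor>of_nat N * frac (of_nat t * q i)\<rfloor>)" for t :: nat
    have F_in: "F t \<in> {..<deg} \<rightarrow>\<^sub>E {..<N}" for t
    proof (rule PiE_I)
      fix i assume "i \<in> {..<deg}"
      have "frac (of_nat t * q i) < 1" "frac (of_nat t * q i) \<ge> 0" by (auto simp: frac_lt_1)
      then have "of_nat N * frac (of_nat t * q i) < of_nat N" "of_nat N * frac (of_nat t * q i) \<ge> 0"
        using N0 by auto
      then show "F t i \<in> {..<N}" using \<open>i \<in> {..<deg}\<close>
        by (auto simp: F_def nat_less_iff floor_less_iff)
    qed (simp add: F_def)
    have fin: "finite ({..<deg} \<rightarrow>\<^sub>E {..<N})" by (intro finite_PiE) auto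
    have "card (F ` {0..N ^ deg}) \<le> card ({..<deg} \<rightarrow>\<^sub>E {..<N})"
      using F_in by (intro card_mono fin) blast
    also have "\<dots> = N ^ deg" by (simp add: card_PiE)
    also have "\<dots> < card {0..N ^ deg}" by simp
    finally have "\<not> inj_on F {0..N ^ deg}" by (rule pigeonhole)
    then obtain t t' where tt: "t < t'" "t' \<le> N ^ deg" "F t = F t'"
      unfolding inj_on_def by (metis atLeastAtMost_iff linorder_neqE_nat)
    define s where "s = t' - t"
    define z where "z i = \<lfloor>of_nat t' * q i\<rfloor> - \<lfloor>of_nat t * q i\<rfloor>" for i
    define w where "w = (\<Sum>i<deg. of_int (z i) * ib i)"
    define r where "r i = frac (of_nat t' * q i) - frac (of_nat t * q i)" for i
    have rz: "of_nat s * q i - of_int (z i) = r i" for i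
      using tt(1) by (simp add: s_def z_def r_def frac_def of_nat_diff algebra_simps)
    have diff: "of_nat s * x - w = (\<Sum>i<deg. of_rat (r i) * ib i)"
      unfolding q w_def rz[symmetric]
      by (simp add: sum_distrib_left sum_subtractf[symmetric] of_rat_diff of_rat_mult algebra_simps)
    have small: "\<bar>real_of_rat (r i)\<bar> \<le> 1 / real N" if "i < deg" for i
    proof -
      let ?a = "of_nat N * frac (of_nat t' * q i)" and ?b = "of_nat N * frac (of_nat t * q i)"
      have "nat \<lfloor>?a\<rfloor> = nat \<lfloor>?b\<rfloor>" using fun_cong[OF tt(3), of i] that by (simp add: F_def)
      moreover have "\<lfloor>?a\<rfloor> \<ge> 0" "\<lfloor>?b\<rfloor> \<ge> 0" by auto
      ultimately have "\<lfloor>?a\<rfloor> = \<lfloor>?b\<rfloor>" by linarith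
      then have "\<bar>?a - ?b\<bar> \<le> 1" by linarith
      moreover have "?a - ?b = of_nat N * r i" by (simp add: r_def algebra_simps)
      ultimately have "of_nat N * \<bar>r i\<bar> \<le> 1" by (simp add: abs_mult)
      then have "real_of_rat (of_nat N * \<bar>r i\<bar>) \<le> real_of_rat 1" by (subst of_rat_less_eq)
      then have "real N * \<bar>real_of_rat (r i)\<bar> \<le> 1" by (simp add: of_rat_mult)
      then show ?thesis using N0 by (simp add: field_simps)
    qed
    have "w \<in> lat" unfolding w_def lat_def by blast
    moreover have "s \<in> {1..N ^ deg}" using tt by (auto simp: s_def)
    moreover have "of_nat s * x = w \<or> lnorm (of_nat s * x - w) \<le> - ln 2"
    proof (cases "of_nat s * x = w")
      case False
      have "lnorm (of_nat s * x - w) \<le> ln (1 / 2)"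
      proof (rule lnorm_le)
        show "of_nat s * x - w \<in> Qbar_units"
          using False ib_comb_Qbar[of r] by (metis diff Diff_iff Qbar_units_def eq_iff_diff_eq_0 singletonD)
        fix \<sigma> assume "\<sigma> \<in> GalQ"
        then have "cmod (\<sigma> (of_nat s * x - w)) \<le> C * (1 / real N)"
          unfolding diff using C(2) small by blast
        also have "\<dots> \<le> 1 / 2" using N N0 by (simp add: field_simps)
        finally show "cmod (\<sigma> (of_nat s * x - w)) \<le> 1 / 2" .
      qed
      then show ?thesis by (simp add: ln_div)
    qed simp
    ultimately show ?thesis by blast
  qed
  moreover have "N ^ deg > 0" using N0 by simp
  ultimately show thesis by (rule that[rotated])
qed

section \<open>Ideals of the ring of integers and their residues\<close>

definition nideal :: "complex set \<Rightarrow> bool" where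
  "nideal I \<longleftrightarrow> I \<subseteq> R \<and> 0 \<in> I \<and> (\<forall>x\<in>I. \<forall>y\<in>I. x + y \<in> I) \<and> (\<forall>a\<in>R. \<forall>x\<in>I. a * x \<in> I)"

lemma nidealD:
  assumes "nideal I"
  shows "x \<in> I \<Longrightarrow> x \<in> R" "0 \<in> I" "x \<in> I \<Longrightarrow> y \<in> I \<Longrightarrow> x + y \<in> I" "a \<in> R \<Longrightarrow> x \<in> I \<Longrightarrow> a * x \<in> I"
    "a \<in> R \<Longrightarrow> x \<in> I \<Longrightarrow> x * a \<in> I" "x \<in> I \<Longrightarrow> - x \<in> I" "x \<in> I \<Longrightarrow> y \<in> I \<Longrightarrow> x - y \<in> I"
proof -
  show *: "x \<in> I \<Longrightarrow> x \<in> R" "0 \<in> I" "x \<in> I \<Longrightarrow> y \<in> I \<Longrightarrow> x + y \<in> I"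
    "a \<in> R \<Longrightarrow> x \<in> I \<Longrightarrow> a * x \<in> I" for a x y
    using assms unfolding nideal_def by blast+
  show "a \<in> R \<Longrightarrow> x \<in> I \<Longrightarrow> x * a \<in> I" using *(4)[of a x] by (simp add: mult.commute)
  show m: "x \<in> I \<Longrightarrow> - x \<in> I" for x using *(4)[of "-1" x] R_uminus[OF R_1] by simp
  show "x \<in> I \<Longrightarrow> y \<in> I \<Longrightarrow> x - y \<in> I" using *(3)[of x "- y"] m[of y] by simp
qed

lemma nideal_R: "nideal R"
  by (auto simp: nideal_def intro: R_0 R_add R_mult)

lemma nideal_one: "nideal I \<Longrightarrow> 1 \<in> I \<Longrightarrow> I = R"
  using nidealD(1) nidealD(5)[of I _ 1] by (metis mult_1 subsetI subset_antisym)

lemma R_dvd_nat: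
  assumes "a \<in> R" "a \<noteq> 0"
  obtains m :: nat where "m > 0" "of_nat m / a \<in> R"
proof -
  have a: "alg_int a" "a \<in> K" using assms by (auto simp: R_iff)
  obtain z where z: "relnorm \<rat> a = of_int z" using relnorm_Rats_Ints[OF a(1)] by (elim Ints_cases)
  have "z \<noteq> 0" using relnorm_nonzero[OF alg_int_imp_Qbar[OF a(1)] assms(2), of \<rat>] z by auto
  have "of_int z / a \<in> R"
    using alg_int_relnorm_div[OF a(1), of \<rat>] a(2) z
    by (simp add: R_iff subfield_closed[OF sf] subfield_of_int[OF sf])
  then have "of_nat (nat \<bar>z\<bar>) / a \<in> R" using R_uminus[of "of_int z / a"] by (cases "z \<ge> 0") auto
  moreover have "nat \<bar>z\<bar> > 0" using \<open>z \<noteq> 0\<close> by simp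
  ultimately show thesis by (rule that[rotated])
qed

lemma nideal_contains_nat:
  assumes "nideal I" "I \<noteq> {0}"
  obtains m :: nat where "m > 0" "of_nat m \<in> I"
proof -
  obtain a where a: "a \<in> I" "a \<noteq> 0" using assms nidealD(2) by blast
  obtain m :: nat where m: "m > 0" "of_nat m / a \<in> R" using R_dvd_nat nidealD(1)[OF assms(1)] a by metis
  then have "of_nat m \<in> I" using nidealD(4)[OF assms(1) m(2) a(1)] a(2) by simp
  then show thesis using that m by blast
qed

text \<open>Hurwitz' bound: a single \<open>D\<close> clears the denominators of every ideal relative to a suitable
  element of almost minimal norm.\<close>

lemma hurwitz_ideal:
  obtains D :: nat where "D > 0" "\<And>x. x \<in> R \<Longrightarrow> of_nat D * x \<in> lat"
    "\<And>I. nideal I \<Longrightarrow> I \<noteq> {0} \<Longrightarrow> \<exists>y\<in>I - {0}. \<forall>x\<in>I. of_nat D * x / y \<in> R"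
proof -
  obtain M :: nat where M: "M > 0"
    "\<And>x. x \<in> K \<Longrightarrow> \<exists>t\<in>{1..M}. \<exists>w\<in>lat. of_nat t * x = w \<or> lnorm (of_nat t * x - w) \<le> - ln 2"
    using hurwitz_approximation by blast
  \<comment> \<open>Every multiplier \<open>t\<close> between 1 and \<open>M\<close> divides the
    factorial, so one \<open>D\<close> serves all approximations.\<close>
  define D where "D = (fact M :: nat)"
  have dvd: "\<exists>k. D = k * t" if "t \<in> {1..M}" for t
    using dvd_fact[of t M] that by (auto simp: D_def dvd_def mult.commute)
  have "D > 0" by (simp add: D_def)
  moreover have "of_nat D * x \<in> lat" if x: "x \<in> R" for x
  proof -
    obtain t w where t: "t \<in> {1..M}" "w \<in> lat" "of_nat t * x = w \<or> lnorm (of_nat t * x - w) \<le> - ln 2"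
      using M(2)[OF R_K[OF x]] by blast
    \<comment> \<open>The difference is integral, and a nonzero integral element has nonnegative
      \<open>lnorm\<close>, which rules out the bound \<open>- ln 2\<close>.\<close>
    have "of_nat t * x = w"
    proof (rule ccontr)
      assume ne: "of_nat t * x \<noteq> w"
      have "alg_int (of_nat t * x - w)" using x lat_R[OF t(2)] by (simp add: R_iff alg_int_diff alg_int_mult)
      then have "lnorm (of_nat t * x - w) \<ge> 0" using ne by (intro lnorm_nonneg) auto
      then show False using t(3) ne ln_gt_zero[of 2] by linarith
    qed
    obtain k where "D = k * t" using dvd[OF t(1)] by blast
    then have "of_nat D * x = of_int (int k) * w" using \<open>of_nat t * x = w\<close> by (simp add: mult.assoc)
    then show ?thesis using lat_mult_int[OF t(2), of "int k"] by simp
  qed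
  moreover have "\<exists>y\<in>I - {0}. \<forall>x\<in>I. of_nat D * x / y \<in> R" if I: "nideal I" "I \<noteq> {0}" for I
  proof -
    have alg: "alg_int y" if "y \<in> I" for y using nidealD(1)[OF I(1) that] by (simp add: R_iff)
    \<comment> \<open>Coming within \<open>ln 2\<close> of the infimum is enough: multiplying
      \<open>y\<close> by a nonzero approximation error lowers \<open>lnorm\<close> by at least
      \<open>ln 2\<close>, and the result would be a nonzero element of \<open>I\<close> below the
      infimum.\<close>
    define m where "m = Inf (lnorm ` (I - {0}))"
    have ne: "I - {0} \<noteq> {}" using I nidealD(2) by blast
    have bdd: "bdd_below (lnorm ` (I - {0}))"
      using lnorm_nonneg alg by (intro bdd_belowI[of _ 0]) auto
    have "m < m + ln 2" by simp
    then obtain y where y: "y \<in> I - {0}" "lnorm y < m + ln 2"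
    proof -
      have "lnorm ` (I - {0}) \<noteq> {}" using ne by blast
      then obtain u where "u \<in> lnorm ` (I - {0})" "u < m + ln 2"
        using cInf_lessD[of "lnorm ` (I - {0})" "m + ln 2"] \<open>m < m + ln 2\<close> unfolding m_def by blast
      then show ?thesis using that by blast
    qed
    have yR: "y \<in> R" "y \<noteq> 0" "y \<in> I" using y nidealD(1)[OF I(1)] by auto
    have "of_nat D * x / y \<in> R" if x: "x \<in> I" for x
    proof -
      have xR: "x \<in> R" using nidealD(1)[OF I(1) x] .
      then have "x / y \<in> K" using yR R_K by (simp add: subfield_closed[OF sf])
      then obtain t w where t: "t \<in> {1..M}" "w \<in> lat"
        "of_nat t * (x / y) = w \<or> lnorm (of_nat t * (x / y) - w) \<le> - ln 2"
        using M(2) by blast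
      have wR: "w \<in> R" using lat_R t(2) by blast
      have "of_nat t * (x / y) = w"
      proof (rule ccontr)
        assume nw: "of_nat t * (x / y) \<noteq> w"
        let ?u = "of_nat t * (x / y) - w"
        have eq: "?u * y = of_nat t * x - w * y" using yR(2) by (simp add: field_simps)
        have uI: "?u * y \<in> I - {0}"
        proof -
          have "of_nat t * x - w * y \<in> I"
            by (intro nidealD(7)[OF I(1)] nidealD(4)[OF I(1)] R_of_nat wR x yR)
          moreover have "?u * y \<noteq> 0" using nw yR by simp
          ultimately show ?thesis unfolding eq by simp
        qed
        have "?u \<in> K"
          by (intro subfield_closed(4,7)[OF sf] subfield_of_nat[OF sf] \<open>x / y \<in> K\<close> R_K[OF wR])
        then have "lnorm (?u * y) = lnorm ?u + lnorm y"
          using nw yR R_K K_units by (intro lnorm_mult) auto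
        moreover have "lnorm ?u \<le> - ln 2" using t(3) nw by blast
        ultimately have "lnorm (?u * y) < m" using y(2) by linarith
        moreover have "m \<le> lnorm (?u * y)"
          unfolding m_def using uI by (intro cInf_lower bdd) blast
        ultimately show False by linarith
      qed
      moreover obtain k where "D = k * t" using dvd[OF t(1)] by blast
      ultimately have "of_nat D * x / y = of_nat k * w" by (simp add: mult.assoc flip: times_divide_eq_right)
      then show ?thesis using R_mult[OF R_of_nat wR] by simp
    qed
    then show ?thesis using y(1) by blast
  qed
  ultimately show thesis by (rule that)
qed

text \<open>\<open>D x\<close> lies in the lattice, and its coordinates modulo \<open>m D\<close>
  determine \<open>x\<close> modulo \<open>m\<close>; one representative is kept for each of the
  finitely many coordinate vectors.\<close>

lemma finite_residues_nat:
  assumes "m > 0"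
  obtains S where "finite S" "S \<subseteq> R" "\<And>x. x \<in> R \<Longrightarrow> \<exists>s\<in>S. (x - s) / of_nat m \<in> R"
proof -
  obtain D :: nat where D: "D > 0" "\<And>x. x \<in> R \<Longrightarrow> of_nat D * x \<in> lat" using hurwitz_ideal by metis
  have "\<forall>x\<in>R. \<exists>z::nat \<Rightarrow> int. of_nat D * x = (\<Sum>i<deg. of_int (z i) * ib i)"
    using D(2) unfolding lat_def by blast
  then obtain Z :: "complex \<Rightarrow> nat \<Rightarrow> int" where Z: "\<And>x. x \<in> R \<Longrightarrow> of_nat D * x = (\<Sum>i<deg. of_int (Z x i) * ib i)"
    by metis
  define F where "F x = (\<lambda>i\<in>{..<deg}. Z x i mod int (m * D))" for x
  define S where "S = inv_into R F ` (F ` R)"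
  have "F ` R \<subseteq> {..<deg} \<rightarrow>\<^sub>E {0..<int (m * D)}"
    using assms D(1) by (auto simp: F_def PiE_def Pi_def extensional_def)
  moreover have "finite ({..<deg} \<rightarrow>\<^sub>E {0..<int (m * D)})" by (intro finite_PiE) auto
  ultimately have "finite (F ` R)" by (rule finite_subset)
  then have "finite S" by (simp add: S_def)
  moreover have "S \<subseteq> R" by (auto simp: S_def intro: inv_into_into)
  moreover have "\<exists>s\<in>S. (x - s) / of_nat m \<in> R" if x: "x \<in> R" for x
  proof -
    define s where "s = inv_into R F (F x)"
    have s: "s \<in> S" "s \<in> R" "F s = F x"
      using x by (auto simp: S_def s_def intro: inv_into_into f_inv_into_f)
    have "\<exists>k. Z x i - Z s i = int (m * D) * k" if "i < deg" for i
    proof -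
      have "Z x i mod int (m * D) = Z s i mod int (m * D)"
        using fun_cong[OF s(3), of i] that by (simp add: F_def)
      then show ?thesis by (metis dvdE mod_eq_dvd_iff)
    qed
    then obtain k where k: "\<And>i. i < deg \<Longrightarrow> Z x i - Z s i = int (m * D) * k i" by metis
    have "of_nat D * (x - s) = (\<Sum>i<deg. of_int (Z x i - Z s i) * ib i)"
      using Z[OF x] Z[OF s(2)] by (simp add: algebra_simps sum_subtractf)
    also have "\<dots> = (\<Sum>i<deg. of_nat (m * D) * (of_int (k i) * ib i))"
      using k by (intro sum.cong) auto
    also have "\<dots> = of_nat D * (of_nat m * (\<Sum>i<deg. of_int (k i) * ib i))"
      by (simp add: sum_distrib_left mult_ac)
    finally have "x - s = of_nat m * (\<Sum>i<deg. of_int (k i) * ib i)" using D(1) by simp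
    then have "(x - s) / of_nat m = (\<Sum>i<deg. of_int (k i) * ib i)" using assms by simp
    then have "(x - s) / of_nat m \<in> lat" unfolding lat_def by blast
    then show ?thesis using lat_R s(1) by blast
  qed
  ultimately show thesis by (rule that)
qed

lemma finite_residues:
  assumes "nideal I" "I \<noteq> {0}"
  obtains S where "finite S" "S \<subseteq> R" "\<And>x. x \<in> R \<Longrightarrow> \<exists>s\<in>S. x - s \<in> I"
proof -
  obtain m :: nat where m: "m > 0" "of_nat m \<in> I" using nideal_contains_nat[OF assms] by blast
  obtain S where S: "finite S" "S \<subseteq> R" "\<And>x. x \<in> R \<Longrightarrow> \<exists>s\<in>S. (x - s) / of_nat m \<in> R"
    using finite_residues_nat[OF m(1)] by blast
  have "\<exists>s\<in>S. x - s \<in> I" if x: "x \<in> R" for x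
  proof -
    obtain s where s: "s \<in> S" "(x - s) / of_nat m \<in> R" using S(3)[OF x] by blast
    then have "x - s \<in> I" using nidealD(4)[OF assms(1) s(2) m(2)] m(1) by simp
    then show ?thesis using s by blast
  qed
  then show thesis using that S by blast
qed

text \<open>Such an ideal contains a fixed positive integer \<open>m\<close>, so it is a union of
  residue classes modulo \<open>m\<close> and is determined by the representatives in
  \<open>S\<close> that it contains.\<close>

lemma finite_ideals_containing:
  assumes "a \<in> R" "a \<noteq> 0"
  shows "finite {I. nideal I \<and> a \<in> I}"
proof -
  obtain m :: nat where m: "m > 0" "of_nat m / a \<in> R" using R_dvd_nat[OF assms] by blast
  obtain S where S: "finite S" "S \<subseteq> R" "\<And>x. x \<in> R \<Longrightarrow> \<exists>s\<in>S. (x - s) / of_nat m \<in> R"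
    using finite_residues_nat[OF m(1)] by blast
  have m_in: "of_nat m \<in> I" if "nideal I" "a \<in> I" for I
    using nidealD(4)[OF that(1) m(2) that(2)] assms(2) by simp
  have "inj_on (\<lambda>I. I \<inter> S) {I. nideal I \<and> a \<in> I}"
  proof (rule inj_onI)
    fix I J assume I: "I \<in> {I. nideal I \<and> a \<in> I}" and J: "J \<in> {I. nideal I \<and> a \<in> I}" and eq: "I \<inter> S = J \<inter> S"
    have sub: "I \<subseteq> J" if I: "nideal I" "a \<in> I" and J: "nideal J" "a \<in> J" and eq: "I \<inter> S = J \<inter> S" for I J
    proof
      fix x assume x: "x \<in> I"
      then obtain s where s: "s \<in> S" "(x - s) / of_nat m \<in> R" using S(3) nidealD(1)[OF I(1)] by blast
      then have d: "x - s \<in> L" if "nideal L" "a \<in> L" for L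
        using nidealD(4)[OF that(1) s(2) m_in[OF that]] m(1) by simp
      have "x - (x - s) \<in> I" using nidealD(7)[OF I(1) x d[OF I]] .
      then have "s \<in> J" using eq s(1) by auto
      then have "(x - s) + s \<in> J" using nidealD(3)[OF J(1) d[OF J]] by blast
      then show "x \<in> J" by simp
    qed
    show "I = J" using sub[of I J] sub[of J I] I J eq by blast
  qed
  moreover have "(\<lambda>I. I \<inter> S) ` {I. nideal I \<and> a \<in> I} \<subseteq> Pow S" by blast
  ultimately show ?thesis using S(1) by (meson finite_Pow_iff finite_imageD finite_subset)
qed

text \<open>Integrality criterion: two powers of \<open>x\<close> agree modulo \<open>R\<close>, which is a monic equation.\<close>

lemma R_if_stabilizes:
  assumes x: "x \<in> K" and I: "nideal I" "I \<noteq> {0}" and st: "\<And>y. y \<in> I \<Longrightarrow> x * y \<in> I"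
  shows "x \<in> R"
proof -
  obtain m :: nat where m: "m > 0" "of_nat m \<in> I" using nideal_contains_nat[OF I] by blast
  \<comment> \<open>The powers of \<open>x\<close> have the common denominator \<open>m\<close>, so
    they fall into finitely many classes modulo \<open>R\<close>.\<close>
  have pw: "x ^ k * of_nat m \<in> I" for k
    by (induction k) (use m st in \<open>auto simp: mult.assoc\<close>)
  obtain S where S: "finite S" "S \<subseteq> R" "\<And>x. x \<in> R \<Longrightarrow> \<exists>s\<in>S. (x - s) / of_nat m \<in> R"
    using finite_residues_nat[OF m(1)] by blast
  have "\<forall>k. \<exists>s\<in>S. (x ^ k * of_nat m - s) / of_nat m \<in> R"
    using S(3) nidealD(1)[OF I(1) pw] by blast
  then obtain s where s: "\<And>k. s k \<in> S" "\<And>k. (x ^ k * of_nat m - s k) / of_nat m \<in> R" by metis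
  have "\<not> inj_on s UNIV"
  proof
    assume "inj_on s UNIV"
    moreover have "finite (range s)" using S(1) s(1) by (meson finite_subset image_subsetI)
    ultimately show False using finite_imageD infinite_UNIV_nat by blast
  qed
  then obtain k l where kl: "k < l" "s k = s l" unfolding inj_on_def by (metis linorder_neqE_nat)
  have "x ^ l - x ^ k = (x ^ l * of_nat m - s l) / of_nat m - (x ^ k * of_nat m - s k) / of_nat m"
    using kl(2) m(1) by (simp add: field_simps)
  then have d: "x ^ l - x ^ k \<in> R" using R_diff s(2) by metis
  define q :: "int poly" where "q = monom 1 l - monom 1 k"
  have "degree (monom (1::int) k) < degree (monom (1::int) l)" using kl by (simp add: degree_monom_eq)
  then have dq: "degree q = l" unfolding q_def diff_conv_add_uminus
    by (subst degree_add_eq_left) (auto simp: degree_monom_eq)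
  have lc: "lead_coeff q = 1" unfolding dq using kl by (simp add: q_def)
  have "poly (map_poly of_int q) x = x ^ l - x ^ k"
    by (simp add: q_def of_int_poly_hom.hom_minus poly_monom map_poly_monom)
  then have "alg_int (poly (map_poly of_int q) x)" using d by (simp add: R_iff)
  then have "alg_int x" by (rule alg_int_if_monic_value[OF _ lc]) (use dq kl(1) in simp)
  then show ?thesis using x by (simp add: R_iff)
qed

section \<open>Torsion of the ideal class group\<close>

lemma idm_memI: "a \<in> I \<Longrightarrow> b \<in> J \<Longrightarrow> a * b \<in> ideal_mult I J"
  unfolding ideal_mult_def
  by (intro CollectI exI[of _ 1] exI[of _ "\<lambda>_. a"] exI[of _ "\<lambda>_. b"]) auto

text \<open>The induction principle for ideal products: a set closed under addition need only be
  tested on products of two elements. Nearly all inclusions between ideal products below are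
  obtained in this way.\<close>

lemma idm_subset:
  assumes "0 \<in> M" "\<And>x y. x \<in> M \<Longrightarrow> y \<in> M \<Longrightarrow> x + y \<in> M" "\<And>a b. a \<in> I \<Longrightarrow> b \<in> J \<Longrightarrow> a * b \<in> M"
  shows "ideal_mult I J \<subseteq> M"
proof
  fix x assume "x \<in> ideal_mult I J"
  then obtain n :: nat and a b where ab: "\<forall>i<n. a i \<in> I \<and> b i \<in> J" "x = (\<Sum>i<n. a i * b i)"
    unfolding ideal_mult_def by blast
  have "(\<Sum>i<m. a i * b i) \<in> M" if "m \<le> n" for m
    using that by (induction m) (use assms ab in auto)
  then show "x \<in> M" using ab(2) by auto
qed

lemma idm_zero: "0 \<in> ideal_mult I J"
  unfolding ideal_mult_def by (intro CollectI exI[of _ 0]) auto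

lemma idm_add:
  assumes x: "x \<in> ideal_mult I J" and y: "y \<in> ideal_mult I J"
  shows "x + y \<in> ideal_mult I J"
proof -
  have add1: "z + c * d \<in> ideal_mult I J" if z: "z \<in> ideal_mult I J" and cd: "c \<in> I" "d \<in> J" for z c d
  proof -
    obtain n :: nat and a b where ab: "\<forall>i<n. a i \<in> I \<and> b i \<in> J" "z = (\<Sum>i<n. a i * b i)"
      using z unfolding ideal_mult_def by blast
    have "z + c * d = (\<Sum>i<Suc n. (a(n := c)) i * (b(n := d)) i)" by (simp add: ab(2))
    moreover have "\<forall>i<Suc n. (a(n := c)) i \<in> I \<and> (b(n := d)) i \<in> J" using ab(1) cd by auto
    ultimately show ?thesis unfolding ideal_mult_def by blast
  qed
  obtain n :: nat and a b where ab: "\<forall>i<n. a i \<in> I \<and> b i \<in> J" "y = (\<Sum>i<n. a i * b i)"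
    using y unfolding ideal_mult_def by blast
  have "x + (\<Sum>i<m. a i * b i) \<in> ideal_mult I J" if "m \<le> n" for m
    using that
  proof (induction m)
    case (Suc m)
    then show ?case using add1[of "x + (\<Sum>i<m. a i * b i)" "a m" "b m"] ab(1) by (simp add: add.assoc)
  qed (simp add: x)
  then show ?thesis using ab(2) by auto
qed

lemma idm_comm: "ideal_mult I J = ideal_mult J I"
proof -
  have "ideal_mult I J \<subseteq> ideal_mult J I" for I J
    by (rule idm_subset) (auto intro: idm_zero idm_add, metis idm_memI mult.commute)
  then show ?thesis by blast
qed

lemma idm_nideal:
  assumes "nideal I" "nideal J"
  shows "nideal (ideal_mult I J)"
proof -
  have "ideal_mult I J \<subseteq> R"
    by (rule idm_subset) (auto intro: R_0 R_add R_mult nidealD assms)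
  moreover have "a * x \<in> ideal_mult I J" if a: "a \<in> R" and x: "x \<in> ideal_mult I J" for a x
  proof -
    have "ideal_mult I J \<subseteq> {x. a * x \<in> ideal_mult I J}"
    proof (rule idm_subset)
      fix b c assume "b \<in> I" "c \<in> J"
      then have "(a * b) * c \<in> ideal_mult I J" using nidealD(4)[OF assms(1) a] by (intro idm_memI)
      then show "b * c \<in> {x. a * x \<in> ideal_mult I J}" by (simp add: mult.assoc)
    qed (auto simp: idm_zero distrib_left intro: idm_add)
    then show ?thesis using x by blast
  qed
  ultimately show ?thesis unfolding nideal_def by (auto intro: idm_zero idm_add)
qed

lemma idm_R:
  assumes "nideal I" shows "ideal_mult R I = I"
proof
  show "ideal_mult R I \<subseteq> I" by (rule idm_subset) (auto intro: nidealD[OF assms])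
  show "I \<subseteq> ideal_mult R I" using idm_memI[OF R_1] by force
qed

lemma idm_assoc: "ideal_mult (ideal_mult I J) M = ideal_mult I (ideal_mult J M)"
proof
  show "ideal_mult (ideal_mult I J) M \<subseteq> ideal_mult I (ideal_mult J M)"
  proof (rule idm_subset)
    fix z m assume z: "z \<in> ideal_mult I J" and m: "m \<in> M"
    have "ideal_mult I J \<subseteq> {z. z * m \<in> ideal_mult I (ideal_mult J M)}"
      by (rule idm_subset) (auto simp: idm_zero distrib_right mult.assoc intro: idm_add idm_memI m)
    then show "z * m \<in> ideal_mult I (ideal_mult J M)" using z by blast
  qed (auto intro: idm_zero idm_add)
  show "ideal_mult I (ideal_mult J M) \<subseteq> ideal_mult (ideal_mult I J) M"
  proof (rule idm_subset)
    fix i z assume z: "z \<in> ideal_mult J M" and i: "i \<in> I"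
    have "ideal_mult J M \<subseteq> {z. i * z \<in> ideal_mult (ideal_mult I J) M}"
      by (rule idm_subset) (auto simp: idm_zero distrib_left mult.assoc[symmetric] intro: idm_add idm_memI i)
    then show "i * z \<in> ideal_mult (ideal_mult I J) M" using z by blast
  qed (auto intro: idm_zero idm_add)
qed

lemma idm_subset_left: "nideal I \<Longrightarrow> nideal J \<Longrightarrow> ideal_mult I J \<subseteq> I"
  by (rule idm_subset) (auto intro: nidealD)

text \<open>The generators stay fixed while the coefficient set \<open>A\<close> varies:
  \<open>R\<close> for the module itself, \<open>J\<close> for its multiple by the ideal
  \<open>J\<close>.\<close>

definition spanR :: "complex set \<Rightarrow> complex set \<Rightarrow> complex set" where
  "spanR A G = {(\<Sum>g\<in>G. c g * g) | c. \<forall>g\<in>G. c g \<in> A}"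

lemma spanR_add:
  assumes "nideal A" "x \<in> spanR A G" "y \<in> spanR A G"
  shows "x + y \<in> spanR A G"
proof -
  obtain c d where "\<forall>g\<in>G. c g \<in> A" "\<forall>g\<in>G. d g \<in> A" "x = (\<Sum>g\<in>G. c g * g)" "y = (\<Sum>g\<in>G. d g * g)"
    using assms by (auto simp: spanR_def)
  then have "x + y = (\<Sum>g\<in>G. (\<lambda>g. c g + d g) g * g)" "\<forall>g\<in>G. (\<lambda>g. c g + d g) g \<in> A"
    by (auto simp: sum.distrib distrib_right intro: nidealD[OF assms(1)])
  then show ?thesis unfolding spanR_def by (intro CollectI exI[of _ "\<lambda>g. c g + d g"]) simp
qed

lemma spanR_scale:
  assumes "\<And>r. r \<in> A \<Longrightarrow> b * r \<in> B" "x \<in> spanR A G"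
  shows "b * x \<in> spanR B G"
proof -
  obtain c where "\<forall>g\<in>G. c g \<in> A" "x = (\<Sum>g\<in>G. c g * g)"
    using assms by (auto simp: spanR_def)
  then have "b * x = (\<Sum>g\<in>G. (\<lambda>g. b * c g) g * g)" "\<forall>g\<in>G. (\<lambda>g. b * c g) g \<in> B"
    by (auto simp: sum_distrib_left mult.assoc intro: assms)
  then show ?thesis unfolding spanR_def by (intro CollectI exI[of _ "\<lambda>g. b * c g"]) simp
qed

lemma spanR_zero: "nideal A \<Longrightarrow> 0 \<in> spanR A G"
  unfolding spanR_def by (intro CollectI exI[of _ "\<lambda>_. 0"]) (auto intro: nidealD)

lemma spanR_insertE:
  assumes "x \<in> spanR A (insert g G)" "finite G" "g \<notin> G"
  obtains a t where "a \<in> A" "t \<in> spanR A G" "x = a * g + t"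
proof -
  obtain c where c: "\<forall>g\<in>insert g G. c g \<in> A" "x = (\<Sum>g\<in>insert g G. c g * g)"
    using assms by (auto simp: spanR_def)
  then have "x = c g * g + (\<Sum>g\<in>G. c g * g)" using assms by simp
  moreover have "(\<Sum>g\<in>G. c g * g) \<in> spanR A G" unfolding spanR_def using c(1) by blast
  ultimately show thesis using that c(1) by blast
qed

text \<open>Nakayama's lemma, by eliminating the generators one at a time.\<close>

lemma nakayama_generators:
  assumes I: "nideal I" "I \<noteq> {0}" and J: "nideal J" and IJ: "I \<subseteq> ideal_mult I J"
  shows "finite G \<Longrightarrow> G \<subseteq> I \<Longrightarrow> e \<in> J \<Longrightarrow> (\<And>x. x \<in> I \<Longrightarrow> (1 - e) * x \<in> spanR R G) \<Longrightarrow> 1 \<in> J"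
proof (induction G arbitrary: e rule: finite_induct)
  case empty
  obtain x where "x \<in> I" "x \<noteq> 0" using I nidealD(2) by blast
  then have "(1 - e) * x = 0" using empty(3)[of x] by (simp add: spanR_def)
  then have "e = 1" using \<open>x \<noteq> 0\<close> by simp
  then show ?case using empty by simp
next
  case (insert g G)
  have inJ: "(1 - e) * x \<in> spanR J (insert g G)" if x: "x \<in> I" for x
  proof -
    have "ideal_mult I J \<subseteq> {x. (1 - e) * x \<in> spanR J (insert g G)}"
    proof (rule idm_subset)
      fix a b assume a: "a \<in> I" and b: "b \<in> J"
      have "b * ((1 - e) * a) \<in> spanR J (insert g G)"
        by (rule spanR_scale[OF _ insert.prems(3)[OF a]]) (rule nidealD(5)[OF J _ b])
      then show "a * b \<in> {x. (1 - e) * x \<in> spanR J (insert g G)}" by (simp add: mult_ac)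
    qed (auto simp: distrib_left spanR_zero[OF J] intro: spanR_add[OF J])
    then show ?thesis using IJ x by blast
  qed
  have eR: "e \<in> R" using nidealD(1)[OF J insert.prems(2)] .
  have gI: "g \<in> I" using insert.prems by simp
  obtain a t where at: "a \<in> J" "t \<in> spanR J G" "(1 - e) * g = a * g + t"
    using spanR_insertE[OF inJ[OF gI] insert.hyps(1,2)] by metis
  have aR: "a \<in> R" using nidealD(1)[OF J at(1)] .
  have tR: "t \<in> spanR R G" using spanR_scale[of J 1 R t G] at(2) nidealD(1)[OF J] by simp
  \<comment> \<open>Chosen so that \<open>1 - e' = (1 - e) (1 - e - a)\<close>. The second factor
    sends \<open>g\<close> to the combination \<open>t\<close> of the remaining generators, which
    eliminates \<open>g\<close>.\<close>
  define e' where "e' = e + (e + a) * (1 - e)"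
  have "e' \<in> J" unfolding e'_def
    by (intro nidealD(3,5)[OF J] insert.prems(2) at(1) R_diff R_1 eR)
  moreover have "(1 - e') * x \<in> spanR R G" if x: "x \<in> I" for x
  proof -
    obtain r t' where rt: "r \<in> R" "t' \<in> spanR R G" "(1 - e) * x = r * g + t'"
      using spanR_insertE[OF insert.prems(3)[OF x] insert.hyps(1,2)] by metis
    have "(1 - e') * x = (1 - e - a) * ((1 - e) * x)" by (simp add: e'_def algebra_simps)
    also have "\<dots> = r * ((1 - e) * g - a * g) + (1 - e - a) * t'" unfolding rt by (simp add: algebra_simps)
    also have "\<dots> = r * t + (1 - e - a) * t'" unfolding at(3) by simp
    also have "\<dots> \<in> spanR R G"
      by (intro spanR_add[OF nideal_R] spanR_scale[OF _ tR] spanR_scale[OF _ rt(2)] R_mult R_diff R_1 eR aR rt(1))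
    finally show ?thesis .
  qed
  ultimately show ?case using insert.IH[of e'] insert.prems(1) by blast
qed

text \<open>The generators are \<open>m\<close> together with the residues modulo \<open>m\<close>
  that lie in \<open>I\<close>; the elimination starts with \<open>e = 0\<close>. The result acts as
  a cancellation law for ideals.\<close>

lemma nakayama:
  assumes I: "nideal I" "I \<noteq> {0}" and J: "nideal J" and IJ: "I \<subseteq> ideal_mult I J"
  shows "1 \<in> J"
proof -
  obtain m :: nat where m: "m > 0" "of_nat m \<in> I" using nideal_contains_nat[OF I] by blast
  obtain S where S: "finite S" "S \<subseteq> R" "\<And>x. x \<in> R \<Longrightarrow> \<exists>s\<in>S. (x - s) / of_nat m \<in> R"
    using finite_residues_nat[OF m(1)] by blast
  define G where "G = insert (of_nat m) (S \<inter> I)"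
  have finG: "finite G" using S by (simp add: G_def)
  have gen: "g \<in> spanR R G" if "g \<in> G" for g
  proof -
    have "g = (\<Sum>g'\<in>G. (if g' = g then 1 else 0) * g')"
    proof -
      have "(\<Sum>g'\<in>G. (if g' = g then 1 else 0) * g') = (\<Sum>g'\<in>G. if g' = g then g' else 0)"
        by (intro sum.cong) auto
      then show ?thesis using finG that by simp
    qed
    moreover have "\<forall>g'\<in>G. (if g' = g then 1 else 0) \<in> R" using R_0 R_1 by auto
    ultimately show ?thesis unfolding spanR_def
      by (intro CollectI exI[of _ "\<lambda>g'. if g' = g then 1 else 0"]) blast
  qed
  have "(1 - 0) * x \<in> spanR R G" if x: "x \<in> I" for x
  proof -
    obtain s where s: "s \<in> S" "(x - s) / of_nat m \<in> R" using S(3)[OF nidealD(1)[OF I(1) x]] by blast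
    have d: "x - s = (x - s) / of_nat m * of_nat m" using m(1) by simp
    have "x - s \<in> I" by (subst d) (rule nidealD(4)[OF I(1) s(2) m(2)])
    then have "x - (x - s) \<in> I" by (rule nidealD(7)[OF I(1) x])
    then have "s \<in> G" using s(1) by (simp add: G_def)
    have "x = s + (x - s) / of_nat m * of_nat m" using d by simp
    also have "\<dots> \<in> spanR R G"
      by (rule spanR_add[OF nideal_R gen[OF \<open>s \<in> G\<close>] spanR_scale[OF R_mult[OF s(2)] gen]])
        (auto simp: G_def)
    finally show ?thesis by simp
  qed
  then show ?thesis
    using nakayama_generators[OF I J IJ finG, of 0] m(2) nidealD(2)[OF J] by (auto simp: G_def)
qed

abbreviation pw :: "complex set \<Rightarrow> nat \<Rightarrow> complex set" where "pw P k \<equiv> ideal_pow K P k"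

lemma pw_nideal: "nideal P \<Longrightarrow> nideal (pw P k)"
  by (induction k) (auto intro: nideal_R idm_nideal)

lemma pw_add: "nideal P \<Longrightarrow> pw P (k + l) = ideal_mult (pw P k) (pw P l)"
proof (induction l)
  case 0
  then show ?case by (simp add: idm_R pw_nideal idm_comm[of "pw P k" R])
next
  case (Suc l)
  then show ?case by (simp add: idm_assoc)
qed

lemma pw_1: "nideal P \<Longrightarrow> pw P 1 = P"
  by (simp add: idm_R)

lemma pw_power_mem: "a \<in> P \<Longrightarrow> a ^ k \<in> pw P k"
proof (induction k)
  case (Suc k)
  then show ?case using idm_memI[of "a ^ k" "pw P k" a P] by (simp add: mult.commute)
qed (simp add: R_1)

lemma pw_nonzero: assumes "nideal P" "P \<noteq> {0}" shows "pw P k \<noteq> {0}"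
proof -
  obtain a where "a \<in> P" "a \<noteq> 0" using assms nidealD(2) by blast
  then have a: "a ^ k \<in> pw P k" "a ^ k \<noteq> 0" using pw_power_mem by simp_all
  show ?thesis
  proof
    assume "pw P k = {0}"
    with a(1) have "a ^ k = 0" by blast
    with a(2) show False by simp
  qed
qed

lemma pw_mono: assumes "nideal P" "k \<le> l" shows "pw P l \<subseteq> pw P k"
proof -
  have "pw P (k + (l - k)) \<subseteq> pw P k"
    unfolding pw_add[OF assms(1)] by (intro idm_subset_left pw_nideal assms)
  then show ?thesis using assms(2) by simp
qed

text \<open>The fractional ideals \<open>y\<^sub>k\<inverse> P\<^sup>k\<close> lie between \<open>R\<close> and \<open>D\<inverse> R\<close>, so two of them coincide;
  cancelling (by Nakayama) makes a power of \<open>P\<close> principal.\<close>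

lemma power_principal:
  assumes P: "nideal P" "P \<noteq> {0}"
  shows "\<exists>h \<gamma>. h > 0 \<and> \<gamma> \<in> R - {0} \<and> pw P h = (\<lambda>r. \<gamma> * r) ` R"
proof -
  obtain D :: nat where D: "D > 0"
    "\<And>I. nideal I \<Longrightarrow> I \<noteq> {0} \<Longrightarrow> \<exists>y\<in>I - {0}. \<forall>x\<in>I. of_nat D * x / y \<in> R"
    using hurwitz_ideal by metis
  obtain S where S: "finite S" "S \<subseteq> R" "\<And>x. x \<in> R \<Longrightarrow> \<exists>s\<in>S. (x - s) / of_nat D \<in> R"
    using finite_residues_nat[OF D(1)] by blast
  have "\<forall>k. \<exists>y\<in>pw P k - {0}. \<forall>x\<in>pw P k. of_nat D * x / y \<in> R"
    by (intro allI D(2) pw_nideal pw_nonzero P)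
  then obtain y where y: "\<And>k. y k \<in> pw P k" "\<And>k. y k \<noteq> 0" "\<And>k x. x \<in> pw P k \<Longrightarrow> of_nat D * x / y k \<in> R"
  proof -
    assume *: "\<And>y. (\<And>k. y k \<in> pw P k) \<Longrightarrow> (\<And>k. y k \<noteq> 0) \<Longrightarrow> (\<And>k x. x \<in> pw P k \<Longrightarrow> of_nat D * x / y k \<in> R) \<Longrightarrow> thesis"
    assume "\<forall>k. \<exists>y\<in>pw P k - {0}. \<forall>x\<in>pw P k. of_nat D * x / y \<in> R"
    then have "\<forall>k. \<exists>y. y \<in> pw P k - {0} \<and> (\<forall>x\<in>pw P k. of_nat D * x / y \<in> R)" by blast
    then obtain y where "\<forall>k. y k \<in> pw P k - {0} \<and> (\<forall>x\<in>pw P k. of_nat D * x / y k \<in> R)"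
      by (rule choice[THEN exE])
    then show thesis by (intro *[of y]) blast+
  qed
  \<comment> \<open>Encodes the fractional ideal \<open>P^k / y k\<close>, which contains
    \<open>R\<close> and lies in \<open>R / D\<close>, by the residues \<open>s\<close> modulo
    \<open>D\<close> for which \<open>s / D\<close> belongs to it.\<close>
  define F where "F k = {s \<in> S. s / of_nat D * y k \<in> pw P k}" for k
  have "\<not> inj_on F UNIV"
  proof
    assume "inj_on F UNIV"
    moreover have "finite (range F)"
      by (rule finite_subset[of _ "Pow S"]) (use S(1) in \<open>auto simp: F_def\<close>)
    ultimately show False using finite_imageD infinite_UNIV_nat by blast
  qed
  then obtain k l where kl: "k < l" "F k = F l" unfolding inj_on_def by (metis linorder_neqE_nat)
  \<comment> \<open>Membership of \<open>z\<close> in the fractional ideal depends only on the class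
    of \<open>D z\<close> modulo \<open>D\<close>, hence only on \<open>F\<close>.\<close>
  have transfer: "z * y l \<in> pw P l" if z: "z * y k \<in> pw P k" and F: "F k = F l" for z k l
  proof -
    note nk = pw_nideal[OF P(1), of k] and nl = pw_nideal[OF P(1), of l]
    have "of_nat D * z \<in> R" using y(3)[OF z] y(2)[of k] by simp
    then obtain s where s: "s \<in> S" "(of_nat D * z - s) / of_nat D \<in> R" using S(3) by blast
    define r where "r = (of_nat D * z - s) / of_nat D"
    have r: "r \<in> R" using s(2) by (simp add: r_def)
    have zr: "z = s / of_nat D + r" using D(1) by (simp add: r_def field_simps)
    have "z * y k - r * y k \<in> pw P k" by (intro nidealD(4,7)[OF nk] z r y(1))
    then have "s / of_nat D * y k \<in> pw P k" using zr by (simp add: algebra_simps)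
    then have "s / of_nat D * y l \<in> pw P l" using s(1) F by (auto simp: F_def)
    then have "s / of_nat D * y l + r * y l \<in> pw P l"
      by (rule nidealD(3)[OF nl _ nidealD(4)[OF nl r y(1)]])
    then show ?thesis using zr by (simp add: algebra_simps)
  qed
  define m where "m = l - k"
  \<comment> \<open>Equality of the two fractional ideals says that multiplication by \<gamma>
    carries \<open>P^k\<close> onto \<open>P^l\<close>, the product of \<open>I\<close> and
    \<open>J\<close>.\<close>
  define \<gamma> where "\<gamma> = y l / y k"
  define I where "I = pw P k"
  define J where "J = pw P m"
  have nI: "nideal I" "I \<noteq> {0}" and nJ: "nideal J" unfolding I_def J_def using pw_nideal pw_nonzero P by auto
  have yK: "y i \<in> K" for i using y(1) nidealD(1)[OF pw_nideal[OF P(1)]] R_K by blast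
  have g0: "\<gamma> \<noteq> 0" and gK: "\<gamma> \<in> K" using y(2) yK by (auto simp: \<gamma>_def subfield_closed[OF sf])
  have IJ: "pw P l = ideal_mult I J" using pw_add[OF P(1), of k m] kl(1) by (simp add: I_def J_def m_def)
  have up: "\<gamma> * x \<in> ideal_mult I J" if "x \<in> I" for x
    using transfer[of "x / y k" k l] that y(2)[of k] kl(2) unfolding IJ[symmetric] unfolding I_def \<gamma>_def
    by (simp add: mult.commute)
  have down: "x \<in> I" if "\<gamma> * x \<in> ideal_mult I J" for x
    using transfer[of "x / y k" l k] that y(2) kl(2) unfolding IJ[symmetric] unfolding I_def \<gamma>_def
    by (simp add: mult.commute)
  have gR: "\<gamma> \<in> R"
    by (rule R_if_stabilizes[OF gK nI]) (use up idm_subset_left[OF nI(1) nJ] in blast)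
  have div: "b / \<gamma> \<in> R" if b: "b \<in> J" for b
  proof (rule R_if_stabilizes[OF _ nI])
    show "b / \<gamma> \<in> K" using gK R_K nidealD(1)[OF nJ b] by (simp add: subfield_closed[OF sf])
    fix x assume "x \<in> I"
    then have "x * b \<in> ideal_mult I J" using b by (rule idm_memI)
    then show "b / \<gamma> * x \<in> I" using g0 by (intro down) (simp add: mult.commute)
  qed
  \<comment> \<open>By \<open>div\<close>, this is \<open>J\<close> divided by \<gamma>. Dividing
    the equality of ideals by \<gamma> shows that \<open>I\<close> lies in \<open>I J'\<close>, so
    Nakayama's lemma makes \<open>J'\<close> the unit ideal.\<close>
  define J' where "J' = {z \<in> R. \<gamma> * z \<in> J}"
  have nJ': "nideal J'"
    unfolding nideal_def J'_def
    by (auto simp: distrib_left mult.left_commute intro: R_0 R_add R_mult nidealD[OF nJ])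
  have "I \<subseteq> ideal_mult I J'"
  proof
    fix x assume "x \<in> I"
    have "ideal_mult I J \<subseteq> {x. x / \<gamma> \<in> ideal_mult I J'}"
    proof (rule idm_subset)
      fix a b assume a: "a \<in> I" and b: "b \<in> J"
      have "b / \<gamma> \<in> J'" using div[OF b] b g0 by (simp add: J'_def)
      then have "a * (b / \<gamma>) \<in> ideal_mult I J'" by (rule idm_memI[OF a])
      then show "a * b \<in> {x. x / \<gamma> \<in> ideal_mult I J'}" by simp
    qed (auto simp: idm_zero add_divide_distrib intro: idm_add)
    then show "x \<in> ideal_mult I J'" using up[OF \<open>x \<in> I\<close>] g0 by force
  qed
  then have "1 \<in> J'" by (rule nakayama[OF nI nJ'])
  then have gJ: "\<gamma> \<in> J" by (simp add: J'_def)
  have "J = (\<lambda>r. \<gamma> * r) ` R"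
  proof
    show "J \<subseteq> (\<lambda>r. \<gamma> * r) ` R"
    proof
      fix b assume "b \<in> J"
      then show "b \<in> (\<lambda>r. \<gamma> * r) ` R" using div[of b] g0 by (intro image_eqI[of _ _ "b / \<gamma>"]) auto
    qed
    show "(\<lambda>r. \<gamma> * r) ` R \<subseteq> J" using nidealD(5)[OF nJ _ gJ] by blast
  qed
  moreover have "m > 0" using kl by (simp add: m_def)
  ultimately show ?thesis using gR g0 unfolding J_def by blast
qed

section \<open>Places and valuations\<close>

lemma placesD:
  assumes "P \<in> places K"
  shows "nideal P" "P \<noteq> {0}" "P \<noteq> R" "1 \<notin> P"
    "a \<in> R \<Longrightarrow> b \<in> R \<Longrightarrow> a * b \<in> P \<Longrightarrow> a \<in> P \<or> b \<in> P"
proof -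
  show n: "nideal P" and "P \<noteq> {0}" and ne: "P \<noteq> R" and "a \<in> R \<Longrightarrow> b \<in> R \<Longrightarrow> a * b \<in> P \<Longrightarrow> a \<in> P \<or> b \<in> P"
    using assms unfolding places_def nideal_def by blast+
  show "1 \<notin> P" using nideal_one[OF n] ne by blast
qed

lemma placesI:
  assumes "nideal P" "P \<noteq> {0}" "1 \<notin> P" "\<And>a b. a \<in> R \<Longrightarrow> b \<in> R \<Longrightarrow> a * b \<in> P \<Longrightarrow> a \<in> P \<or> b \<in> P"
  shows "P \<in> places K"
  using assms nidealD(6)[OF assms(1)] R_1 unfolding places_def nideal_def by auto

lemma place_power_mem:
  assumes P: "P \<in> places K" and a: "a \<in> R" "a ^ k \<in> P"
  shows "a \<in> P"
  using a(2)
proof (induction k)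
  case (Suc k)
  then show ?case using placesD(5)[OF P a(1) R_power[OF a(1)], of k] by auto
qed (use placesD(4)[OF P] in simp)

text \<open>Two powers of \<open>w\<close> agree modulo \<open>P\<close>; cancelling the smaller
  one, which is outside the prime ideal, leaves a power congruent to 1.\<close>

lemma place_inverse:
  assumes P: "P \<in> places K" and w: "w \<in> R" "w \<notin> P"
  obtains w' where "w' \<in> R" "w * w' - 1 \<in> P"
proof -
  obtain S where S: "finite S" "S \<subseteq> R" "\<And>x. x \<in> R \<Longrightarrow> \<exists>s\<in>S. x - s \<in> P"
    using finite_residues[OF placesD(1,2)[OF P]] by blast
  have "\<forall>k. \<exists>s\<in>S. w ^ k - s \<in> P" using S(3) R_power[OF w(1)] by blast
  then obtain s where s: "\<And>k. s k \<in> S" "\<And>k. w ^ k - s k \<in> P" by metis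
  have "\<not> inj_on s UNIV"
  proof
    assume "inj_on s UNIV"
    moreover have "finite (range s)" using S(1) s(1) by (meson finite_subset image_subsetI)
    ultimately show False using finite_imageD infinite_UNIV_nat by blast
  qed
  then obtain k l where kl: "k < l" "s k = s l" unfolding inj_on_def by (metis linorder_neqE_nat)
  have "(w ^ l - s l) - (w ^ k - s k) \<in> P" by (intro nidealD(7)[OF placesD(1)[OF P]] s)
  then have "w ^ l - w ^ k \<in> P" using kl(2) by simp
  moreover have "w ^ l - w ^ k = w ^ k * (w ^ (l - k) - 1)"
    using kl(1) by (simp add: algebra_simps flip: power_add)
  ultimately have "w ^ k \<in> P \<or> w ^ (l - k) - 1 \<in> P"
    using placesD(5)[OF P R_power[OF w(1)] R_diff[OF R_power[OF w(1)] R_1]] by metis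
  then have "w ^ (l - k) - 1 \<in> P" using place_power_mem[OF P w(1)] w(2) by blast
  moreover have "w * w ^ (l - k - 1) = w ^ (l - k)" using kl(1) by (simp add: Suc_diff_Suc flip: power_Suc)
  ultimately show thesis using that[of "w ^ (l - k - 1)"] R_power[OF w(1)] by simp
qed

text \<open>An element of \<open>Q\<close> outside \<open>P\<close> would be invertible modulo
  \<open>P\<close>, and this puts 1 into \<open>Q\<close>.\<close>

lemma place_maximal:
  assumes P: "P \<in> places K" and Q: "Q \<in> places K" and "P \<subseteq> Q"
  shows "P = Q"
proof (rule ccontr)
  assume "P \<noteq> Q"
  then obtain w where w: "w \<in> Q" "w \<notin> P" using assms by blast
  have wR: "w \<in> R" using nidealD(1)[OF placesD(1)[OF Q] w(1)] .
  obtain w' where w': "w' \<in> R" "w * w' - 1 \<in> P" using place_inverse[OF P wR w(2)] by blast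
  have "w * w' - (w * w' - 1) \<in> Q"
    using nidealD(7)[OF placesD(1)[OF Q] nidealD(5)[OF placesD(1)[OF Q] w'(1) w(1)] subsetD[OF assms(3) w'(2)]] .
  then show False using placesD(4)[OF Q] by simp
qed

text \<open>Only finitely many ideals contain the nonzero element \<open>a\<close>, so a maximal
  proper ideal above \<open>I\<close> exists without Zorn's lemma; as usual it is prime.\<close>

lemma ex_place_containing:
  assumes I: "nideal I" "a \<in> I" "a \<noteq> 0" "1 \<notin> I"
  shows "\<exists>P\<in>places K. I \<subseteq> P"
proof -
  let ?A = "{J. nideal J \<and> a \<in> J \<and> 1 \<notin> J \<and> I \<subseteq> J}"
  have aR: "a \<in> R" using nidealD(1)[OF I(1,2)] .
  have "finite ?A" using finite_ideals_containing[OF aR I(3)] by (rule rev_finite_subset) blast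
  moreover have "I \<in> ?A" using I by blast
  ultimately obtain M where M: "M \<in> ?A" and max: "\<And>J. J \<in> ?A \<Longrightarrow> M \<subseteq> J \<Longrightarrow> J = M"
  proof -
    assume *: "\<And>M. M \<in> ?A \<Longrightarrow> (\<And>J. J \<in> ?A \<Longrightarrow> M \<subseteq> J \<Longrightarrow> J = M) \<Longrightarrow> thesis"
    assume "finite ?A" "I \<in> ?A"
    from finite_has_maximal2[OF this] obtain M where "M \<in> ?A" "\<forall>J\<in>?A. M \<subseteq> J \<longrightarrow> M = J" by auto
    then show thesis by (intro *[of M]) blast+
  qed
  have nM: "nideal M" using M by blast
  have "M \<in> places K"
  proof (rule placesI[OF nM])
    show "M \<noteq> {0}" "1 \<notin> M" using M I(3) by auto
    fix b c assume bc: "b \<in> R" "c \<in> R" "b * c \<in> M"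
    show "b \<in> M \<or> c \<in> M"
    proof (rule ccontr)
      assume "\<not> (b \<in> M \<or> c \<in> M)"
      define J where "J = {x + b * r | x r. x \<in> M \<and> r \<in> R}"
      have JI: "x + b * r \<in> J" if "x \<in> M" "r \<in> R" for x r using that unfolding J_def by blast
      have "nideal J"
        unfolding nideal_def
      proof (intro conjI ballI)
        show "J \<subseteq> R" using nidealD(1)[OF nM] bc(1) by (auto simp: J_def intro: R_add R_mult)
        show "0 \<in> J" using JI[OF nidealD(2)[OF nM] R_0] by simp
        fix x y assume "x \<in> J" "y \<in> J"
        then obtain u r v s where "x = u + b * r" "y = v + b * s" "u \<in> M" "v \<in> M" "r \<in> R" "s \<in> R"
          unfolding J_def by blast
        then show "x + y \<in> J" using JI[of "u + v" "r + s"] nidealD(3)[OF nM] R_add by (simp add: algebra_simps)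
      next
        fix c x assume "c \<in> R" "x \<in> J"
        then obtain u r where "x = u + b * r" "u \<in> M" "r \<in> R" unfolding J_def by blast
        then show "c * x \<in> J" using JI[of "c * u" "c * r"] nidealD(4)[OF nM] R_mult \<open>c \<in> R\<close> by (simp add: algebra_simps)
      qed
      have MJ: "M \<subseteq> J" using JI[OF _ R_0] by auto
      have "b \<in> J" using JI[OF nidealD(2)[OF nM] R_1] by simp
      have "1 \<in> J"
      proof (rule ccontr)
        assume "1 \<notin> J"
        then have "J \<in> ?A" using M MJ \<open>nideal J\<close> by blast
        then show False using max[of J] MJ \<open>b \<in> J\<close> \<open>\<not> (b \<in> M \<or> c \<in> M)\<close> by blast
      qed
      then obtain x r where xr: "1 = x + b * r" "x \<in> M" "r \<in> R" unfolding J_def by blast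
      have "c = c * (x + b * r)" using xr(1) by simp
      also have "\<dots> = c * x + r * (b * c)" by (simp add: algebra_simps)
      also have "\<dots> \<in> M" by (intro nidealD(3,4)[OF nM] bc xr)
      finally show False using \<open>\<not> (b \<in> M \<or> c \<in> M)\<close> by blast
    qed
  qed
  then show ?thesis using M by blast
qed

text \<open>Exponent and generator are chosen as one pair, so that the two projections
  \<open>hh\<close> and \<open>gam\<close> belong to the same principal power of
  \<open>P\<close>.\<close>

definition hgam :: "complex set \<Rightarrow> nat \<times> complex" where
  "hgam P = (SOME hg. fst hg > 0 \<and> snd hg \<in> R - {0} \<and> pw P (fst hg) = (\<lambda>r. snd hg * r) ` R)"

definition hh :: "complex set \<Rightarrow> nat" where "hh P = fst (hgam P)"

definition gam :: "complex set \<Rightarrow> complex" where "gam P = snd (hgam P)"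

lemma hgam:
  assumes "P \<in> places K"
  shows "hh P > 0" "gam P \<in> R" "gam P \<noteq> 0" "pw P (hh P) = (\<lambda>r. gam P * r) ` R"
proof -
  obtain h \<gamma> where "h > 0 \<and> \<gamma> \<in> R - {0} \<and> pw P h = (\<lambda>r. \<gamma> * r) ` R"
    using power_principal[OF placesD(1,2)[OF assms]] by blast
  then have "fst (h,\<gamma>) > 0 \<and> snd (h,\<gamma>) \<in> R - {0} \<and> pw P (fst (h,\<gamma>)) = (\<lambda>r. snd (h,\<gamma>) * r) ` R" by simp
  then have "fst (hgam P) > 0 \<and> snd (hgam P) \<in> R - {0} \<and> pw P (fst (hgam P)) = (\<lambda>r. snd (hgam P) * r) ` R"
    unfolding hgam_def by (rule someI)
  then show "hh P > 0" "gam P \<in> R" "gam P \<noteq> 0" "pw P (hh P) = (\<lambda>r. gam P * r) ` R"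
    by (auto simp: hh_def gam_def)
qed

lemma gam_units: "P \<in> places K \<Longrightarrow> gam P \<in> Qbar_units"
  using hgam K_units R_K by blast

text \<open>Multiplication by a principal ideal is multiplication by its generator, so
  \<open>gam P\<close> acts on the powers of \<open>P\<close> as the \<open>h\<close>-th power of a
  uniformizer would.\<close>

lemma pw_shift:
  assumes P: "P \<in> places K"
  shows "pw P (hh P * k + j) = (\<lambda>y. gam P ^ k * y) ` pw P j"
proof (induction k)
  case (Suc k)
  note n = placesD(1)[OF P]
  have scale: "ideal_mult ((\<lambda>r. gam P * r) ` R) J = (\<lambda>y. gam P * y) ` J" if J: "nideal J" for J
  proof
    show "ideal_mult ((\<lambda>r. gam P * r) ` R) J \<subseteq> (\<lambda>y. gam P * y) ` J"
    proof (rule idm_subset)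
      show "0 \<in> (\<lambda>y. gam P * y) ` J" using nidealD(2)[OF J] by force
      show "x + y \<in> (\<lambda>y. gam P * y) ` J" if "x \<in> (\<lambda>y. gam P * y) ` J" "y \<in> (\<lambda>y. gam P * y) ` J" for x y
        using that nidealD(3)[OF J] by (auto simp flip: distrib_left)
      show "a * b \<in> (\<lambda>y. gam P * y) ` J" if "a \<in> (\<lambda>r. gam P * r) ` R" "b \<in> J" for a b
        using that nidealD(4)[OF J] by (auto simp: mult.assoc)
    qed
    show "(\<lambda>y. gam P * y) ` J \<subseteq> ideal_mult ((\<lambda>r. gam P * r) ` R) J"
      using R_1 by (force intro: idm_memI)
  qed
  have "pw P (hh P * Suc k + j) = ideal_mult (pw P (hh P)) (pw P (hh P * k + j))"
    using pw_add[OF n, of "hh P" "hh P * k + j"] by (simp add: algebra_simps)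
  also have "\<dots> = (\<lambda>y. gam P * y) ` pw P (hh P * k + j)"
    unfolding hgam(4)[OF P] by (rule scale[OF pw_nideal[OF n]])
  also have "\<dots> = (\<lambda>y. gam P ^ Suc k * y) ` pw P j" by (simp add: Suc.IH image_image mult.assoc)
  finally show ?case .
qed simp

lemma pw_shift_iff:
  assumes P: "P \<in> places K"
  shows "gam P ^ k * y \<in> pw P (hh P * k + j) \<longleftrightarrow> y \<in> pw P j"
  using hgam(3)[OF P] unfolding pw_shift[OF P] by (auto simp: image_iff)

lemma pw_mult_mem: "nideal P \<Longrightarrow> a \<in> pw P k \<Longrightarrow> b \<in> pw P l \<Longrightarrow> a * b \<in> pw P (k + l)"
  by (simp add: pw_add idm_memI)

lemma pw_div_mem:
  assumes P: "P \<in> places K" and x: "x \<in> pw P (hh P * k + j)"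
  shows "x / gam P ^ k \<in> pw P j"
  using x hgam(3)[OF P] unfolding pw_shift[OF P] by auto

lemma gam_mem: "P \<in> places K \<Longrightarrow> gam P \<in> P"
proof -
  assume P: "P \<in> places K"
  have "gam P * 1 \<in> pw P (hh P)" unfolding hgam(4)[OF P] using R_1 by blast
  moreover have "pw P (hh P) \<subseteq> pw P 1"
    using hgam(1)[OF P] by (intro pw_mono[OF placesD(1)[OF P]]) simp
  ultimately show ?thesis using pw_1[OF placesD(1)[OF P]] by auto
qed

text \<open>A substitute for dividing by a power of a uniformizer: an element \<open>a\<close> of
  exact order \<open>k\<close> is multiplied by some \<open>u\<close> of complementary order and
  divided by \<open>gam P ^ k\<close>, leaving an element outside \<open>P\<close>.\<close>

lemma unit_witness:
  assumes P: "P \<in> places K" and a: "a \<in> pw P k" "a \<notin> pw P (Suc k)"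
  obtains u where "u \<in> pw P ((hh P - 1) * k)" "a * u / gam P ^ k \<in> R" "a * u / gam P ^ k \<notin> P"
proof -
  note n = placesD(1)[OF P]
  let ?g = "gam P" and ?h = "hh P"
  have hk: "k + (?h - 1) * k = ?h * k" using hgam(1)[OF P] by (cases ?h) auto
  have au: "a * u \<in> pw P (?h * k + 0)" if "u \<in> pw P ((?h - 1) * k)" for u
    using pw_mult_mem[OF n a(1) that] unfolding hk by simp
  have "\<exists>u\<in>pw P ((?h - 1) * k). a * u / ?g ^ k \<notin> P"
  proof (rule ccontr)
    assume "\<not> ?thesis"
    then have all: "a * u / ?g ^ k \<in> P" if "u \<in> pw P ((?h - 1) * k)" for u using that by blast
    \<comment> \<open>\<open>gam P ^ k\<close> is a sum of products \<open>u v\<close> with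
      \<open>v\<close> in \<open>P^k\<close>. If every \<open>a u / gam P ^ k\<close> were in
      \<open>P\<close>, multiplying by \<open>v\<close> and adding up would put \<open>a\<close>
      into \<open>P^(k+1)\<close>.\<close>
    have "?g ^ k * 1 \<in> pw P (?h * k + 0)" using pw_shift_iff[OF P, of k 1 0] R_1 by simp
    then have "?g ^ k \<in> ideal_mult (pw P ((?h - 1) * k)) (pw P k)"
      unfolding pw_add[OF n, symmetric] add.commute[of "(?h - 1) * k"] hk by simp
    moreover have "ideal_mult (pw P ((?h - 1) * k)) (pw P k) \<subseteq> {x. a * x / ?g ^ k \<in> pw P (Suc k)}"
    proof (rule idm_subset)
      note ns = pw_nideal[OF n, of "Suc k"]
      fix u v assume u: "u \<in> pw P ((?h - 1) * k)" and v: "v \<in> pw P k"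
      have "v * (a * u / ?g ^ k) \<in> ideal_mult (pw P k) P" by (rule idm_memI[OF v all[OF u]])
      then show "u * v \<in> {x. a * x / ?g ^ k \<in> pw P (Suc k)}" by (simp add: mult_ac)
    qed (use nidealD(2,3)[OF pw_nideal[OF n, of "Suc k"]] in \<open>auto simp: distrib_left add_divide_distrib\<close>)
    ultimately have "a * ?g ^ k / ?g ^ k \<in> pw P (Suc k)" by blast
    then show False using a(2) hgam(3)[OF P] by simp
  qed
  then obtain u where u: "u \<in> pw P ((?h - 1) * k)" "a * u / ?g ^ k \<notin> P" by blast
  have "a * u / ?g ^ k \<in> R" using pw_div_mem[OF P au[OF u(1)]] by simp
  then show thesis using that u by blast
qed

lemma lnorm_gam_pos:
  assumes P: "P \<in> places K"
  shows "lnorm (gam P) > 0"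
proof (rule lnorm_pos)
  show "alg_int (gam P)" "gam P \<noteq> 0" using hgam[OF P] by (auto simp: R_iff)
  show "\<not> alg_int (inverse (gam P))"
  proof
    assume "alg_int (inverse (gam P))"
    then have "inverse (gam P) \<in> R" using hgam(2)[OF P] by (simp add: R_iff subfield_closed[OF sf])
    then have "inverse (gam P) * gam P \<in> P" by (rule nidealD(4)[OF placesD(1)[OF P] _ gam_mem[OF P]])
    then show False using placesD(4)[OF P] hgam(3)[OF P] by simp
  qed
qed

lemma lnorm_power: "x \<in> Qbar_units \<Longrightarrow> lnorm (x ^ k) = real k * lnorm x"
proof -
  assume x: "x \<in> Qbar_units"
  have "x \<in> Qbar - {0}" using x by (simp add: Qbar_units_def)
  from additive_power[OF subfield_Qbar _ this, of lnorm] lnorm_mult show ?thesis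
    by (simp add: Qbar_units_def)
qed

text \<open>The Krull intersection property by size: if \<open>a\<close> lies in
  \<open>P^(h k)\<close> then \<open>gam P ^ k\<close> divides it, so \<open>k\<close> is at most
  the quotient of the two values of \<open>lnorm\<close>. This gives \<open>GREATEST\<close> in
  \<open>vOK\<close> its meaning.\<close>

lemma not_in_all_powers:
  assumes P: "P \<in> places K" and a: "a \<in> R" "a \<noteq> 0"
  shows "\<exists>k. a \<notin> pw P k"
proof (rule ccontr)
  assume "\<not> ?thesis"
  then have all: "a \<in> pw P k" for k by blast
  have bound: "real k * lnorm (gam P) \<le> lnorm a" for k
  proof -
    define b where "b = a / gam P ^ k"
    have "b \<in> pw P 0" unfolding b_def by (rule pw_div_mem[OF P all])
    then have b: "b \<in> R" "b \<noteq> 0" using a hgam(3)[OF P] by (auto simp: b_def)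
    have "a = gam P ^ k * b" using hgam(3)[OF P] by (simp add: b_def)
    then have "lnorm a = lnorm (gam P ^ k) + lnorm b"
      using lnorm_mult[of "gam P ^ k" b] gam_units[OF P] b K_units R_K by (simp add: Qbar_units_closed)
    moreover have "lnorm b \<ge> 0" using b by (intro lnorm_nonneg) (auto simp: R_iff)
    ultimately show ?thesis using lnorm_power[OF gam_units[OF P]] by simp
  qed
  obtain k :: nat where "lnorm a < real k * lnorm (gam P)"
    using reals_Archimedean3[OF lnorm_gam_pos[OF P]] by blast
  then show False using bound[of k] by linarith
qed

section \<open>Additivity of the valuation on integers\<close>

lemma vOK_iff:
  assumes P: "P \<in> places K" and a: "a \<in> R" "a \<noteq> 0"
  shows "a \<in> pw P k \<longleftrightarrow> k \<le> vOK K P a"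
proof -
  note n = placesD(1)[OF P]
  obtain k0 where k0: "a \<notin> pw P k0" using not_in_all_powers[OF assms] by blast
  have bd: "\<And>k. a \<in> pw P k \<Longrightarrow> k \<le> k0" using k0 pw_mono[OF n] by (metis nat_le_linear subsetD)
  have z: "a \<in> pw P 0" using a by simp
  have mem: "a \<in> pw P (vOK K P a)" unfolding vOK_def by (rule GreatestI_nat[where P = "\<lambda>k. a \<in> pw P k", OF z bd])
  show ?thesis
  proof
    show "a \<in> pw P k \<Longrightarrow> k \<le> vOK K P a"
      unfolding vOK_def by (rule Greatest_le_nat[where P = "\<lambda>k. a \<in> pw P k", OF _ bd])
    show "k \<le> vOK K P a \<Longrightarrow> a \<in> pw P k" using mem pw_mono[OF n] by blast
  qed
qed

lemma vOK_eqI: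
  assumes "P \<in> places K" "a \<in> R" "a \<noteq> 0" "a \<in> pw P k" "a \<notin> pw P (Suc k)"
  shows "vOK K P a = k"
  using vOK_iff[OF assms(1-3)] assms(4,5) by (metis le_antisym not_less_eq_eq)

lemma vOK_pos_iff: "P \<in> places K \<Longrightarrow> a \<in> R \<Longrightarrow> a \<noteq> 0 \<Longrightarrow> vOK K P a > 0 \<longleftrightarrow> a \<in> P"
  using vOK_iff[of P a 1] pw_1[OF placesD(1)] by auto

text \<open>Unit witnesses for both factors lie outside the prime ideal \<open>P\<close>, hence so
  does their product; membership of \<open>a b\<close> in one more power of \<open>P\<close> would
  push this product into \<open>P\<close>.\<close>

lemma vOK_mult:
  assumes P: "P \<in> places K" and a: "a \<in> R" "a \<noteq> 0" and b: "b \<in> R" "b \<noteq> 0"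
  shows "vOK K P (a * b) = vOK K P a + vOK K P b"
proof -
  note n = placesD(1)[OF P]
  let ?k = "vOK K P a" and ?l = "vOK K P b" and ?g = "gam P" and ?h = "hh P"
  have ka: "a \<in> pw P ?k" "a \<notin> pw P (Suc ?k)" unfolding vOK_iff[OF P a] by auto
  have lb: "b \<in> pw P ?l" "b \<notin> pw P (Suc ?l)" unfolding vOK_iff[OF P b] by auto
  obtain u where u: "u \<in> pw P ((?h - 1) * ?k)" "a * u / ?g ^ ?k \<in> R" "a * u / ?g ^ ?k \<notin> P"
    by (rule unit_witness[OF P ka])
  obtain v where v: "v \<in> pw P ((?h - 1) * ?l)" "b * v / ?g ^ ?l \<in> R" "b * v / ?g ^ ?l \<notin> P"
    by (rule unit_witness[OF P lb])
  show ?thesis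
  proof (rule vOK_eqI[OF P])
    show "a * b \<in> R" "a * b \<noteq> 0" using a b R_mult by auto
    show "a * b \<in> pw P (?k + ?l)" by (rule pw_mult_mem[OF n ka(1) lb(1)])
    show "a * b \<notin> pw P (Suc (?k + ?l))"
    proof
      assume "a * b \<in> pw P (Suc (?k + ?l))"
      then have "(a * b) * (u * v) \<in> pw P (Suc (?k + ?l) + ((?h - 1) * ?k + (?h - 1) * ?l))"
        by (intro pw_mult_mem[OF n] u v)
      moreover have "Suc (?k + ?l) + ((?h - 1) * ?k + (?h - 1) * ?l) = ?h * (?k + ?l) + 1"
        using hgam(1)[OF P] by (cases ?h) (auto simp: algebra_simps)
      ultimately have "(a * b) * (u * v) \<in> pw P (?h * (?k + ?l) + 1)" by metis
      then have "(a * b) * (u * v) / ?g ^ (?k + ?l) \<in> pw P 1" by (rule pw_div_mem[OF P])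
      moreover have "(a * b) * (u * v) / ?g ^ (?k + ?l) = (a * u / ?g ^ ?k) * (b * v / ?g ^ ?l)"
        by (simp add: power_add)
      ultimately have "(a * u / ?g ^ ?k) * (b * v / ?g ^ ?l) \<in> P" using pw_1[OF n] by metis
      then show False using placesD(5)[OF P u(2) v(2)] u(3) v(3) by blast
    qed
  qed
qed

section \<open>The valuation on the whole field\<close>

lemma K_fraction:
  assumes "x \<in> K" "x \<noteq> 0"
  obtains a b where "a \<in> R - {0}" "b \<in> R - {0}" "x = a / b"
proof -
  obtain m :: nat where m: "m > 0" "alg_int (of_nat m * x)" using ex_multiple_alg_int assms KQ by blast
  show thesis
  proof (rule that)
    show "of_nat m * x \<in> R - {0}" using m assms by (simp add: R_iff subfield_closed[OF sf] subfield_of_nat[OF sf])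
    show "of_nat m \<in> R - {0}" using m R_of_nat by simp
    show "x = of_nat m * x / of_nat m" using m by simp
  qed
qed

text \<open>Additivity on \<open>R\<close> makes the difference independent of the fraction, so the
  value picked by \<open>SOME\<close> in \<open>ordv\<close> is forced.\<close>

lemma ordv_divide:
  assumes P: "P \<in> places K" and a: "a \<in> R - {0}" and b: "b \<in> R - {0}"
  shows "ordv K P (a / b) = int (vOK K P a) - int (vOK K P b)"
proof -
  let ?Q = "\<lambda>m. \<exists>a' b'. a' \<in> OK K - {0} \<and> b' \<in> OK K - {0} \<and> a / b = a' / b' \<and> m = int (vOK K P a') - int (vOK K P b')"
  have uniq: "m = int (vOK K P a) - int (vOK K P b)" if "?Q m" for m
  proof -
    obtain a' b' where ab: "a' \<in> R - {0}" "b' \<in> R - {0}" "a / b = a' / b'" "m = int (vOK K P a') - int (vOK K P b')"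
      using \<open>?Q m\<close> by blast
    have "a * b' = a' * b" using ab a b by (simp add: frac_eq_eq)
    then have "vOK K P a + vOK K P b' = vOK K P a' + vOK K P b"
      using vOK_mult[OF P] ab a b by (metis DiffD1 DiffD2 singletonI)
    then show ?thesis using ab(4) by linarith
  qed
  have ex: "?Q (int (vOK K P a) - int (vOK K P b))" using a b by blast
  show ?thesis unfolding ordv_def by (rule uniq) (rule someI[of ?Q, OF ex])
qed

lemma ordv_R: "P \<in> places K \<Longrightarrow> a \<in> R \<Longrightarrow> a \<noteq> 0 \<Longrightarrow> ordv K P a = int (vOK K P a)"
proof -
  assume P: "P \<in> places K" and a: "a \<in> R" "a \<noteq> 0"
  have "vOK K P (1 * 1) = vOK K P 1 + vOK K P 1" by (rule vOK_mult[OF P]) (auto simp: R_1)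
  then show ?thesis using ordv_divide[OF P, of a 1] a R_1 by simp
qed

lemma ordv_mult:
  assumes P: "P \<in> places K" and x: "x \<in> K - {0}" and y: "y \<in> K - {0}"
  shows "ordv K P (x * y) = ordv K P x + ordv K P y"
proof -
  obtain a b where ab: "a \<in> R - {0}" "b \<in> R - {0}" "x = a / b" using K_fraction x by blast
  obtain c d where cd: "c \<in> R - {0}" "d \<in> R - {0}" "y = c / d" using K_fraction y by blast
  have "x * y = (a * c) / (b * d)" using ab cd by simp
  moreover have "a * c \<in> R - {0}" "b * d \<in> R - {0}" using ab cd R_mult by auto
  ultimately have "ordv K P (x * y) = int (vOK K P (a * c)) - int (vOK K P (b * d))"
    using ordv_divide[OF P] by simp
  also have "\<dots> = ordv K P x + ordv K P y"
    using ab cd by (simp add: ordv_divide[OF P] vOK_mult[OF P])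
  finally show ?thesis .
qed

text \<open>If the ideal of denominators of \<open>x\<close> were proper, it would lie in a place
  \<open>P\<close>. A unit witness for the denominator \<open>b\<close> at \<open>P\<close> is
  itself a denominator of \<open>x\<close>, because the numerator has at least the order of
  \<open>b\<close>, but it is not in \<open>P\<close>.\<close>

lemma ordv_nonneg_imp_R:
  assumes x: "x \<in> K - {0}" and ge: "\<And>P. P \<in> places K \<Longrightarrow> ordv K P x \<ge> 0"
  shows "x \<in> R"
proof (rule ccontr)
  assume nx: "x \<notin> R"
  obtain a b where ab: "a \<in> R - {0}" "b \<in> R - {0}" "x = a / b" using K_fraction x by blast
  define I where "I = {d \<in> R. d * x \<in> R}"
  have nI: "nideal I"
    unfolding nideal_def I_def by (auto simp: distrib_right mult.assoc intro: R_0 R_add R_mult)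
  have "b \<in> I" "b \<noteq> 0" using ab by (auto simp: I_def)
  moreover have "1 \<notin> I" using nx by (simp add: I_def)
  ultimately obtain P where P: "P \<in> places K" "I \<subseteq> P" using ex_place_containing[OF nI] by blast
  note n = placesD(1)[OF P(1)]
  let ?k = "vOK K P b" and ?g = "gam P" and ?h = "hh P"
  have b: "b \<in> R" "b \<noteq> 0" using ab by auto
  have kb: "b \<in> pw P ?k" "b \<notin> pw P (Suc ?k)" unfolding vOK_iff[OF P(1) b] by auto
  have "?k \<le> vOK K P a" using ge[OF P(1)] ordv_divide[OF P(1) ab(1,2)] ab(3) by simp
  then have ka: "a \<in> pw P ?k" using vOK_iff[OF P(1)] ab by auto
  obtain u where u: "u \<in> pw P ((?h - 1) * ?k)" "b * u / ?g ^ ?k \<in> R" "b * u / ?g ^ ?k \<notin> P"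
    by (rule unit_witness[OF P(1) kb])
  have hk: "?k + (?h - 1) * ?k = ?h * ?k + 0" using hgam(1)[OF P(1)] by (cases ?h) auto
  have "a * u \<in> pw P (?h * ?k + 0)" using pw_mult_mem[OF n ka u(1)] hk by metis
  from pw_div_mem[OF P(1) this] have "a * u / ?g ^ ?k \<in> R" by simp
  moreover have "b * u / ?g ^ ?k * x = a * u / ?g ^ ?k" using ab by simp
  ultimately have "b * u / ?g ^ ?k * x \<in> R" by metis
  then have "b * u / ?g ^ ?k \<in> I" using u(2) unfolding I_def by blast
  then show False using P(2) u(3) by blast
qed

lemma ordv_one: "P \<in> places K \<Longrightarrow> ordv K P 1 = 0"
  using ordv_mult[of P 1 1] subfield_closed(2)[OF sf] by simp

lemma ordv_inverse: "P \<in> places K \<Longrightarrow> x \<in> K - {0} \<Longrightarrow> ordv K P (inverse x) = - ordv K P x"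
  using ordv_mult[of P x "inverse x"] ordv_one[of P] subfield_closed(6)[OF sf, of x] by simp

lemma ordv_power: "P \<in> places K \<Longrightarrow> x \<in> K - {0} \<Longrightarrow> ordv K P (x ^ k) = int k * ordv K P x"
  by (induction k) (auto simp: ordv_one ordv_mult subfield_power[OF sf] algebra_simps)

lemma ordv_powi: "P \<in> places K \<Longrightarrow> x \<in> K - {0} \<Longrightarrow> ordv K P (x powi k) = k * ordv K P x"
  using ordv_power[of P x "nat k"] ordv_power[of P "inverse x" "nat (- k)"] ordv_inverse[of P x]
    subfield_closed(6)[OF sf, of x]
  by (auto simp: power_int_def)

lemma ordv_prod:
  assumes P: "P \<in> places K"
  shows "(\<And>i. i \<in> I \<Longrightarrow> f i \<in> K - {0}) \<Longrightarrow> ordv K P (\<Prod>i\<in>I. f i) = (\<Sum>i\<in>I. ordv K P (f i))"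
proof (induction I rule: infinite_finite_induct)
  case (insert j I)
  have "(\<Prod>i\<in>I. f i) \<in> K - {0}" using insert by (auto intro: subfield_prod[OF sf])
  then show ?case using insert ordv_mult[OF P, of "f j" "\<Prod>i\<in>I. f i"] by simp
qed (simp_all add: ordv_one P)

lemma ordv_zero_imp_AUnits:
  assumes x: "x \<in> K - {0}" and "\<And>P. P \<in> places K \<Longrightarrow> ordv K P x = 0"
  shows "x \<in> AUnits"
proof -
  have "x \<in> R" using assms by (intro ordv_nonneg_imp_R) auto
  moreover have "inverse x \<in> R"
    using assms subfield_closed(6)[OF sf] by (intro ordv_nonneg_imp_R) (auto simp: ordv_inverse)
  ultimately show ?thesis using x by (simp add: AUnits_def R_iff)
qed

lemma AUnits_imp_ordv_zero:
  assumes P: "P \<in> places K" and u: "u \<in> AUnits" "u \<in> K"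
  shows "ordv K P u = 0"
proof -
  have u0: "u \<in> K - {0}" using u by (auto simp: AUnits_def)
  have "u \<in> R" "inverse u \<in> R" using u by (auto simp: AUnits_def R_iff subfield_closed[OF sf])
  then have "ordv K P u \<ge> 0" "ordv K P (inverse u) \<ge> 0"
    using ordv_R[OF P] u0 by auto
  then show ?thesis using ordv_inverse[OF P u0] by simp
qed

lemma ordv_gam_self: "P \<in> places K \<Longrightarrow> ordv K P (gam P) = int (hh P)"
proof -
  assume P: "P \<in> places K"
  have "vOK K P (gam P) = hh P"
  proof (rule vOK_eqI[OF P hgam(2,3)[OF P]])
    show "gam P \<in> pw P (hh P)" using pw_shift_iff[OF P, of 1 1 0] R_1 by simp
    show "gam P \<notin> pw P (Suc (hh P))"
      using pw_shift_iff[OF P, of 1 1 1] placesD(4)[OF P] pw_1[OF placesD(1)[OF P]] by auto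
  qed
  then show ?thesis using ordv_R[OF P hgam(2,3)[OF P]] by simp
qed

text \<open>The \<open>h\<close>-th power of an element of \<open>P\<close> is a multiple of
  \<open>gam P\<close>. The statement speaks of a prime ideal instead of a place, so that it applies
  to the contraction of a place of a larger field.\<close>

lemma gam_mem_iff:
  assumes P: "P \<in> places K" and Q: "nideal Q" "\<And>a b. a \<in> R \<Longrightarrow> b \<in> R \<Longrightarrow> a * b \<in> Q \<Longrightarrow> a \<in> Q \<or> b \<in> Q" "1 \<notin> Q"
  shows "gam P \<in> Q \<longleftrightarrow> P \<subseteq> Q"
proof
  assume g: "gam P \<in> Q"
  show "P \<subseteq> Q"
  proof
    fix a assume a: "a \<in> P"
    have aR: "a \<in> R" using nidealD(1)[OF placesD(1)[OF P] a] .
    have "a ^ hh P \<in> pw P (hh P)" by (rule pw_power_mem[OF a])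
    then have "a ^ hh P \<in> Q" unfolding hgam(4)[OF P] using nidealD(5)[OF Q(1) _ g] by auto
    moreover have "a ^ k \<in> Q \<Longrightarrow> a \<in> Q" for k
      by (induction k) (use Q(3) Q(2)[OF aR R_power[OF aR]] in auto)
    ultimately show "a \<in> Q" by blast
  qed
qed (use gam_mem[OF P] in blast)

lemma ordv_gam_other:
  assumes P: "P \<in> places K" and Q: "Q \<in> places K" and "P \<noteq> Q"
  shows "ordv K Q (gam P) = 0"
proof -
  have "gam P \<notin> Q"
    using gam_mem_iff[OF P placesD(1)[OF Q] placesD(5)[OF Q] placesD(4)[OF Q]] place_maximal[OF P Q] assms(3) by blast
  then show ?thesis using vOK_pos_iff[OF Q hgam(2,3)[OF P]] ordv_R[OF Q hgam(2,3)[OF P]] by simp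
qed

lemma finite_places_containing:
  assumes "a \<in> R" "a \<noteq> 0"
  shows "finite {P \<in> places K. a \<in> P}"
  using finite_ideals_containing[OF assms] by (rule rev_finite_subset) (auto dest: placesD(1))

lemma finite_support:
  assumes x: "x \<in> K - {0}"
  shows "finite {P \<in> places K. ordv K P x \<noteq> 0}"
proof -
  obtain a b where ab: "a \<in> R - {0}" "b \<in> R - {0}" "x = a / b" using K_fraction x by blast
  have "{P \<in> places K. ordv K P x \<noteq> 0} \<subseteq> {P \<in> places K. a \<in> P} \<union> {P \<in> places K. b \<in> P}"
  proof
    fix P assume P: "P \<in> {P \<in> places K. ordv K P x \<noteq> 0}"
    then have "vOK K P a > 0 \<or> vOK K P b > 0" using ordv_divide[of P a b] ab by auto
    then show "P \<in> {P \<in> places K. a \<in> P} \<union> {P \<in> places K. b \<in> P}" using P ab vOK_pos_iff by auto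
  qed
  moreover have "finite {P \<in> places K. a \<in> P}" "finite {P \<in> places K. b \<in> P}"
    using ab finite_places_containing by blast+
  ultimately show ?thesis by (meson finite_UnI finite_subset)
qed

lemma additive_powi:
  fixes f :: "complex \<Rightarrow> 'a :: field_char_0"
  assumes f: "\<And>x y. x \<in> K - {0} \<Longrightarrow> y \<in> K - {0} \<Longrightarrow> f (x * y) = f x + f y" and x: "x \<in> K - {0}"
  shows "f (x powi k) = of_int k * f x"
proof -
  have f1: "f 1 = 0" using f[of 1 1] subfield_closed(2)[OF sf] by simp
  have inv: "f (inverse x) = - f x"
    using f[of x "inverse x"] f1 x subfield_closed(6)[OF sf, of x] by (simp add: eq_neg_iff_add_eq_0 add.commute)
  have "inverse x \<in> K - {0}" using x subfield_closed(6)[OF sf, of x] by simp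
  then show ?thesis
    using additive_power[OF sf f x, of "nat k"] additive_power[OF sf f, of "inverse x" "nat (- k)"] inv
    by (auto simp: power_int_def)
qed

text \<open>A suitable power of \<open>x\<close> is a unit times a product of powers of the elements \<open>gam P\<close>.\<close>

lemma place_decomposition:
  fixes f :: "complex \<Rightarrow> 'a :: field_char_0"
  assumes f: "\<And>x y. x \<in> K - {0} \<Longrightarrow> y \<in> K - {0} \<Longrightarrow> f (x * y) = f x + f y"
    and fu: "\<And>u. u \<in> AUnits \<Longrightarrow> u \<in> K \<Longrightarrow> f u = 0" and x: "x \<in> K - {0}"
    and S: "finite S" "S \<subseteq> places K" "\<And>P. P \<in> places K \<Longrightarrow> ordv K P x \<noteq> 0 \<Longrightarrow> P \<in> S"
  shows "f x = (\<Sum>P\<in>S. of_int (ordv K P x) * f (gam P) / of_nat (hh P))"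
proof -
  \<comment> \<open>A common multiple of the \<open>hh P\<close>: the power \<open>x^H\<close> has
    at each place an order that an integral power of \<open>gam P\<close> can match.\<close>
  define H where "H = (\<Prod>P\<in>S. hh P)"
  have hp: "hh P > 0" if "P \<in> S" for P using hgam(1) S(2) that by blast
  have H0: "H > 0" unfolding H_def using hp by (simp add: prod_pos)
  have dv: "hh P dvd H" if "P \<in> S" for P unfolding H_def using S(1) that by (rule dvd_prodI)
  have gK: "gam P \<in> K - {0}" if "P \<in> S" for P using hgam S(2) R_K that by blast
  define e where "e P = ordv K P x * int (H div hh P)" for P
  define y where "y = (\<Prod>P\<in>S. gam P powi e P)"
  have trm: "gam P powi e P \<in> K - {0}" if "P \<in> S" for P
    using gK[OF that] subfield_powi[OF sf] by auto
  then have y: "y \<in> K - {0}" unfolding y_def using S(1) by (auto intro!: subfield_prod[OF sf])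
  have fprod: "f (\<Prod>P\<in>T. gam P powi e P) = (\<Sum>P\<in>T. f (gam P powi e P))" if "T \<subseteq> S" for T
    using finite_subset[OF that S(1)] that
  proof (induction T rule: finite_induct)
    case empty
    then show ?case using f[of 1 1] subfield_closed(2)[OF sf] by simp
  next
    case (insert P T)
    have "(\<Prod>P\<in>T. gam P powi e P) \<in> K - {0}" using insert trm by (auto intro!: subfield_prod[OF sf])
    then show ?case using insert trm[of P] f by simp
  qed
  define u where "u = x ^ H / y"
  have xH: "x ^ H \<in> K - {0}" using x subfield_power[OF sf] by simp
  have uK: "u \<in> K - {0}" using xH y subfield_closed(8)[OF sf] by (auto simp: u_def)
  have "u \<in> AUnits"
  proof (rule ordv_zero_imp_AUnits[OF uK])
    fix Q assume Q: "Q \<in> places K"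
    have "ordv K Q y = (\<Sum>P\<in>S. e P * ordv K Q (gam P))"
      unfolding y_def using ordv_prod[OF Q, of S "\<lambda>P. gam P powi e P"] trm gK
      by (simp add: ordv_powi[OF Q])
    also have "\<dots> = (\<Sum>P\<in>S. if P = Q then e Q * int (hh Q) else 0)"
      using S(2) ordv_gam_other[OF _ Q] ordv_gam_self[OF Q] by (intro sum.cong) auto
    also have "\<dots> = (if Q \<in> S then e Q * int (hh Q) else 0)" using S(1) by simp
    also have "\<dots> = int H * ordv K Q x"
      using dv[of Q] S(3)[OF Q] hp[of Q] by (auto simp: e_def mult.assoc simp flip: of_nat_mult)
    finally have "ordv K Q y = int H * ordv K Q x" .
    moreover have "ordv K Q (x ^ H) = ordv K Q (u * y)" using y by (simp add: u_def)
    ultimately show "ordv K Q u = 0" using ordv_mult[OF Q uK y] ordv_power[OF Q x, of H] by simp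
  qed
  then have "f u = 0" using fu uK by blast
  moreover have "f (x ^ H) = f (u * y)" using y by (simp add: u_def)
  ultimately have "of_nat H * f x = f y" using f[OF uK y] additive_power[OF sf f x, of H] by simp
  also have "\<dots> = (\<Sum>P\<in>S. of_int (e P) * f (gam P))"
    unfolding y_def fprod[OF subset_refl] using additive_powi[OF f] gK by (intro sum.cong) auto
  also have "\<dots> = of_nat H * (\<Sum>P\<in>S. of_int (ordv K P x) * f (gam P) / of_nat (hh P))"
    unfolding sum_distrib_left
  proof (rule sum.cong)
    fix P assume P: "P \<in> S"
    have "of_nat H = (of_nat (H div hh P) * of_nat (hh P) :: 'a)" using dv[OF P] by (simp flip: of_nat_mult)
    then show "of_int (e P) * f (gam P) = of_nat H * (of_int (ordv K P x) * f (gam P) / of_nat (hh P))"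
      using hp[OF P] by (simp add: e_def)
  qed simp
  finally show ?thesis using H0 by simp
qed

section \<open>Residue fields and the size of the generators\<close>

lemma place_nat_coprime:
  assumes P: "P \<in> places K" and a: "of_int a \<in> P" and b: "of_int b \<in> P"
  shows "\<not> coprime a b"
proof
  assume "coprime a b"
  obtain u v where uv: "u * a + v * b = gcd a b" using bezout_int[of a b] by blast
  have "of_int u * of_int a + of_int v * of_int b \<in> P"
    by (intro nidealD(3,4)[OF placesD(1)[OF P]] R_of_int a b)
  moreover have "of_int u * of_int a + of_int v * of_int b = (1 :: complex)"
    using uv \<open>coprime a b\<close> by (simp flip: of_int_mult of_int_add)
  ultimately show False using placesD(4)[OF P] by simp
qed

text \<open>The least positive integer in \<open>P\<close> is prime, since a proper factorization
  would give a smaller one; two distinct primes in \<open>P\<close> would give 1 by Bezout.\<close>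

lemma ex1_prime_below:
  assumes P: "P \<in> places K"
  shows "\<exists>!p::nat. prime p \<and> of_nat p \<in> P"
proof (rule ex_ex1I)
  note n = placesD(1)[OF P]
  define m where "m = (LEAST m::nat. m > 0 \<and> of_nat m \<in> P)"
  have ex: "\<exists>m::nat. m > 0 \<and> of_nat m \<in> P" using nideal_contains_nat[OF placesD(1,2)[OF P]] by blast
  have m: "m > 0" "of_nat m \<in> P" using LeastI_ex[OF ex] by (auto simp: m_def)
  have min: "m \<le> k" if "k > 0" "of_nat k \<in> P" for k :: nat unfolding m_def using that by (intro Least_le) simp
  have "prime m"
    unfolding prime_nat_iff
  proof (intro conjI allI impI)
    have "m \<noteq> 1" using m(2) placesD(4)[OF P] by auto
    then show "1 < m" using m(1) by simp
    fix d assume "d dvd m"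
    then obtain e where e: "m = d * e" by (auto simp: dvd_def)
    have pos: "d > 0" "e > 0" using m(1) e by auto
    have "of_nat d * of_nat e \<in> P" using m(2) e by simp
    then have "of_nat d \<in> P \<or> of_nat e \<in> P" by (rule placesD(5)[OF P R_of_nat R_of_nat])
    then have "m \<le> d \<or> m \<le> e" using min pos by blast
    then show "d = 1 \<or> d = m" using e pos m(1) by (metis dvd_imp_le dvd_triv_left dvd_triv_right le_antisym mult.right_neutral mult_eq_self_implies_10 mult.commute nat_neq_iff)
  qed
  then show "\<exists>p::nat. prime p \<and> of_nat p \<in> P" using m by blast
  fix p q :: nat assume pq: "prime p \<and> of_nat p \<in> P" "prime q \<and> of_nat q \<in> P"
  then have "\<not> coprime (int p) (int q)" by (intro place_nat_coprime[OF P]) auto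
  then show "p = q" using pq primes_coprime[of p q] by auto
qed

lemma prime_below:
  assumes "P \<in> places K"
  shows "prime (prime_below P)" "of_nat (prime_below P) \<in> P"
  using theI'[OF ex1_prime_below[OF assms]] unfolding prime_below_def by blast+

lemma prime_below_eq:
  assumes P: "P \<in> places K" and "prime p" "of_nat p \<in> P"
  shows "prime_below P = p"
  using ex1_prime_below[OF P] prime_below[OF P] assms(2,3) by blast

lemma of_nat_mem_place_iff:
  assumes P: "P \<in> places K"
  shows "of_nat m \<in> P \<longleftrightarrow> prime_below P dvd m"
proof
  assume "of_nat m \<in> P"
  then have "\<not> coprime (int (prime_below P)) (int m)"
    using prime_below[OF P] by (intro place_nat_coprime[OF P]) auto
  then show "prime_below P dvd m" using prime_imp_coprime[OF prime_below(1)[OF P]] by auto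
next
  assume "prime_below P dvd m"
  then obtain k where "m = prime_below P * k" by (auto simp: dvd_def)
  then show "of_nat m \<in> P" using nidealD(5)[OF placesD(1)[OF P] R_of_nat[of k] prime_below(2)[OF P]] by simp
qed

lemma prime_below_gt_1: "P \<in> places K \<Longrightarrow> prime_below P > 1"
  using prime_below(1) prime_gt_1_nat by blast

lemma ram_index_pos: "P \<in> places K \<Longrightarrow> ram_index K P > 0"
  unfolding ram_index_def using vOK_pos_iff[OF _ R_of_nat] prime_below[of P] prime_below_gt_1[of P] by simp

lemma ln_vnorm:
  assumes "P \<in> places K"
  shows "ln (vnorm K P x) = - real_of_int (ordv K P x) / real (ram_index K P) * ln (real (prime_below P))"
  unfolding vnorm_def using prime_below_gt_1[OF assms] by (simp add: ln_powr)

section \<open>Residue fields and residues modulo prime powers\<close>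

abbreviation cosets :: "complex set \<Rightarrow> complex set \<Rightarrow> complex set set" where
  "cosets P H \<equiv> (\<lambda>a. (+) a ` P) ` H"

lemma coset_eq_iff:
  assumes "nideal P"
  shows "(+) a ` P = (+) b ` P \<longleftrightarrow> a - b \<in> P"
proof
  assume "(+) a ` P = (+) b ` P"
  then have "a + 0 \<in> (+) b ` P" using nidealD(2)[OF assms] by blast
  then show "a - b \<in> P" by auto
next
  have sub: "(+) a ` P \<subseteq> (+) b ` P" if "a - b \<in> P" for a b
  proof
    fix x assume "x \<in> (+) a ` P"
    then obtain y where "y \<in> P" "x = a + y" by auto
    then have "x = b + ((a - b) + y)" "(a - b) + y \<in> P" using nidealD(3)[OF assms that] by auto
    then show "x \<in> (+) b ` P" by blast
  qed
  assume "a - b \<in> P"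
  moreover from this have "b - a \<in> P" using nidealD(6)[OF assms] by force
  ultimately show "(+) a ` P = (+) b ` P" using sub by blast
qed

lemma finite_cosets:
  assumes "nideal P" "P \<noteq> {0}"
  shows "finite (cosets P R)"
proof -
  obtain S where S: "finite S" "S \<subseteq> R" "\<And>x. x \<in> R \<Longrightarrow> \<exists>s\<in>S. x - s \<in> P"
    using finite_residues[OF assms] by blast
  have "cosets P R \<subseteq> cosets P S"
  proof
    fix C assume "C \<in> cosets P R"
    then obtain a where a: "a \<in> R" "C = (+) a ` P" by (elim imageE)
    obtain s where s: "s \<in> S" "a - s \<in> P" using S(3)[OF a(1)] by blast
    then have "C = (+) s ` P" unfolding a(2) coset_eq_iff[OF assms(1)] by simp
    then show "C \<in> cosets P S" using s(1) by (rule image_eqI)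
  qed
  then show ?thesis by (rule finite_subset) (rule finite_imageI[OF S(1)])
qed

text \<open>A subgroup between \<open>P\<close> and \<open>R\<close> whose index over \<open>P\<close> is a power of \<open>p\<close> can be enlarged by a factor \<open>p\<close>.\<close>

lemma card_residue_field_prime_power:
  assumes P: "P \<in> places K"
  shows "\<exists>f. prime_below P ^ f = card (cosets P R)"
proof -
  note n = placesD(1)[OF P]
  let ?p = "prime_below P"
  \<comment> \<open>Additive groups between \<open>P\<close> and \<open>R\<close> whose index over
    \<open>P\<close> is a power of \<open>p\<close>. One of maximal index exists because
    \<open>R\<close> has finitely many cosets.\<close>
  define sg where "sg H \<longleftrightarrow> P \<subseteq> H \<and> H \<subseteq> R \<and> (\<forall>x\<in>H. \<forall>y\<in>H. x + y \<in> H) \<and> (\<forall>x\<in>H. - x \<in> H)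
      \<and> (\<exists>f. ?p ^ f = card (cosets P H))" for H
  have pR: "P \<subseteq> R" using nidealD(1)[OF n] by blast
  have fin: "finite (cosets P H)" if "H \<subseteq> R" for H
    using finite_cosets[OF placesD(1,2)[OF P]] by (rule rev_finite_subset) (use that in blast)
  have "cosets P P = {P}"
  proof -
    have "(+) a ` P = P" if "a \<in> P" for a
      using coset_eq_iff[OF n, of a 0] that by simp
    then show ?thesis using nidealD(2)[OF n] by auto
  qed
  then have "sg P" unfolding sg_def using pR nidealD(3,6)[OF n] by (auto intro!: exI[of _ 0])
  moreover have "card (cosets P H) < Suc (card (cosets P R))" if "sg H" for H
    using card_mono[OF fin[OF subset_refl], of "cosets P H"] that unfolding sg_def by (auto simp: less_Suc_eq_le)
  ultimately obtain H where H: "sg H" and max: "\<And>H'. sg H' \<Longrightarrow> card (cosets P H') \<le> card (cosets P H)"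
    using ex_has_greatest_nat[of sg P "\<lambda>H. card (cosets P H)" "Suc (card (cosets P R))"] by (metis less_imp_le)
  have HP: "P \<subseteq> H" and HR: "H \<subseteq> R" and Hadd: "\<And>x y. x \<in> H \<Longrightarrow> y \<in> H \<Longrightarrow> x + y \<in> H"
    and Hneg: "\<And>x. x \<in> H \<Longrightarrow> - x \<in> H" using H unfolding sg_def by blast+
  have Hint: "of_int k * x \<in> H" if "x \<in> H" for k x
  proof -
    have nat: "of_nat k * x \<in> H" for k
      by (induction k) (use Hadd HP nidealD(2)[OF n] that in \<open>auto simp: distrib_right\<close>)
    show ?thesis using nat[of "nat k"] Hneg[OF nat[of "nat (- k)"]] by (cases "k \<ge> 0") auto
  qed
  have pH: "of_nat ?p * x \<in> H" if "x \<in> R" for x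
    using nidealD(5)[OF n that prime_below(2)[OF P]] HP by blast
  have "H = R"
  proof (rule ccontr)
    assume "H \<noteq> R"
    then obtain x where x: "x \<in> R" "x \<notin> H" using HR by blast
    define H' where "H' = {of_int k * x + h | k h. h \<in> H}"
    have H'I: "of_int k * x + h \<in> H'" if "h \<in> H" for k h using that unfolding H'_def by blast
    \<comment> \<open>Since \<open>p x\<close> lies in \<open>H\<close>, the cosets in
      \<open>H'\<close> are those of \<open>H\<close> translated by \<open>k x\<close> with
      \<open>k < p\<close>.\<close>
    define F where "F = (\<lambda>(k, C). (+) (of_nat k * x) ` C)"
    have comb: "(+) (of_nat k * x) ` ((+) h ` P) = (+) (of_nat k * x + h) ` P" for k h
      by (simp add: image_image add.assoc)
    have img: "F ` ({..<?p} \<times> cosets P H) = cosets P H'"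
    proof
      show "F ` ({..<?p} \<times> cosets P H) \<subseteq> cosets P H'"
      proof
        fix C assume "C \<in> F ` ({..<?p} \<times> cosets P H)"
        then obtain k h where "h \<in> H" "C = (+) (of_nat k * x + h) ` P" unfolding F_def using comb by auto
        then show "C \<in> cosets P H'" using H'I[of h "int k"] by simp
      qed
      show "cosets P H' \<subseteq> F ` ({..<?p} \<times> cosets P H)"
      proof
        fix C assume "C \<in> cosets P H'"
        then obtain k h where kh: "h \<in> H" "C = (+) (of_int k * x + h) ` P" unfolding H'_def by blast
        define r where "r = nat (k mod int ?p)"
        define h' where "h' = of_int (k div int ?p) * (of_nat ?p * x) + h"
        have rp: "r < ?p" using prime_below_gt_1[OF P] by (simp add: r_def nat_less_iff)
        have "int r + int ?p * (k div int ?p) = k"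
          using prime_below_gt_1[OF P] by (simp add: r_def)
        then have "of_int k = of_nat r + of_nat ?p * (of_int (k div int ?p) :: complex)"
          by (metis of_int_add of_int_mult of_int_of_nat_eq)
        then have "of_int k * x + h = of_nat r * x + h'" by (simp add: h'_def algebra_simps)
        moreover have "h' \<in> H" unfolding h'_def by (intro Hadd Hint pH x kh)
        ultimately have "C = F (r, (+) h' ` P)" "(r, (+) h' ` P) \<in> {..<?p} \<times> cosets P H"
          using kh(2) comb[of r h'] rp by (auto simp: F_def)
        then show "C \<in> F ` ({..<?p} \<times> cosets P H)" by blast
      qed
    qed
    have inj: "inj_on F ({..<?p} \<times> cosets P H)"
    proof (rule inj_onI)
      fix a b assume a: "a \<in> {..<?p} \<times> cosets P H" and b: "b \<in> {..<?p} \<times> cosets P H" and eq: "F a = F b"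
      obtain k h where kh: "a = (k, (+) h ` P)" "k < ?p" "h \<in> H" using a by blast
      obtain l g where lg: "b = (l, (+) g ` P)" "l < ?p" "g \<in> H" using b by blast
      have "(+) (of_nat k * x + h) ` P = (+) (of_nat l * x + g) ` P"
        using eq comb unfolding kh(1) lg(1) F_def by simp
      then have d: "(of_nat k * x + h) - (of_nat l * x + g) \<in> P" using coset_eq_iff[OF n] by blast
      \<comment> \<open>Otherwise \<open>(k - l) x\<close> and \<open>p x\<close> both lie in
        \<open>H\<close> with coprime multipliers, and then so does \<open>x\<close>.\<close>
      have "k = l"
      proof (rule ccontr)
        assume "k \<noteq> l"
        let ?z = "int k - int l"
        have "((of_nat k * x + h) - (of_nat l * x + g)) + (g + - h) \<in> H"
          by (intro Hadd Hneg kh lg) (use d HP in blast)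
        then have zx: "of_int ?z * x \<in> H" by (simp add: algebra_simps)
        have "\<not> int ?p dvd ?z"
        proof
          assume "int ?p dvd ?z"
          then have "int ?p \<le> \<bar>?z\<bar>" using \<open>k \<noteq> l\<close> by (intro zdvd_imp_le) auto
          then show False using kh(2) lg(2) by linarith
        qed
        then have "coprime (int ?p) ?z" using prime_below(1)[OF P] by (intro prime_imp_coprime) auto
        then obtain u v where "u * int ?p + v * ?z = 1" using bezout_int[of "int ?p" ?z] by auto
        then have "of_int u * of_nat ?p + of_int v * of_int ?z = (1::complex)"
          by (metis of_int_1 of_int_add of_int_mult of_int_of_nat_eq)
        then have "x = of_int u * (of_nat ?p * x) + of_int v * (of_int ?z * x)"
          by (metis distrib_right mult.assoc mult_1)
        also have "\<dots> \<in> H" by (intro Hadd Hint pH x zx)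
        finally show False using x by blast
      qed
      moreover from this have "h - g \<in> P" using d by simp
      ultimately show "a = b" using kh(1) lg(1) coset_eq_iff[OF n] by blast
    qed
    have card: "card (cosets P H') = ?p * card (cosets P H)"
      using card_image[OF inj] by (simp add: img card_cartesian_product)
    have "sg H'"
      unfolding sg_def
    proof (intro conjI ballI)
      show "P \<subseteq> H'" using H'I[of _ 0] HP by force
      show "H' \<subseteq> R" using x HR by (auto simp: H'_def intro!: R_add R_mult R_of_int)
      show "\<exists>f. ?p ^ f = card (cosets P H')" using H card unfolding sg_def by (metis power_Suc)
      fix a assume "a \<in> H'"
      then obtain k h where kh: "h \<in> H" "a = of_int k * x + h" unfolding H'_def by blast
      show "- a \<in> H'" using H'I[OF Hneg[OF kh(1)], of "- k"] kh(2) by simp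
      fix b assume "b \<in> H'"
      then obtain l g where lg: "g \<in> H" "b = of_int l * x + g" unfolding H'_def by blast
      show "a + b \<in> H'" using H'I[OF Hadd[OF kh(1) lg(1)], of "k + l"] kh(2) lg(2) by (simp add: algebra_simps)
    qed
    from max[OF this] have "?p * card (cosets P H) \<le> card (cosets P H)" using card by simp
    moreover have "card (cosets P H) > 0"
      using fin[OF HR] HP nidealD(2)[OF n] by (auto simp: card_gt_0_iff)
    ultimately show False using prime_below_gt_1[OF P] by simp
  qed
  then show ?thesis using H unfolding sg_def by blast
qed

lemma res_degree:
  assumes P: "P \<in> places K"
  shows "prime_below P ^ res_degree K P = card (cosets P R)"
proof -
  obtain f where f: "prime_below P ^ f = card (cosets P R)" using card_residue_field_prime_power[OF P] by blast
  have "res_degree K P = f"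
    unfolding res_degree_def
  proof (rule the_equality)
    fix f' assume "prime_below P ^ f' = card (cosets P R)"
    then have "prime_below P ^ f' = prime_below P ^ f" using f by simp
    then show "f' = f" using prime_below_gt_1[OF P] by (simp add: power_inject_exp)
  qed (rule f)
  then show ?thesis using f by simp
qed

text \<open>By Nakayama's lemma some \<open>a\<close> in \<open>P^k\<close> is outside
  \<open>P^(k+1)\<close>, and modulo \<open>P^(k+1)\<close> every element of \<open>P^k\<close> is a
  multiple of it. So each residue modulo \<open>P^k\<close> splits into at most
  \<open>card (cosets P R)\<close> residues.\<close>

lemma residues_mod_power:
  assumes P: "P \<in> places K"
  shows "\<exists>T. finite T \<and> T \<subseteq> R \<and> card T \<le> card (cosets P R) ^ k \<and> (\<forall>x\<in>R. \<exists>t\<in>T. x - t \<in> pw P k)"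
proof (induction k)
  case 0
  show ?case by (rule exI[of _ "{0}"]) (auto simp: R_0)
next
  case (Suc k)
  note n = placesD(1)[OF P]
  let ?q = "card (cosets P R)" and ?g = "gam P" and ?h = "hh P"
  obtain T where T: "finite T" "T \<subseteq> R" "card T \<le> ?q ^ k" "\<And>x. x \<in> R \<Longrightarrow> \<exists>t\<in>T. x - t \<in> pw P k" using Suc by blast
  define S where "S = inv_into R (\<lambda>a. (+) a ` P) ` cosets P R"
  have S: "finite S" "card S \<le> ?q" "S \<subseteq> R"
    using finite_cosets[OF placesD(1,2)[OF P]] by (auto simp: S_def card_image_le inv_into_into)
  have Sres: "\<exists>s\<in>S. x - s \<in> P" if x: "x \<in> R" for x
  proof -
    let ?s = "inv_into R (\<lambda>a. (+) a ` P) ((+) x ` P)"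
    have "(+) ?s ` P = (+) x ` P" by (rule f_inv_into_f) (use x in blast)
    then have "x - ?s \<in> P" using coset_eq_iff[OF n] by metis
    then show ?thesis using x unfolding S_def by blast
  qed
  have "\<not> pw P k \<subseteq> pw P (Suc k)"
    using nakayama[OF pw_nideal[OF n] pw_nonzero[OF placesD(1,2)[OF P]] n, of k] placesD(4)[OF P] by auto
  then obtain a where a: "a \<in> pw P k" "a \<notin> pw P (Suc k)" by blast
  have aR: "a \<in> R" using nidealD(1)[OF pw_nideal[OF n] a(1)] .
  obtain u where u: "u \<in> pw P ((?h - 1) * k)" "a * u / ?g ^ k \<in> R" "a * u / ?g ^ k \<notin> P"
    by (rule unit_witness[OF P a])
  obtain w where w: "w \<in> R" "a * u / ?g ^ k * w - 1 \<in> P" using place_inverse[OF P u(2,3)] by blast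
  have hk: "k + (?h - 1) * k = ?h * k + 0" using hgam(1)[OF P] by (cases ?h) auto
  define T' where "T' = (\<lambda>(t,s). t + a * s) ` (T \<times> S)"
  have "finite T'" using T S by (simp add: T'_def)
  moreover have "T' \<subseteq> R" using T(2) S(3) aR by (auto simp: T'_def intro!: R_add R_mult)
  moreover have "card T' \<le> ?q ^ Suc k"
  proof -
    have "card T' \<le> card (T \<times> S)" unfolding T'_def using T S by (intro card_image_le) simp
    also have "\<dots> = card T * card S" by (simp add: card_cartesian_product)
    also have "\<dots> \<le> ?q ^ k * ?q" using T S by (intro mult_mono) auto
    finally show ?thesis by (simp add: mult.commute)
  qed
  moreover have "\<exists>t\<in>T'. x - t \<in> pw P (Suc k)" if x: "x \<in> R" for x
  proof -
    note ns = pw_nideal[OF n, of "Suc k"]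
    obtain t where t: "t \<in> T" "x - t \<in> pw P k" using T(4)[OF x] by blast
    let ?y = "x - t"
    \<comment> \<open>\<open>c\<close> plays the quotient of \<open>x - t\<close> by
      \<open>a\<close> modulo \<open>P\<close>: numerator and denominator are scaled by
      \<open>u / gam P ^ k\<close>, and \<open>w\<close> inverts the scaled denominator modulo
      \<open>P\<close>.\<close>
    define c where "c = ?y * u / ?g ^ k * w"
    have "?y * u \<in> pw P (?h * k + 0)" using pw_mult_mem[OF n t(2) u(1)] unfolding hk .
    from pw_div_mem[OF P this] have "?y * u / ?g ^ k \<in> R" by simp
    then have cR: "c \<in> R" unfolding c_def using w(1) by (rule R_mult)
    obtain s where s: "s \<in> S" "c - s \<in> P" using Sres[OF cR] by blast
    have "?y * (a * u / ?g ^ k * w - 1) \<in> pw P (Suc k)" using idm_memI[OF t(2) w(2)] by simp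
    moreover have "a * (c - s) \<in> pw P (Suc k)" using idm_memI[OF a(1) s(2)] by simp
    ultimately have "a * (c - s) - ?y * (a * u / ?g ^ k * w - 1) \<in> pw P (Suc k)" by (intro nidealD(7)[OF ns])
    moreover have "a * (c - s) - ?y * (a * u / ?g ^ k * w - 1) = x - (t + a * s)"
      by (simp add: c_def algebra_simps)
    ultimately have "x - (t + a * s) \<in> pw P (Suc k)" by metis
    moreover have "t + a * s \<in> T'" unfolding T'_def using t(1) s(1) by (intro image_eqI[of _ _ "(t,s)"]) auto
    ultimately show ?thesis by blast
  qed
  ultimately show ?case by blast
qed

lemma card_cosets_ge_1:
  assumes P: "P \<in> places K"
  shows "card (cosets P R) \<ge> 1"
proof -
  have "cosets P R \<noteq> {}" using R_0 by blast
  then show ?thesis using finite_cosets[OF placesD(1,2)[OF P]] by (simp add: Suc_le_eq card_gt_0_iff)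
qed

text \<open>Among the lattice points of a box two are congruent modulo \<open>P\<^sup>h\<^sup>s = (\<gamma>\<^sup>s)\<close>; their difference
  is small but divisible by \<open>\<gamma>\<^sup>s\<close>.  Letting \<open>s\<close> tend to infinity removes the constant.\<close>

lemma lnorm_gam_le:
  assumes P: "P \<in> places K"
  shows "real deg * lnorm (gam P) \<le> real (hh P) * ln (real (card (cosets P R)))"
proof (rule ccontr)
  note n = placesD(1)[OF P]
  let ?q = "card (cosets P R)" and ?h = "hh P" and ?g = "gam P"
  assume neg: "\<not> ?thesis"
  define d where "d = real deg * lnorm ?g - real ?h * ln (real ?q)"
  have d: "d > 0" using neg by (simp add: d_def)
  have q1: "real ?q \<ge> 1" using card_cosets_ge_1[OF P] by simp
  obtain C where C: "C > 0"
    "\<And>q \<epsilon> \<sigma>. (\<And>i. i < deg \<Longrightarrow> \<bar>real_of_rat (q i)\<bar> \<le> \<epsilon>) \<Longrightarrow> \<sigma> \<in> GalQ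
      \<Longrightarrow> cmod (\<sigma> (\<Sum>i<deg. of_rat (q i) * ib i)) \<le> C * \<epsilon>"
    using conj_bound by metis
  have bound: "real s * d \<le> real deg * ln C" for s :: nat
  proof -
    \<comment> \<open>\<open>r\<close> is the real side length with \<open>r^deg = q^(h s)\<close>.
      Rounding down to \<open>B\<close> still leaves \<open>(B + 1)^deg\<close> points in the box,
      more than the number of residues.\<close>
    define r where "r = real ?q powr (real (?h * s) / real deg)"
    have r1: "r \<ge> 1" unfolding r_def using q1 by (intro ge_one_powr_ge_zero) auto
    define B where "B = nat \<lfloor>r\<rfloor>"
    have B: "real B \<le> r" "r < real B + 1" "B \<ge> 1" using r1 unfolding B_def by linarith+
    have "r ^ deg = real ?q ^ (?h * s)"
      unfolding r_def using q1 deg_pos by (simp add: powr_powr powr_realpow flip: powr_realpow)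
    moreover have "r ^ deg < real (B + 1) ^ deg" using B r1 deg_pos by (intro power_strict_mono) auto
    ultimately have big: "?q ^ (?h * s) < (B + 1) ^ deg" by (metis of_nat_less_iff of_nat_power)
    obtain T where T: "finite T" "T \<subseteq> R" "card T \<le> ?q ^ (?h * s)" "\<And>x. x \<in> R \<Longrightarrow> \<exists>t\<in>T. x - t \<in> pw P (?h * s)"
      using residues_mod_power[OF P] by metis
    define box where "box = ({..<deg} \<rightarrow>\<^sub>E {0..B})"
    define pt where "pt z = (\<Sum>i<deg. of_nat (z i) * ib i)" for z :: "nat \<Rightarrow> nat"
    have ptR: "pt z \<in> R" for z unfolding pt_def by (intro R_sum R_mult R_of_nat ib_R) simp
    have "\<forall>z. \<exists>t\<in>T. pt z - t \<in> pw P (?h * s)" using T(4) ptR by blast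
    then obtain F where F: "\<And>z. F z \<in> T" "\<And>z. pt z - F z \<in> pw P (?h * s)" by metis
    have "card (F ` box) \<le> card T" using F(1) by (intro card_mono T) blast
    also have "\<dots> < card box" using T(3) big by (simp add: box_def card_PiE)
    finally have "\<not> inj_on F box" by (rule pigeonhole)
    then obtain z z' where zz: "z \<in> box" "z' \<in> box" "F z = F z'" "z \<noteq> z'" unfolding inj_on_def by blast
    define w where "w i = rat_of_nat (z i) - rat_of_nat (z' i)" for i
    define y where "y = pt z - pt z'"
    have y_eq: "y = (\<Sum>i<deg. of_rat (w i) * ib i)"
      by (simp add: y_def pt_def w_def of_rat_diff sum_subtractf algebra_simps)
    have "y \<noteq> 0"
    proof
      assume "y = 0"
      then have "w i = 0" if "i < deg" for i using ib_indep[of w i] that y_eq by simp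
      then have "z i = z' i" for i
        using zz(1,2) by (cases "i < deg") (auto simp: w_def box_def PiE_def extensional_def)
      then show False using zz(4) by blast
    qed
    have "(pt z - F z) - (pt z' - F z') \<in> pw P (?h * s)" by (intro nidealD(7)[OF pw_nideal[OF n]] F)
    then have "y \<in> pw P (?h * s + 0)" using zz(3) by (simp add: y_def)
    from pw_div_mem[OF P this] have b: "y / ?g ^ s \<in> R" by simp
    have g0: "?g \<noteq> 0" using hgam(3)[OF P] .
    have "lnorm y = lnorm (?g ^ s * (y / ?g ^ s))" using g0 by simp
    also have "\<dots> = lnorm (?g ^ s) + lnorm (y / ?g ^ s)"
      using b \<open>y \<noteq> 0\<close> g0 by (intro lnorm_mult Qbar_units_closed gam_units[OF P] K_units R_K) auto
    also have "\<dots> = real s * lnorm ?g + lnorm (y / ?g ^ s)" using lnorm_power[OF gam_units[OF P]] by simp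
    finally have "real s * lnorm ?g \<le> lnorm y"
      using lnorm_nonneg[of "y / ?g ^ s"] b \<open>y \<noteq> 0\<close> g0 by (simp add: R_iff)
    also have "lnorm y \<le> ln (C * real B)"
    proof (rule lnorm_le)
      show "y \<in> Qbar_units" using \<open>y \<noteq> 0\<close> ptR R_diff R_K K_units unfolding y_def by blast
      fix \<sigma> assume s: "\<sigma> \<in> GalQ"
      have "\<bar>real_of_rat (w i)\<bar> \<le> real B" if "i < deg" for i
      proof -
        have "z i \<le> B" "z' i \<le> B" using zz(1,2) that by (auto simp: box_def PiE_def Pi_def)
        then show ?thesis by (simp add: w_def of_rat_diff del: abs_of_rat)
      qed
      then show "cmod (\<sigma> y) \<le> C * real B" unfolding y_eq by (intro C(2) s)
    qed
    also have "\<dots> = ln C + ln (real B)" using C(1) B(3) by (simp add: ln_mult)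
    also have "ln (real B) \<le> ln r" using B by simp
    also have "ln r = real (?h * s) / real deg * ln (real ?q)" unfolding r_def using q1 by (simp add: ln_powr)
    finally have "real s * lnorm ?g \<le> ln C + real (?h * s) / real deg * ln (real ?q)" by simp
    then have "real deg * (real s * lnorm ?g) \<le> real deg * (ln C + real (?h * s) / real deg * ln (real ?q))"
      by (intro mult_left_mono) auto
    then show ?thesis using deg_pos by (simp add: d_def algebra_simps)
  qed
  obtain s :: nat where "real deg * ln C < real s * d" using reals_Archimedean3[OF d] by blast
  then show False using bound[of s] by linarith
qed

text \<open>The ramification index in the local degree cancels the one in \<open>vnorm\<close>, and
  the residue degree times \<open>ln p\<close> is the logarithm of the size of the residue
  field.\<close>

lemma ln_vabs:
  assumes P: "P \<in> places K"
  shows "ln (vabs K P x) = - real_of_int (ordv K P x) * ln (real (card (cosets P R))) / real deg"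
proof -
  have "vnorm K P x > 0" unfolding vnorm_def using prime_below_gt_1[OF P] by simp
  then have "ln (vabs K P x) = real (local_degree K P) / real deg * ln (vnorm K P x)"
    unfolding vabs_def by (simp add: ln_powr)
  also have "\<dots> = - real_of_int (ordv K P x) * (real (res_degree K P) * ln (real (prime_below P))) / real deg"
    unfolding ln_vnorm[OF P] local_degree_def using ram_index_pos[OF P] by simp
  also have "real (res_degree K P) * ln (real (prime_below P)) = ln (real (card (cosets P R)))"
    unfolding res_degree[OF P, symmetric] using prime_below_gt_1[OF P] by (simp add: ln_realpow)
  finally show ?thesis .
qed

text \<open>The left side is the contribution of \<open>P\<close> to the expansion of
  \<open>lnorm\<close> in the generators, up to sign; the right side is its contribution to
  \<open>normS\<close>. Continuity follows from this comparison place by place.\<close>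

lemma lnorm_gam_le_vabs:
  assumes P: "P \<in> places K"
  shows "\<bar>real_of_int (ordv K P x)\<bar> * lnorm (gam P) / real (hh P) \<le> \<bar>ln (vabs K P x)\<bar>"
proof -
  have q: "ln (real (card (cosets P R))) \<ge> 0" using card_cosets_ge_1[OF P] by simp
  have "lnorm (gam P) / real (hh P) \<le> ln (real (card (cosets P R))) / real deg"
    using lnorm_gam_le[OF P] hgam(1)[OF P] deg_pos by (simp add: field_simps)
  from mult_left_mono[OF this, of "\<bar>real_of_int (ordv K P x)\<bar>"] show ?thesis
    unfolding ln_vabs[OF P] using q by (simp add: abs_mult)
qed

text \<open>Positivity of \<open>lnorm (gam P)\<close> excludes a trivial residue factor. The sum in
  \<open>normS\<close> therefore runs exactly over the support of \<open>x\<close>.\<close>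

lemma ln_vabs_nonzero:
  assumes P: "P \<in> places K" and "ordv K P x \<noteq> 0"
  shows "ln (vabs K P x) \<noteq> 0"
proof
  assume "ln (vabs K P x) = 0"
  then have "\<bar>real_of_int (ordv K P x)\<bar> * lnorm (gam P) / real (hh P) \<le> 0" using lnorm_gam_le_vabs[OF P, of x] by simp
  moreover have "\<bar>real_of_int (ordv K P x)\<bar> * lnorm (gam P) / real (hh P) > 0"
    using lnorm_gam_pos[OF P] hgam(1)[OF P] assms(2) by simp
  ultimately show False by linarith
qed

end

section \<open>Compactly supported functionals\<close>

lemma SdualD:
  assumes "\<Phi> \<in> Sdual"
  shows "x \<in> Qbar_units \<Longrightarrow> y \<in> Qbar_units \<Longrightarrow> \<Phi> (x * y) = \<Phi> x + \<Phi> y"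
    "u \<in> AUnits \<Longrightarrow> \<Phi> u = 0" "z \<notin> Qbar_units \<Longrightarrow> \<Phi> z = 0"
  using assms unfolding Sdual_def by blast+

lemma Sdual_power: "\<Phi> \<in> Sdual \<Longrightarrow> x \<in> Qbar_units \<Longrightarrow> \<Phi> (x ^ n) = of_nat n * \<Phi> x"
  by (rule additive_power[OF subfield_Qbar]) (auto simp: SdualD Qbar_units_def)

text \<open>The algebraic integers all of whose prime divisors lie over \<open>p\<close>.\<close>

definition pelem :: "nat \<Rightarrow> complex \<Rightarrow> bool" where
  "pelem p a \<longleftrightarrow> alg_int a \<and> a \<noteq> 0 \<and> (\<exists>k. alg_int (of_nat p ^ k / a))"

context nfield
begin

lemma ordv_of_nat_eq_0:
  assumes P: "P \<in> places K" and m: "m > 0" "\<not> prime_below P dvd m"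
  shows "ordv K P (of_nat m) = 0"
  using vOK_pos_iff[OF P R_of_nat, of m] ordv_R[OF P R_of_nat, of m] of_nat_mem_place_iff[OF P, of m] m by simp

text \<open>\<open>m\<close> has order 0 at \<open>P\<close>, so integrality of \<open>m x\<close>
  and of \<open>m / x\<close> bounds the order of \<open>x\<close> from both sides.\<close>

lemma ordv_eq_0_if_dvd_nat:
  assumes P: "P \<in> places K" and x: "x \<in> K" "x \<noteq> 0" and m: "m > 0" "\<not> prime_below P dvd m"
    and "alg_int (of_nat m * x)" "alg_int (of_nat m / x)"
  shows "ordv K P x = 0"
proof -
  have m0: "of_nat m \<in> K - {0}" using m R_of_nat R_K by auto
  have ge: "ordv K P y \<ge> 0" if "y \<in> K" "y \<noteq> 0" "alg_int y" for y
    using ordv_R[OF P, of y] that by (simp add: R_iff)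
  have mx: "of_nat m * x \<in> K" "of_nat m / x \<in> K" using m0 x by (auto intro: subfield_closed[OF sf])
  have xx: "x \<in> K - {0}" "inverse x \<in> K - {0}" using x subfield_closed(6)[OF sf] by auto
  have "ordv K P (of_nat m * x) \<ge> 0" "ordv K P (of_nat m * inverse x) \<ge> 0"
    using ge[OF mx(1)] ge[OF mx(2)] x m assms(6,7) by (auto simp: divide_inverse)
  then show ?thesis
    using ordv_mult[OF P m0 xx(1)] ordv_mult[OF P m0 xx(2)] ordv_inverse[OF P xx(1)]
      ordv_of_nat_eq_0[OF P m] by simp
qed

lemma pelem_ordv:
  assumes "P \<in> places K" "prime p" "prime_below P \<noteq> p" "pelem p x" "x \<in> K"
  shows "ordv K P x = 0"
proof -
  obtain k where k: "alg_int x" "x \<noteq> 0" "alg_int (of_nat p ^ k / x)" using assms(4) by (auto simp: pelem_def)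
  have nd: "\<not> prime_below P dvd p ^ k"
    using prime_below(1)[OF assms(1)] assms(2,3) prime_dvd_power primes_dvd_imp_eq by blast
  show ?thesis
    by (rule ordv_eq_0_if_dvd_nat[OF assms(1,5) k(2) _ nd])
      (use k assms(2) in \<open>simp_all add: prime_gt_0_nat alg_int_mult alg_int_power\<close>)
qed

text \<open>The power \<open>p^h\<close> lies in \<open>P^h\<close>, so it is a multiple of
  \<open>gam P\<close>.\<close>

lemma pelem_gam:
  assumes P: "P \<in> places K"
  shows "pelem (prime_below P) (gam P)"
proof -
  have "of_nat (prime_below P) ^ hh P \<in> pw P (hh P)" by (rule pw_power_mem[OF prime_below(2)[OF P]])
  then obtain r where "r \<in> R" "of_nat (prime_below P) ^ hh P = gam P * r" unfolding hgam(4)[OF P] by blast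
  then have "alg_int (of_nat (prime_below P) ^ hh P / gam P)" using hgam(3)[OF P] by (simp add: R_iff)
  then show ?thesis using hgam(2,3)[OF P] by (auto simp: pelem_def R_iff)
qed

lemma Sdual_decomposition:
  assumes "\<Phi> \<in> Sdual" "x \<in> K" "x \<noteq> 0"
    and "finite S" "S \<subseteq> places K" "\<And>P. P \<in> places K \<Longrightarrow> ordv K P x \<noteq> 0 \<Longrightarrow> P \<in> S"
  shows "\<Phi> x = (\<Sum>P\<in>S. of_int (ordv K P x) * \<Phi> (gam P) / of_nat (hh P))"
  by (rule place_decomposition) (use assms SdualD(1,2)[OF assms(1)] K_units in auto)

lemma finite_places_over:
  assumes "finite \<PP>"
  shows "finite {P \<in> places K. prime_below P \<in> \<PP>}"
proof -
  have "{P \<in> places K. prime_below P \<in> \<PP>} \<subseteq> (\<Union>p\<in>\<PP> - {0}. {P \<in> places K. of_nat p \<in> P})"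
    using prime_below(2) prime_below_gt_1 by fastforce
  moreover have "finite (\<Union>p\<in>\<PP> - {0}. {P \<in> places K. of_nat p \<in> P})"
    using assms by (intro finite_UN_I) (auto intro!: finite_places_containing R_of_nat)
  ultimately show ?thesis by (rule finite_subset)
qed

definition coeff_of :: "(complex \<Rightarrow> rat) \<Rightarrow> complex set \<Rightarrow> rat" where
  "coeff_of \<Phi> P = - (of_nat (ram_index K P) * \<Phi> (gam P) / of_nat (hh P))"

end

lemma in_SK_wit_ex:
  assumes "\<alpha> \<in> Qbar_units"
  shows "\<exists>K n x. number_field K \<and> in_SK_wit K \<alpha> n x"
proof -
  obtain K where K: "number_field K" "{\<alpha>} \<subseteq> K"
    using ex_number_field_superset[of "{\<alpha>}"] assms by (auto simp: Qbar_units_def)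
  have "in_SK_wit K \<alpha> 1 \<alpha>"
    using K assms by (auto simp: in_SK_wit_def Qbar_units_def AUnits_def intro!: bexI[of _ 1])
  then show ?thesis using K by blast
qed

text \<open>Brings the choices hidden in \<open>Phi_c\<close> into the open. They depend on \<alpha>
  only, not on \<open>c\<close>; the logarithms of \<open>p\<close> cancel, and any finite set of
  places containing the support of \<open>x\<close> may serve as index set.\<close>

lemma Phi_c_formula:
  assumes \<alpha>: "\<alpha> \<in> Qbar_units"
  shows "\<exists>K n x. number_field K \<and> in_SK_wit K \<alpha> n x \<and>
    (\<forall>c S. finite S \<and> S \<subseteq> places K \<and> (\<forall>P\<in>places K. ordv K P x \<noteq> 0 \<longrightarrow> P \<in> S) \<longrightarrow>
      Phi_c c \<alpha> = - (\<Sum>P\<in>S. real_of_rat (c (K, P)) * real_of_int (ordv K P x) / (real n * real (ram_index K P))))"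
proof -
  define K where "K = (SOME K. number_field K \<and> (\<exists>n x. in_SK_wit K \<alpha> n x))"
  define nx where "nx = (SOME nx. in_SK_wit K \<alpha> (fst nx) (snd nx))"
  have "\<exists>K. number_field K \<and> (\<exists>n x. in_SK_wit K \<alpha> n x)" using in_SK_wit_ex[OF \<alpha>] by blast
  then have K: "number_field K" "\<exists>n x. in_SK_wit K \<alpha> n x"
    unfolding atomize_conj K_def by (rule someI_ex)
  then have "\<exists>nx. in_SK_wit K \<alpha> (fst nx) (snd nx)" by auto
  then have nx: "in_SK_wit K \<alpha> (fst nx) (snd nx)" unfolding nx_def by (rule someI_ex)
  interpret nfield K using K by unfold_locales
  obtain n x where nxe: "nx = (n, x)" by fastforce
  have n: "n \<ge> 1" using nx by (simp add: nxe in_SK_wit_def)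
  define trm where "trm c P = real_of_rat (c (K, P)) / ln (real (prime_below P))
      * ln (vnorm K P x powr (1 / real n))" for c :: "complex set \<times> complex set \<Rightarrow> rat" and P
  have trm: "trm c P = - (real_of_rat (c (K, P)) * real_of_int (ordv K P x) / (real n * real (ram_index K P)))"
    if P: "P \<in> places K" for c P
  proof -
    have "vnorm K P x > 0" unfolding vnorm_def using prime_below_gt_1[OF P] by simp
    moreover have "ln (real (prime_below P)) > 0" using prime_below_gt_1[OF P] by simp
    ultimately show ?thesis unfolding trm_def by (simp add: ln_powr ln_vnorm[OF P])
  qed
  have form: "Phi_c c \<alpha> = - (\<Sum>P\<in>S. real_of_rat (c (K, P)) * real_of_int (ordv K P x) / (real n * real (ram_index K P)))"
    if S: "finite S" "S \<subseteq> places K" "\<And>P. P \<in> places K \<Longrightarrow> ordv K P x \<noteq> 0 \<Longrightarrow> P \<in> S" for c S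
  proof -
    have "Phi_c c \<alpha> = (\<Sum>P\<in>{P \<in> places K. trm c P \<noteq> 0}. trm c P)"
      unfolding Phi_c_def Let_def K_def[symmetric] nx_def[symmetric] using \<alpha> by (simp add: nxe trm_def)
    also have "\<dots> = (\<Sum>P\<in>S. trm c P)"
    proof (rule sum.mono_neutral_left[OF S(1)])
      show "{P \<in> places K. trm c P \<noteq> 0} \<subseteq> S"
      proof
        fix P assume P: "P \<in> {P \<in> places K. trm c P \<noteq> 0}"
        then have "ordv K P x \<noteq> 0" using trm[of P c] by auto
        then show "P \<in> S" using S(3) P by blast
      qed
      show "\<forall>P\<in>S - {P \<in> places K. trm c P \<noteq> 0}. trm c P = 0" using S(2) by blast
    qed
    also have "\<dots> = - (\<Sum>P\<in>S. real_of_rat (c (K, P)) * real_of_int (ordv K P x) / (real n * real (ram_index K P)))"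
      unfolding sum_negf[symmetric] using S(2) by (intro sum.cong) (auto simp: trm)
    finally show ?thesis .
  qed
  have w: "in_SK_wit K \<alpha> n x" using nx by (simp add: nxe)
  show ?thesis by (intro exI[of _ K] exI[of _ n] exI[of _ x] conjI allI impI K(1) w form) auto
qed

text \<open>The order at \<open>Q\<close> is an additive function on \<open>K\<close> trivial on
  units, so it expands in the generators of the places of \<open>K\<close>. Only
  \<open>gam P\<close> can have nonzero order at \<open>Q\<close>, so on \<open>K\<close> it is a
  multiple of the order at \<open>P\<close>.\<close>

lemma place_below_decomposition:
  assumes K: "number_field K" and L: "number_field L" and KL: "K \<subseteq> L"
    and P: "P \<in> places K" and Q: "Q \<in> places L" and QP: "Q \<inter> OK K = P" and x: "x \<in> K" "x \<noteq> 0"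
  shows "ordv L Q x * int (nfield.hh K P) = ordv K P x * ordv L Q (nfield.gam K P)"
proof -
  interpret K: nfield K using K by unfold_locales
  interpret L: nfield L using L by unfold_locales
  have OKL: "OK K \<subseteq> OK L" using KL by (auto simp: OK_def)
  define S where "S = insert P {P' \<in> places K. ordv K P' x \<noteq> 0}"
  have S: "finite S" "S \<subseteq> places K" using K.finite_support[of x] x P by (auto simp: S_def)
  have z: "ordv L Q (K.gam P') = 0" if P': "P' \<in> places K" "P' \<noteq> P" for P'
  proof -
    have "K.gam P' \<notin> P"
      using K.gam_mem_iff[OF P'(1) K.placesD(1)[OF P] K.placesD(5)[OF P] K.placesD(4)[OF P]]
        K.place_maximal[OF P'(1) P] P'(2) by blast
    then have "K.gam P' \<notin> Q" using QP K.hgam(2)[OF P'(1)] by blast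
    then show ?thesis
      using L.vOK_pos_iff[OF Q, of "K.gam P'"] L.ordv_R[OF Q, of "K.gam P'"] K.hgam[OF P'(1)] OKL by auto
  qed
  have "rat_of_int (ordv L Q x) = (\<Sum>P'\<in>S. of_int (ordv K P' x) * rat_of_int (ordv L Q (K.gam P')) / of_nat (K.hh P'))"
  proof (rule K.place_decomposition)
    show "rat_of_int (ordv L Q (x * y)) = rat_of_int (ordv L Q x) + rat_of_int (ordv L Q y)"
      if "x \<in> K - {0}" "y \<in> K - {0}" for x y
      using that KL by (subst L.ordv_mult[OF Q]) auto
    show "rat_of_int (ordv L Q u) = 0" if "u \<in> AUnits" "u \<in> K" for u
      using L.AUnits_imp_ordv_zero[OF Q that(1)] that(2) KL by auto
  qed (use x S in \<open>auto simp: S_def\<close>)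
  also have "\<dots> = (\<Sum>P'\<in>S. if P' = P then of_int (ordv K P x) * rat_of_int (ordv L Q (K.gam P)) / of_nat (K.hh P) else 0)"
    using z S(2) by (intro sum.cong) auto
  also have "\<dots> = of_int (ordv K P x) * rat_of_int (ordv L Q (K.gam P)) / of_nat (K.hh P)"
    using S(1) by (simp add: S_def)
  finally have "rat_of_int (ordv L Q x) * of_nat (K.hh P) = of_int (ordv K P x) * rat_of_int (ordv L Q (K.gam P))"
    using K.hgam(1)[OF P] by simp
  then have "rat_of_int (ordv L Q x * int (K.hh P)) = rat_of_int (ordv K P x * ordv L Q (K.gam P))" by simp
  then show ?thesis by (simp only: of_int_eq_iff)
qed

text \<open>The contraction of \<open>Q\<close> is a nonzero prime ideal that contains
  \<open>gam P\<close>, hence contains \<open>P\<close> and equals it by maximality.\<close>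

lemma gam_mem_imp_below:
  assumes K: "number_field K" and L: "number_field L" and KL: "K \<subseteq> L"
    and P: "P \<in> places K" and Q: "Q \<in> places L" and g: "nfield.gam K P \<in> Q"
  shows "Q \<inter> OK K = P"
proof -
  interpret K: nfield K using K by unfold_locales
  interpret L: nfield L using L by unfold_locales
  have OKL: "OK K \<subseteq> OK L" using KL by (auto simp: OK_def)
  let ?I = "Q \<inter> OK K"
  have nI: "K.nideal ?I"
  proof (unfold K.nideal_def, intro conjI ballI)
    note nQ = L.placesD(1)[OF Q]
    show "?I \<subseteq> OK K" by simp
    show "0 \<in> ?I" using L.nidealD(2)[OF nQ] K.R_0 by simp
    show "x + y \<in> ?I" if "x \<in> ?I" "y \<in> ?I" for x y
      using that L.nidealD(3)[OF nQ, of x y] K.R_add[of x y] by simp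
    show "a * x \<in> ?I" if "a \<in> OK K" "x \<in> ?I" for a x
      using that L.nidealD(4)[OF nQ subsetD[OF OKL that(1)], of x] K.R_mult[of a x] by simp
  qed
  have one: "1 \<notin> ?I" using L.placesD(4)[OF Q] by blast
  have pr: "a \<in> ?I \<or> b \<in> ?I" if "a \<in> OK K" "b \<in> OK K" "a * b \<in> ?I" for a b
    using L.placesD(5)[OF Q, of a b] that OKL by blast
  have "P \<subseteq> ?I" using K.gam_mem_iff[OF P nI pr one] g K.hgam(2)[OF P] by blast
  have "?I \<noteq> {0}"
  proof
    assume "?I = {0}"
    then have "K.gam P = 0" using g K.hgam(2)[OF P] by blast
    then show False using K.hgam(3)[OF P] by simp
  qed
  then have "?I \<in> places K" by (rule K.placesI[OF nI _ one pr])
  with \<open>P \<subseteq> ?I\<close> show ?thesis using K.place_maximal[OF P] by blast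
qed

text \<open>Expand \<Phi> at \<open>gam P\<close> by the places of \<open>L\<close>: only those
  above \<open>P\<close> occur, and the relative orders turn \<open>e_P\<close> into
  \<open>e_Q\<close>. Pairs outside \<open>JJ\<close> get the default value 0.\<close>

lemma consistent_coeff_of:
  assumes \<Phi>: "\<Phi> \<in> Sdual"
  shows "consistent (\<lambda>(K, P). if (K, P) \<in> JJ then nfield.coeff_of K \<Phi> P else 0)"
  unfolding consistent_def
proof (intro allI impI, elim conjE)
  fix K L P assume K: "number_field K" and L: "number_field L" and KL: "K \<subseteq> L" and P: "P \<in> places K"
  interpret K: nfield K using K by unfold_locales
  interpret L: nfield L using L by unfold_locales
  have OKL: "OK K \<subseteq> OK L" using KL by (auto simp: OK_def)
  define S where "S = {Q \<in> places L. Q \<inter> OK K = P}"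
  have gL: "K.gam P \<in> OK L" "K.gam P \<noteq> 0" using K.hgam[OF P] OKL by auto
  have "S \<subseteq> {Q \<in> places L. K.gam P \<in> Q}" using K.gam_mem[OF P] by (auto simp: S_def)
  then have S: "finite S" "S \<subseteq> places L"
    using L.finite_places_containing[OF gL] finite_subset by (auto simp: S_def)
  have SQ: "Q \<in> S" if "Q \<in> places L" "ordv L Q (K.gam P) \<noteq> 0" for Q
  proof -
    have "K.gam P \<in> Q" using L.vOK_pos_iff[OF that(1) gL] L.ordv_R[OF that(1) gL] that(2) by simp
    then show ?thesis using gam_mem_imp_below[OF K L KL P that(1)] that(1) by (simp add: S_def)
  qed
  \<comment> \<open>The comparison of orders applied to the rational prime \<open>p\<close>, whose
    orders at \<open>P\<close> and \<open>Q\<close> are the ramification indices.\<close>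
  have e: "of_nat (ram_index L Q) = rat_of_nat (ram_index K P) * of_int (ordv L Q (K.gam P)) / of_nat (K.hh P)"
    if Q: "Q \<in> S" for Q
  proof -
    let ?p = "prime_below P"
    have QL: "Q \<in> places L" "Q \<inter> OK K = P" using Q by (auto simp: S_def)
    have pQ: "prime_below Q = ?p"
      using K.prime_below[OF P] QL by (intro L.prime_below_eq[OF QL(1)]) auto
    have p0: "of_nat ?p \<in> K" "of_nat ?p \<noteq> (0::complex)"
      using K.prime_below_gt_1[OF P] K.R_of_nat K.R_K by auto
    have "ordv L Q (of_nat ?p) * int (K.hh P) = ordv K P (of_nat ?p) * ordv L Q (K.gam P)"
      by (rule place_below_decomposition[OF K L KL P QL p0])
    moreover have "ordv L Q (of_nat ?p) = int (ram_index L Q)"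
      unfolding ram_index_def pQ by (rule L.ordv_R[OF QL(1) L.R_of_nat p0(2)])
    moreover have "ordv K P (of_nat ?p) = int (ram_index K P)"
      unfolding ram_index_def by (rule K.ordv_R[OF P K.R_of_nat p0(2)])
    ultimately have "int (ram_index L Q) * int (K.hh P) = int (ram_index K P) * ordv L Q (K.gam P)" by simp
    then have "rat_of_int (int (ram_index L Q) * int (K.hh P)) = rat_of_int (int (ram_index K P) * ordv L Q (K.gam P))"
      by simp
    then show ?thesis using K.hgam(1)[OF P] by (simp add: field_simps)
  qed
  have "\<Phi> (K.gam P) = (\<Sum>Q\<in>S. of_int (ordv L Q (K.gam P)) * \<Phi> (L.gam Q) / of_nat (L.hh Q))"
    by (rule L.Sdual_decomposition[OF \<Phi> _ gL(2) S SQ]) (use gL L.R_K in auto)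
  then have "K.coeff_of \<Phi> P = (\<Sum>Q\<in>S. - (of_nat (ram_index K P) / of_nat (K.hh P)
      * (of_int (ordv L Q (K.gam P)) * \<Phi> (L.gam Q) / of_nat (L.hh Q))))"
    unfolding K.coeff_of_def sum_negf sum_distrib_left[symmetric] by simp
  also have "\<dots> = (\<Sum>Q\<in>S. L.coeff_of \<Phi> Q)"
    by (rule sum.cong) (auto simp: L.coeff_of_def e)
  also have "\<dots> = (\<Sum>Q\<in>S. if (L, Q) \<in> JJ then L.coeff_of \<Phi> Q else 0)"
    using S(2) L by (intro sum.cong) (auto simp: JJ_def)
  finally show "(case (K, P) of (K, P) \<Rightarrow> if (K, P) \<in> JJ then nfield.coeff_of K \<Phi> P else 0) =
      (\<Sum>Q\<in>{Q \<in> places L. Q \<inter> OK K = P}. case (L, Q) of (K, P) \<Rightarrow> if (K, P) \<in> JJ then nfield.coeff_of K \<Phi> P else 0)"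
    using K P by (simp add: S_def JJ_def)
qed

text \<open>Replaces the quantification over \<open>c\<close> by a condition on \<Phi> alone, which
  survives sums, norms and changes of the field.\<close>

theorem Sdual_com_iff:
  "\<Phi> \<in> Sdual_com \<longleftrightarrow> \<Phi> \<in> Sdual \<and> (\<exists>\<PP>. finite \<PP> \<and> (\<forall>p a. prime p \<longrightarrow> p \<notin> \<PP> \<longrightarrow> pelem p a \<longrightarrow> \<Phi> a = 0))"
proof
  assume "\<Phi> \<in> Sdual_com"
  then obtain c \<PP> where \<Phi>: "\<Phi> \<in> Sdual" and c: "consistent c" "finite \<PP>" "supported_on c \<PP>"
    "\<And>\<alpha>. real_of_rat (\<Phi> \<alpha>) = Phi_c c \<alpha>" unfolding Sdual_com_def by blast
  have "\<Phi> a = 0" if p: "prime p" "p \<notin> \<PP>" and a: "pelem p a" for p a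
  proof -
    have au: "a \<in> Qbar_units" using a by (simp add: pelem_def Qbar_units_def alg_int_imp_Qbar)
    obtain K n x where K: "number_field K" and w: "in_SK_wit K a n x"
      and form: "\<forall>c S. finite S \<and> S \<subseteq> places K \<and> (\<forall>P\<in>places K. ordv K P x \<noteq> 0 \<longrightarrow> P \<in> S) \<longrightarrow>
      Phi_c c a = - (\<Sum>P\<in>S. real_of_rat (c (K, P)) * real_of_int (ordv K P x) / (real n * real (ram_index K P)))"
      using Phi_c_formula[OF au] by blast
    interpret nfield K using K by unfold_locales
    obtain u where n: "n \<ge> 1" and x: "x \<in> K" "x \<noteq> 0" and u: "u \<in> AUnits" "a ^ n = x * u"
      using w by (auto simp: in_SK_wit_def)
    note uu = AUnitsD[OF u(1)]
    obtain k where k: "alg_int a" "a \<noteq> 0" "alg_int (of_nat p ^ k / a)" using a by (auto simp: pelem_def)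
    \<comment> \<open>\<open>x\<close> is \<open>a^n\<close> up to a unit, so it divides the power
      of \<open>p\<close> with exponent \<open>k n\<close>.\<close>
    have "pelem p x"
      unfolding pelem_def
    proof (intro conjI exI[of _ "k * n"])
      have "x = a ^ n * inverse u" using u(2) uu(2) by simp
      then show "alg_int x" using k(1) uu(3) by (simp add: alg_int_mult alg_int_power)
      have "(of_nat p ^ k / a) ^ n * u = of_nat p ^ (k * n) / x"
        using u(2) uu(2) x by (simp add: power_divide power_mult)
      then show "alg_int (of_nat p ^ (k * n) / x)" using k(3) uu(1) by (metis alg_int_mult alg_int_power)
    qed (rule x(2))
    \<comment> \<open>Over a prime in the support, which differs from \<open>p\<close>, the order of
      \<open>x\<close> vanishes; over any other prime the coefficient does.\<close>
    have zero: "real_of_rat (c (K, P)) * real_of_int (ordv K P x) = 0" if P: "P \<in> places K" for P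
    proof (cases "prime_below P \<in> \<PP>")
      case True
      then have "prime_below P \<noteq> p" using p(2) by blast
      then show ?thesis using pelem_ordv[OF P p(1) _ \<open>pelem p x\<close> x(1)] by simp
    next
      case False
      then show ?thesis using c(3) P K unfolding supported_on_def JJ_def by auto
    qed
    have "Phi_c c a = - (\<Sum>P\<in>{P \<in> places K. ordv K P x \<noteq> 0}.
        real_of_rat (c (K, P)) * real_of_int (ordv K P x) / (real n * real (ram_index K P)))"
      by (rule form[rule_format]) (use finite_support[of x] x in auto)
    also have "(\<Sum>P\<in>{P \<in> places K. ordv K P x \<noteq> 0}.
        real_of_rat (c (K, P)) * real_of_int (ordv K P x) / (real n * real (ram_index K P))) = 0"
      by (intro sum.neutral ballI) (use zero in auto)
    finally show ?thesis using c(4)[of a] by simp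
  qed
  then show "\<Phi> \<in> Sdual \<and> (\<exists>\<PP>. finite \<PP> \<and> (\<forall>p a. prime p \<longrightarrow> p \<notin> \<PP> \<longrightarrow> pelem p a \<longrightarrow> \<Phi> a = 0))"
    using \<Phi> c(2) by blast
next
  assume "\<Phi> \<in> Sdual \<and> (\<exists>\<PP>. finite \<PP> \<and> (\<forall>p a. prime p \<longrightarrow> p \<notin> \<PP> \<longrightarrow> pelem p a \<longrightarrow> \<Phi> a = 0))"
  then obtain \<PP> where \<Phi>: "\<Phi> \<in> Sdual" and \<PP>: "finite \<PP>"
    and van: "\<And>p a. prime p \<Longrightarrow> p \<notin> \<PP> \<Longrightarrow> pelem p a \<Longrightarrow> \<Phi> a = 0" by blast
  define c where "c = (\<lambda>(K, P). if (K, P) \<in> JJ then nfield.coeff_of K \<Phi> P else 0)"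
  have "supported_on c \<PP>"
    unfolding supported_on_def
  proof (intro allI impI, elim conjE)
    fix K P assume KP: "(K, P) \<in> JJ" and nP: "prime_below P \<notin> \<PP>"
    then interpret nfield K by unfold_locales (simp add: JJ_def)
    have P: "P \<in> places K" using KP by (simp add: JJ_def)
    have "\<Phi> (gam P) = 0" by (rule van[OF prime_below(1)[OF P] nP pelem_gam[OF P]])
    then show "c (K, P) = 0" by (simp add: c_def coeff_of_def)
  qed
  moreover have "real_of_rat (\<Phi> \<alpha>) = Phi_c c \<alpha>" for \<alpha>
  proof (cases "\<alpha> \<in> Qbar_units")
    case False
    then show ?thesis by (simp add: Phi_c_def SdualD(3)[OF \<Phi>])
  next
    case True
    obtain K n x where K: "number_field K" and w: "in_SK_wit K \<alpha> n x"
      and form: "\<forall>c S. finite S \<and> S \<subseteq> places K \<and> (\<forall>P\<in>places K. ordv K P x \<noteq> 0 \<longrightarrow> P \<in> S) \<longrightarrow>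
      Phi_c c \<alpha> = - (\<Sum>P\<in>S. real_of_rat (c (K, P)) * real_of_int (ordv K P x) / (real n * real (ram_index K P)))"
      using Phi_c_formula[OF True] by blast
    interpret nfield K using K by unfold_locales
    obtain u where n: "n \<ge> 1" and x: "x \<in> K" "x \<noteq> 0" and u: "u \<in> AUnits" "\<alpha> ^ n = x * u"
      using w by (auto simp: in_SK_wit_def)
    define S where "S = {P \<in> places K. ordv K P x \<noteq> 0}"
    have S: "finite S" "S \<subseteq> places K" "\<And>P. P \<in> places K \<Longrightarrow> ordv K P x \<noteq> 0 \<Longrightarrow> P \<in> S"
      using finite_support[of x] x by (auto simp: S_def)
    have "Phi_c c \<alpha> = - (\<Sum>P\<in>S. real_of_rat (c (K, P)) * real_of_int (ordv K P x) / (real n * real (ram_index K P)))"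
      by (rule form[rule_format]) (use S in blast)
    also have "\<dots> = (\<Sum>P\<in>S. real_of_rat (of_int (ordv K P x) * \<Phi> (gam P) / of_nat (hh P)) / real n)"
      unfolding sum_negf[symmetric]
    proof (rule sum.cong)
      fix P assume "P \<in> S"
      then have P: "P \<in> places K" using S(2) by blast
      then have "c (K, P) = coeff_of \<Phi> P" using K by (simp add: c_def JJ_def)
      then show "- (real_of_rat (c (K, P)) * real_of_int (ordv K P x) / (real n * real (ram_index K P)))
        = real_of_rat (of_int (ordv K P x) * \<Phi> (gam P) / of_nat (hh P)) / real n"
        using ram_index_pos[OF P] by (simp add: coeff_of_def of_rat_minus of_rat_divide of_rat_mult)
    qed simp
    also have "\<dots> = real_of_rat (\<Sum>P\<in>S. of_int (ordv K P x) * \<Phi> (gam P) / of_nat (hh P)) / real n"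
      by (simp only: sum_divide_distrib of_rat_sum)
    also have "(\<Sum>P\<in>S. of_int (ordv K P x) * \<Phi> (gam P) / of_nat (hh P)) = \<Phi> x"
      by (rule Sdual_decomposition[OF \<Phi> x S, symmetric])
    also have "\<Phi> x = of_nat n * \<Phi> \<alpha>"
      using SdualD(1)[OF \<Phi> K_units[OF x] AUnitsD(4)[OF u(1)]] SdualD(2)[OF \<Phi> u(1)] u(2)
        Sdual_power[OF \<Phi> True, of n] by simp
    finally show ?thesis using n by (simp add: of_rat_mult)
  qed
  ultimately show "\<Phi> \<in> Sdual_com"
    unfolding Sdual_com_def using \<Phi> \<PP> consistent_coeff_of[OF \<Phi>, folded c_def] by blast
qed

section \<open>Functionals with finite Galois orbit\<close>

lemma (in nfield) GalOver_ib:
  assumes s: "\<sigma> \<in> GalQ" and fixed: "\<And>i. i < deg \<Longrightarrow> \<sigma> (ib i) = ib i"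
  shows "\<sigma> \<in> GalOver K"
proof -
  have "\<sigma> x = x" if x: "x \<in> K" for x
  proof -
    obtain q :: "nat \<Rightarrow> rat" where q: "x = (\<Sum>i<deg. of_rat (q i) * ib i)" by (rule ib_span[OF x])
    have "\<sigma> x = (\<Sum>i<deg. \<sigma> (of_rat (q i) * ib i))" unfolding q
      using s by (intro GalQ_sum) (auto simp: of_rat_Qbar ib_Qbar subfield_closed[OF subfield_Qbar])
    also have "\<dots> = x" unfolding q
      using s by (intro sum.cong) (auto simp: GalQ_D GalQ_Rats of_rat_Qbar ib_Qbar fixed)
    finally show ?thesis .
  qed
  then show ?thesis using s by (simp add: GalOver_def)
qed

lemma (in nfield) superfield_if_ib:
  assumes "Defs.subfield L" "ib ` {..<deg} \<subseteq> L"
  shows "K \<subseteq> L"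
proof
  fix x assume x: "x \<in> K"
  obtain q :: "nat \<Rightarrow> rat" where q: "x = (\<Sum>i<deg. of_rat (q i) * ib i)" by (rule ib_span[OF x])
  show "x \<in> L" unfolding q
    using assms subfield_Rats[OF assms(1)]
    by (intro subfield_sum[OF assms(1)] subfield_closed(4)[OF assms(1)]) auto
qed

lemma (in nfield) ib_image: "finite (ib ` {..<deg})" "ib ` {..<deg} \<subseteq> Qbar"
  using ib_Qbar by auto

lemma ex_common_number_field:
  assumes "number_field K" "number_field L"
  obtains M where "number_field M" "K \<subseteq> M" "L \<subseteq> M"
proof -
  interpret K: nfield K using assms by unfold_locales
  interpret L: nfield L using assms by unfold_locales
  obtain M where M: "number_field M" "K.ib ` {..<K.deg} \<union> L.ib ` {..<L.deg} \<subseteq> M"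
    using ex_number_field_superset[of "K.ib ` {..<K.deg} \<union> L.ib ` {..<L.deg}"] K.ib_image L.ib_image by auto
  note sf = number_field_subfield[OF M(1)]
  show thesis using that[OF M(1)] K.superfield_if_ib[OF sf] L.superfield_if_ib[OF sf] M(2) by blast
qed

lemma GalOver_antimono: "K \<subseteq> L \<Longrightarrow> GalOver L \<subseteq> GalOver K"
  by (auto simp: GalOver_def)

definition inv_over :: "complex set \<Rightarrow> (complex \<Rightarrow> rat) \<Rightarrow> bool" where
  "inv_over K \<Phi> \<longleftrightarrow> (\<forall>\<sigma>\<in>GalOver K. \<forall>x. \<Phi> (\<sigma> x) = \<Phi> x)"

lemma Stab_id: "id \<in> Stab \<Phi>" by (simp add: Stab_def GalQ_id)

text \<open>The stabilizer is closed, so a stabilizer of finite index is open: each coset missing the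
  identity is excluded by the value at one element.\<close>

theorem Sdual_fin_iff: "\<Phi> \<in> Sdual_fin \<longleftrightarrow> \<Phi> \<in> Sdual \<and> (\<exists>K. number_field K \<and> inv_over K \<Phi>)"
proof
  assume fin: "\<Phi> \<in> Sdual_fin"
  define \<C> where "\<C> = {(\<lambda>\<tau>. \<sigma> \<circ> \<tau>) ` Stab \<Phi> | \<sigma>. \<sigma> \<in> GalQ}"
  have C: "finite \<C>" and \<Phi>: "\<Phi> \<in> Sdual" using fin by (auto simp: Sdual_fin_def \<C>_def)
  have wit: "\<exists>\<alpha>\<in>Qbar. \<forall>\<tau>\<in>C. \<tau> \<alpha> \<noteq> \<alpha>" if Cc: "C \<in> \<C>" "id \<notin> C" for C
  proof -
    obtain \<sigma> where s: "\<sigma> \<in> GalQ" "C = (\<lambda>\<tau>. \<sigma> \<circ> \<tau>) ` Stab \<Phi>" using Cc(1) by (auto simp: \<C>_def)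
    obtain \<rho> where r: "\<rho> \<in> GalQ" "\<And>x. \<rho> (\<sigma> x) = x" "\<And>x. \<sigma> (\<rho> x) = x" using GalQ_inv[OF s(1)] by metis
    have "\<rho> \<notin> Stab \<Phi>"
    proof
      assume "\<rho> \<in> Stab \<Phi>"
      then have "\<sigma> \<circ> \<rho> \<in> C" using s(2) by blast
      moreover have "\<sigma> \<circ> \<rho> = id" using r(3) by auto
      ultimately show False using Cc(2) by simp
    qed
    \<comment> \<open>The inverse \<rho> of \<sigma> moves the value of \<Phi> at \<alpha>. An
      element \<sigma> \<pi> of the coset fixing \<alpha> would have \<pi> agree with \<rho> there,
      although \<pi> preserves \<Phi>.\<close>
    then obtain \<alpha> where a: "\<Phi> (\<rho> \<alpha>) \<noteq> \<Phi> \<alpha>" using r(1) by (auto simp: Stab_def fun_eq_iff)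
    have no: "\<tau> \<alpha> \<noteq> \<alpha>" if t: "\<tau> \<in> C" for \<tau>
    proof
      assume fx: "\<tau> \<alpha> = \<alpha>"
      obtain \<pi> where p: "\<pi> \<in> Stab \<Phi>" "\<tau> = \<sigma> \<circ> \<pi>" using t s(2) by blast
      have "\<pi> \<alpha> = \<rho> \<alpha>" using fx p(2) r(2)[of "\<pi> \<alpha>"] by simp
      moreover have "\<Phi> (\<pi> \<alpha>) = \<Phi> \<alpha>" using p(1) by (auto simp: Stab_def fun_eq_iff)
      ultimately show False using a by simp
    qed
    have "\<alpha> \<in> Qbar"
    proof (rule ccontr)
      assume "\<alpha> \<notin> Qbar"
      then have "\<rho> \<alpha> = \<alpha>" using GalQ_D(4)[OF r(1)] by blast
      then show False using a by simp
    qed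
    then show ?thesis using no by blast
  qed
  have "\<forall>C. \<exists>\<alpha>. C \<in> \<C> \<and> id \<notin> C \<longrightarrow> \<alpha> \<in> Qbar \<and> (\<forall>\<tau>\<in>C. \<tau> \<alpha> \<noteq> \<alpha>)" using wit by blast
  then obtain w where w: "\<And>C. C \<in> \<C> \<Longrightarrow> id \<notin> C \<Longrightarrow> w C \<in> Qbar \<and> (\<forall>\<tau>\<in>C. \<tau> (w C) \<noteq> w C)" by metis
  have "finite (w ` {C \<in> \<C>. id \<notin> C})" using C by simp
  then obtain K where K: "number_field K" "w ` {C \<in> \<C>. id \<notin> C} \<subseteq> K"
    using ex_number_field_superset[of "w ` {C \<in> \<C>. id \<notin> C}"] w by auto
  have "inv_over K \<Phi>"
    unfolding inv_over_def
  proof (intro ballI allI)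
    fix \<sigma> x assume s: "\<sigma> \<in> GalOver K"
    define C where "C = (\<lambda>\<tau>. \<sigma> \<circ> \<tau>) ` Stab \<Phi>"
    have "C \<in> \<C>" using GalOver_GalQ[OF s] by (auto simp: C_def \<C>_def)
    moreover have "\<sigma> \<in> C" unfolding C_def using Stab_id by (intro image_eqI[of _ _ id]) auto
    ultimately have "id \<in> C" using w[of C] K(2) s by (force simp: GalOver_def)
    then obtain \<rho> where r: "\<rho> \<in> Stab \<Phi>" "\<sigma> \<circ> \<rho> = id" by (auto simp: C_def)
    have "\<sigma> (\<rho> (\<sigma> x)) = \<sigma> x" using r(2) by (simp add: fun_eq_iff)
    then have "\<rho> (\<sigma> x) = x" by (rule GalQ_inj[OF GalOver_GalQ[OF s]])
    moreover have "\<Phi> (\<rho> (\<sigma> x)) = \<Phi> (\<sigma> x)" using r(1) by (auto simp: Stab_def fun_eq_iff)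
    ultimately show "\<Phi> (\<sigma> x) = \<Phi> x" by simp
  qed
  then show "\<Phi> \<in> Sdual \<and> (\<exists>K. number_field K \<and> inv_over K \<Phi>)" using \<Phi> K(1) by blast
next
  assume "\<Phi> \<in> Sdual \<and> (\<exists>K. number_field K \<and> inv_over K \<Phi>)"
  then obtain K where \<Phi>: "\<Phi> \<in> Sdual" and K: "number_field K" and inv: "inv_over K \<Phi>" by blast
  interpret nfield K using K by unfold_locales
  \<comment> \<open>\<open>r\<close> records the restriction of an automorphism to \<open>K\<close>
    through the images of a basis. Finitely many restrictions occur, and each determines the coset
    of the stabilizer.\<close>
  define r where "r \<sigma> = restrict (\<lambda>i. \<sigma> (ib i)) {..<deg}" for \<sigma> :: "complex \<Rightarrow> complex"
  define cs where "cs \<sigma> = (\<lambda>\<tau>. \<sigma> \<circ> \<tau>) ` Stab \<Phi>" for \<sigma> :: "complex \<Rightarrow> complex"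
  have "r ` GalQ \<subseteq> (\<Pi>\<^sub>E i\<in>{..<deg}. conj_orb \<rat> (ib i))"
    by (auto simp: r_def conj_orb_def GalOver_Rats PiE_def Pi_def extensional_def)
  moreover have "finite (\<Pi>\<^sub>E i\<in>{..<deg}. conj_orb \<rat> (ib i))"
    using finite_conj_orb ib_Qbar by (intro finite_PiE) auto
  ultimately have fin: "finite (r ` GalQ)" by (rule finite_subset)
  have sub: "cs \<sigma>' \<subseteq> cs \<sigma>" if s: "\<sigma> \<in> GalQ" "\<sigma>' \<in> GalQ" and eq: "r \<sigma> = r \<sigma>'" for \<sigma> \<sigma>'
  proof -
    obtain \<rho> where \<rho>: "\<rho> \<in> GalQ" "\<And>x. \<rho> (\<sigma> x) = x" "\<And>x. \<sigma> (\<rho> x) = x" using GalQ_inv[OF s(1)] by metis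
    have t: "\<rho> \<circ> \<sigma>' \<in> GalOver K"
    proof (rule GalOver_ib)
      show "\<rho> \<circ> \<sigma>' \<in> GalQ" using GalQ_comp \<rho>(1) s(2) by blast
      fix i assume "i < deg"
      then have "\<sigma> (ib i) = \<sigma>' (ib i)" using fun_cong[OF eq, of i] by (simp add: r_def)
      then show "(\<rho> \<circ> \<sigma>') (ib i) = ib i" using \<rho>(2)[of "ib i"] by simp
    qed
    show ?thesis
    proof
      fix \<pi> assume "\<pi> \<in> cs \<sigma>'"
      then obtain \<tau> where \<tau>: "\<tau> \<in> Stab \<Phi>" "\<pi> = \<sigma>' \<circ> \<tau>" unfolding cs_def by blast
      have "(\<rho> \<circ> \<sigma>') \<circ> \<tau> \<in> Stab \<Phi>"
        using GalQ_comp[OF GalOver_GalQ[OF t], of \<tau>] \<tau>(1) inv t by (auto simp: Stab_def inv_over_def fun_eq_iff)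
      moreover have "\<pi> = \<sigma> \<circ> ((\<rho> \<circ> \<sigma>') \<circ> \<tau>)" using \<tau>(2) \<rho>(3) by (auto simp: fun_eq_iff)
      ultimately show "\<pi> \<in> cs \<sigma>" unfolding cs_def by blast
    qed
  qed
  have "cs ` GalQ \<subseteq> (\<lambda>v. cs (inv_into GalQ r v)) ` (r ` GalQ)"
  proof
    fix C assume "C \<in> cs ` GalQ"
    then obtain \<sigma> where s: "\<sigma> \<in> GalQ" "C = cs \<sigma>" by blast
    let ?s = "inv_into GalQ r (r \<sigma>)"
    have "?s \<in> GalQ" using s(1) by (intro inv_into_into) blast
    moreover have "r ?s = r \<sigma>" using s(1) f_inv_into_f[of "r \<sigma>" r GalQ] by simp
    ultimately have "cs ?s = cs \<sigma>" using sub[of ?s \<sigma>] sub[of \<sigma> ?s] s(1) by auto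
    then show "C \<in> (\<lambda>v. cs (inv_into GalQ r v)) ` (r ` GalQ)" using s by blast
  qed
  then have "finite (cs ` GalQ)" using fin by (meson finite_imageI finite_subset)
  moreover have "cs ` GalQ = {(\<lambda>\<tau>. \<sigma> \<circ> \<tau>) ` Stab \<Phi> | \<sigma>. \<sigma> \<in> GalQ}" by (auto simp: cs_def)
  ultimately show "\<Phi> \<in> Sdual_fin" unfolding Sdual_fin_def using \<Phi> by simp
qed

definition vanishes_off :: "nat set \<Rightarrow> (complex \<Rightarrow> rat) \<Rightarrow> bool" where
  "vanishes_off \<PP> \<Phi> \<longleftrightarrow> (\<forall>p a. prime p \<longrightarrow> p \<notin> \<PP> \<longrightarrow> pelem p a \<longrightarrow> \<Phi> a = 0)"

lemma Cstar_iff: "\<Phi> \<in> Cstar \<longleftrightarrow> \<Phi> \<in> Sdual \<and> (\<exists>K. number_field K \<and> inv_over K \<Phi>)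
    \<and> (\<exists>\<PP>. finite \<PP> \<and> vanishes_off \<PP> \<Phi>)"
  unfolding Cstar_def Int_iff Sdual_fin_iff Sdual_com_iff vanishes_off_def by blast

section \<open>The subspace property\<close>

lemma Cstar_zero: "(\<lambda>_. 0) \<in> Cstar"
  unfolding Cstar_iff
  using number_field_Rats by (auto simp: Sdual_def inv_over_def vanishes_off_def)

lemma Cstar_add:
  assumes "\<Phi> \<in> Cstar" "\<Psi> \<in> Cstar"
  shows "(\<lambda>z. \<Phi> z + \<Psi> z) \<in> Cstar"
proof -
  obtain K \<PP> where \<Phi>: "\<Phi> \<in> Sdual" "number_field K" "inv_over K \<Phi>" "finite \<PP>" "vanishes_off \<PP> \<Phi>"
    using assms(1) unfolding Cstar_iff by blast
  obtain L \<QQ> where \<Psi>: "\<Psi> \<in> Sdual" "number_field L" "inv_over L \<Psi>" "finite \<QQ>" "vanishes_off \<QQ> \<Psi>"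
    using assms(2) unfolding Cstar_iff by blast
  obtain M where M: "number_field M" "K \<subseteq> M" "L \<subseteq> M" using ex_common_number_field \<Phi>(2) \<Psi>(2) by blast
  have "(\<lambda>z. \<Phi> z + \<Psi> z) \<in> Sdual" using \<Phi>(1) \<Psi>(1) by (simp add: Sdual_def)
  moreover have "inv_over M (\<lambda>z. \<Phi> z + \<Psi> z)"
    using \<Phi>(3) \<Psi>(3) GalOver_antimono[OF M(2)] GalOver_antimono[OF M(3)] by (simp add: inv_over_def subset_eq)
  moreover have "finite (\<PP> \<union> \<QQ>)" "vanishes_off (\<PP> \<union> \<QQ>) (\<lambda>z. \<Phi> z + \<Psi> z)"
    using \<Phi> \<Psi> by (auto simp: vanishes_off_def)
  ultimately show ?thesis unfolding Cstar_iff using M(1) by blast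
qed

lemma Cstar_scale:
  assumes "\<Phi> \<in> Cstar"
  shows "(\<lambda>z. r * \<Phi> z) \<in> Cstar"
proof -
  obtain K \<PP> where \<Phi>: "\<Phi> \<in> Sdual" "number_field K" "inv_over K \<Phi>" "finite \<PP>" "vanishes_off \<PP> \<Phi>"
    using assms(1) unfolding Cstar_iff by blast
  have "(\<lambda>z. r * \<Phi> z) \<in> Sdual" using \<Phi>(1) by (simp add: Sdual_def distrib_left)
  moreover have "inv_over K (\<lambda>z. r * \<Phi> z)" "vanishes_off \<PP> (\<lambda>z. r * \<Phi> z)"
    using \<Phi> by (simp_all add: inv_over_def vanishes_off_def)
  ultimately show ?thesis unfolding Cstar_iff using \<Phi>(2,4) by blast
qed

section \<open>Continuity\<close>

lemma inv_over_relnorm: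
  assumes "\<Phi> \<in> Sdual" "inv_over K \<Phi>" "a \<in> Qbar_units"
  shows "\<Phi> (relnorm K a) = of_nat (card (conj_orb K a)) * \<Phi> a"
  by (rule additive_relnorm) (use assms SdualD(1)[OF assms(1)] in \<open>auto simp: inv_over_def\<close>)

lemma lnorm_relnorm:
  assumes "a \<in> Qbar_units"
  shows "lnorm (relnorm K a) = of_nat (card (conj_orb K a)) * lnorm a"
  by (rule additive_relnorm) (use assms lnorm_mult lnorm_GalQ GalOver_GalQ in auto)

lemma (in nfield) vanishes_off_gam:
  assumes "vanishes_off \<PP> \<Phi>" "P \<in> places K" "prime_below P \<notin> \<PP>"
  shows "\<Phi> (gam P) = 0"
  using assms prime_below(1) pelem_gam unfolding vanishes_off_def by blast

text \<open>On integers of \<open>K\<close>, \<Phi> and \<open>lnorm\<close> expand over the same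
  places with the same nonnegative orders, so it is enough to compare them on generators, where
  \<Phi> is nonzero only finitely often. Norms to \<open>K\<close> carry the bound to all algebraic
  integers.\<close>

lemma Cstar_bound_alg_int:
  assumes "\<Phi> \<in> Cstar"
  obtains C :: real where "C \<ge> 0" "\<And>a. alg_int a \<Longrightarrow> a \<noteq> 0 \<Longrightarrow> \<bar>real_of_rat (\<Phi> a)\<bar> \<le> C * lnorm a"
proof -
  obtain K \<PP> where \<Phi>: "\<Phi> \<in> Sdual" "number_field K" "inv_over K \<Phi>" "finite \<PP>" "vanishes_off \<PP> \<Phi>"
    using assms unfolding Cstar_iff by blast
  interpret nfield K using \<Phi>(2) by unfold_locales
  define T where "T = {P \<in> places K. prime_below P \<in> \<PP>}"
  have finT: "finite T" unfolding T_def by (rule finite_places_over[OF \<Phi>(4)])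
  define C where "C = (\<Sum>P\<in>T. \<bar>real_of_rat (\<Phi> (gam P))\<bar> / lnorm (gam P))"
  have pos: "lnorm (gam P) > 0" if "P \<in> T" for P using lnorm_gam_pos that by (simp add: T_def)
  have C0: "C \<ge> 0" unfolding C_def using pos by (intro sum_nonneg divide_nonneg_nonneg) (auto simp: less_imp_le)
  have gb: "\<bar>real_of_rat (\<Phi> (gam P))\<bar> \<le> C * lnorm (gam P)" if P: "P \<in> places K" for P
  proof (cases "P \<in> T")
    case True
    have "\<bar>real_of_rat (\<Phi> (gam P))\<bar> / lnorm (gam P) \<le> C"
      unfolding C_def using pos
      by (intro member_le_sum[OF True _ finT] divide_nonneg_nonneg) (auto simp: less_imp_le)
    then show ?thesis using pos[OF True] by (simp add: divide_le_eq)
  next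
    case False
    then have "\<Phi> (gam P) = 0" using vanishes_off_gam[OF \<Phi>(5) P] P by (simp add: T_def)
    then show ?thesis using C0 lnorm_gam_pos[OF P] by simp
  qed
  have bR: "\<bar>real_of_rat (\<Phi> b)\<bar> \<le> C * lnorm b" if b: "b \<in> R" "b \<noteq> 0" for b
  proof -
    define S where "S = {P \<in> places K. ordv K P b \<noteq> 0}"
    have bK: "b \<in> K - {0}" using b R_K by simp
    have S: "finite S" "S \<subseteq> places K" "\<And>P. P \<in> places K \<Longrightarrow> ordv K P b \<noteq> 0 \<Longrightarrow> P \<in> S"
      using finite_support[OF bK] by (auto simp: S_def)
    have e1: "\<Phi> b = (\<Sum>P\<in>S. of_int (ordv K P b) * \<Phi> (gam P) / of_nat (hh P))"
      by (rule Sdual_decomposition[OF \<Phi>(1) _ b(2) S]) (use bK in auto)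
    \<comment> \<open>\<open>lnorm\<close> is additive and trivial on units as well, so the
      expansion in generators applies to it too.\<close>
    have e2: "lnorm b = (\<Sum>P\<in>S. of_int (ordv K P b) * lnorm (gam P) / of_nat (hh P))"
      by (rule place_decomposition[OF _ _ bK S]) (use lnorm_mult K_units lnorm_unit in auto)
    have "real_of_rat (\<Phi> b) = (\<Sum>P\<in>S. real_of_int (ordv K P b) * real_of_rat (\<Phi> (gam P)) / real (hh P))"
      unfolding e1 by (simp add: of_rat_sum of_rat_divide of_rat_mult)
    then have "\<bar>real_of_rat (\<Phi> b)\<bar> \<le> (\<Sum>P\<in>S. \<bar>real_of_int (ordv K P b) * real_of_rat (\<Phi> (gam P)) / real (hh P)\<bar>)"
      by (metis sum_abs)
    also have "\<dots> \<le> (\<Sum>P\<in>S. C * (real_of_int (ordv K P b) * lnorm (gam P) / real (hh P)))"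
    proof (rule sum_mono)
      fix P assume "P \<in> S"
      then have P: "P \<in> places K" using S(2) by blast
      have o: "real_of_int (ordv K P b) \<ge> 0" using ordv_R[OF P b] by simp
      have "real_of_int (ordv K P b) / real (hh P) * \<bar>real_of_rat (\<Phi> (gam P))\<bar>
          \<le> real_of_int (ordv K P b) / real (hh P) * (C * lnorm (gam P))"
        using o by (intro mult_left_mono gb[OF P]) simp
      then show "\<bar>real_of_int (ordv K P b) * real_of_rat (\<Phi> (gam P)) / real (hh P)\<bar>
          \<le> C * (real_of_int (ordv K P b) * lnorm (gam P) / real (hh P))"
        using o by (simp add: abs_mult mult_ac del: abs_of_rat)
    qed
    also have "\<dots> = C * lnorm b" unfolding e2 by (simp add: sum_distrib_left)
    finally show ?thesis .
  qed
  have "\<bar>real_of_rat (\<Phi> a)\<bar> \<le> C * lnorm a" if a: "alg_int a" "a \<noteq> 0" for a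
  proof -
    have au: "a \<in> Qbar_units" "a \<in> Qbar" using a alg_int_imp_Qbar by (auto simp: Qbar_units_def)
    let ?d = "card (conj_orb K a)"
    have d: "real ?d > 0" using card_conj_orb_pos[OF au(2), of K] by simp
    have "relnorm K a \<in> R"
      using alg_int_relnorm[OF a(1)] relnorm_mem[OF sf KQ au(2)] by (simp add: R_iff)
    then have "\<bar>real_of_rat (\<Phi> (relnorm K a))\<bar> \<le> C * lnorm (relnorm K a)"
      by (rule bR) (rule relnorm_nonzero[OF au(2) a(2)])
    then have "real ?d * \<bar>real_of_rat (\<Phi> a)\<bar> \<le> real ?d * (C * lnorm a)"
      unfolding inv_over_relnorm[OF \<Phi>(1,3) au(1)] lnorm_relnorm[OF au(1)]
      by (simp add: of_rat_mult abs_mult mult_ac del: abs_of_rat)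
    then show ?thesis using d by simp
  qed
  then show thesis using that C0 by blast
qed

text \<open>Here \<open>K\<close> is the field chosen inside \<open>normS\<close>, unrelated to the
  field fixing \<Phi>. The bound by \<open>lnorm\<close> holds for all algebraic integers, in
  particular for the generators \<open>gam P\<close> of this field.\<close>

lemma Cstar_bound_normS:
  assumes \<Phi>: "\<Phi> \<in> Sdual" and C: "C \<ge> 0" "\<And>a. alg_int a \<Longrightarrow> a \<noteq> 0 \<Longrightarrow> \<bar>real_of_rat (\<Phi> a)\<bar> \<le> C * lnorm a"
    and g: "\<gamma> \<in> Qbar_units"
  shows "\<bar>real_of_rat (\<Phi> \<gamma>)\<bar> \<le> C * normS \<gamma>"
proof -
  define K where "K = (SOME K. number_field K \<and> \<gamma> \<in> K)"
  have "\<exists>K. number_field K \<and> \<gamma> \<in> K"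
    using ex_number_field_superset[of "{\<gamma>}"] g by (auto simp: Qbar_units_def)
  then have "number_field K \<and> \<gamma> \<in> K" unfolding K_def by (rule someI_ex)
  then have K: "number_field K" and gK: "\<gamma> \<in> K" by auto
  interpret nfield K using K by unfold_locales
  have g0: "\<gamma> \<noteq> 0" using g by (simp add: Qbar_units_def)
  define S where "S = {P \<in> places K. ordv K P \<gamma> \<noteq> 0}"
  have S: "finite S" "S \<subseteq> places K" "\<And>P. P \<in> places K \<Longrightarrow> ordv K P \<gamma> \<noteq> 0 \<Longrightarrow> P \<in> S"
    using finite_support[of \<gamma>] gK g0 by (auto simp: S_def)
  have "{P \<in> places K. ln (vabs K P \<gamma>) \<noteq> 0} = S"
    using ln_vabs_nonzero ln_vabs by (auto simp: S_def)
  then have nS: "normS \<gamma> = (\<Sum>P\<in>S. \<bar>ln (vabs K P \<gamma>)\<bar>)"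
    unfolding normS_def K_def[symmetric] Let_def by simp
  have "real_of_rat (\<Phi> \<gamma>) = real_of_rat (\<Sum>P\<in>S. of_int (ordv K P \<gamma>) * \<Phi> (gam P) / of_nat (hh P))"
    by (subst Sdual_decomposition[OF \<Phi> gK g0 S]) auto
  also have "\<dots> = (\<Sum>P\<in>S. real_of_int (ordv K P \<gamma>) * real_of_rat (\<Phi> (gam P)) / real (hh P))"
    by (simp add: of_rat_sum of_rat_divide of_rat_mult)
  finally have "\<bar>real_of_rat (\<Phi> \<gamma>)\<bar> \<le> (\<Sum>P\<in>S. \<bar>real_of_int (ordv K P \<gamma>) * real_of_rat (\<Phi> (gam P)) / real (hh P)\<bar>)"
    by (metis sum_abs)
  also have "\<dots> \<le> (\<Sum>P\<in>S. C * \<bar>ln (vabs K P \<gamma>)\<bar>)"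
  proof (rule sum_mono)
    fix P assume "P \<in> S"
    then have P: "P \<in> places K" using S(2) by blast
    have "\<bar>real_of_int (ordv K P \<gamma>) * real_of_rat (\<Phi> (gam P)) / real (hh P)\<bar>
        = \<bar>real_of_int (ordv K P \<gamma>)\<bar> / real (hh P) * \<bar>real_of_rat (\<Phi> (gam P))\<bar>"
      by (simp add: abs_mult del: abs_of_rat)
    also have "\<dots> \<le> \<bar>real_of_int (ordv K P \<gamma>)\<bar> / real (hh P) * (C * lnorm (gam P))"
      using hgam(2,3)[OF P] by (intro mult_left_mono C(2)) (auto simp: R_iff)
    also have "\<dots> = C * (\<bar>real_of_int (ordv K P \<gamma>)\<bar> * lnorm (gam P) / real (hh P))" by simp
    also have "\<dots> \<le> C * \<bar>ln (vabs K P \<gamma>)\<bar>" by (intro mult_left_mono lnorm_gam_le_vabs[OF P] C(1))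
    finally show "\<bar>real_of_int (ordv K P \<gamma>) * real_of_rat (\<Phi> (gam P)) / real (hh P)\<bar> \<le> C * \<bar>ln (vabs K P \<gamma>)\<bar>" .
  qed
  also have "\<dots> = C * normS \<gamma>" by (simp add: nS sum_distrib_left)
  finally show ?thesis .
qed

lemma Cstar_subset_Sprime: "Cstar \<subseteq> Sprime"
proof
  fix \<Phi> assume c: "\<Phi> \<in> Cstar"
  then have \<Phi>: "\<Phi> \<in> Sdual" by (simp add: Cstar_iff)
  obtain C :: real where C: "C \<ge> 0" "\<And>a. alg_int a \<Longrightarrow> a \<noteq> 0 \<Longrightarrow> \<bar>real_of_rat (\<Phi> a)\<bar> \<le> C * lnorm a"
    using Cstar_bound_alg_int[OF c] by blast
  show "\<Phi> \<in> Sprime"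
    unfolding Sprime_def
  proof (intro CollectI conjI \<Phi> ballI allI impI)
    fix \<alpha> and \<epsilon> :: real assume \<alpha>: "\<alpha> \<in> Qbar_units" and e: "0 < \<epsilon>"
    show "\<exists>\<delta>>0. \<forall>\<beta>\<in>Qbar_units. normS (\<beta> / \<alpha>) < \<delta> \<longrightarrow> \<bar>real_of_rat (\<Phi> \<beta>) - real_of_rat (\<Phi> \<alpha>)\<bar> < \<epsilon>"
    \<comment> \<open>The denominator is \<open>C + 1\<close> because \<open>C\<close> may be
      0.\<close>
    proof (intro exI[of _ "\<epsilon> / (C + 1)"] conjI ballI impI)
      show "0 < \<epsilon> / (C + 1)" using e C(1) by simp
      fix \<beta> assume \<beta>: "\<beta> \<in> Qbar_units" and small: "normS (\<beta> / \<alpha>) < \<epsilon> / (C + 1)"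
      have q: "\<beta> / \<alpha> \<in> Qbar_units" using Qbar_units_closed \<alpha> \<beta> by blast
      have "\<beta> = (\<beta> / \<alpha>) * \<alpha>" using \<alpha> by (simp add: Qbar_units_def)
      then have "\<Phi> \<beta> = \<Phi> (\<beta> / \<alpha>) + \<Phi> \<alpha>" using SdualD(1)[OF \<Phi> q \<alpha>] by metis
      then have "\<bar>real_of_rat (\<Phi> \<beta>) - real_of_rat (\<Phi> \<alpha>)\<bar> = \<bar>real_of_rat (\<Phi> (\<beta> / \<alpha>))\<bar>"
        by (simp add: of_rat_add del: abs_of_rat)
      also have "\<dots> \<le> C * normS (\<beta> / \<alpha>)" by (rule Cstar_bound_normS[OF \<Phi> C q])
      also have "\<dots> \<le> C * (\<epsilon> / (C + 1))" using small C(1) by (intro mult_left_mono) auto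
      also have "\<dots> < \<epsilon>" using e C(1) by (simp add: field_simps)
      finally show "\<bar>real_of_rat (\<Phi> \<beta>) - real_of_rat (\<Phi> \<alpha>)\<bar> < \<epsilon>" .
    qed
  qed
qed

section \<open>Countability\<close>

lemma countable_Qbar: "countable Qbar"
proof -
  have "Qbar \<subseteq> (\<Union>l::int list. {x. Poly l \<noteq> 0 \<and> poly (map_poly of_int (Poly l)) x = 0})"
  proof
    fix x assume "x \<in> Qbar"
    then obtain p :: "int poly" where "p \<noteq> 0" "poly (map_poly of_int p) x = 0"
      using algebraicE' unfolding Qbar_def by blast
    then show "x \<in> (\<Union>l::int list. {x. Poly l \<noteq> 0 \<and> poly (map_poly of_int (Poly l)) x = 0})"
      by (intro UN_I[of "coeffs p"]) auto
  qed
  moreover have "countable (\<Union>l::int list. {x::complex. Poly l \<noteq> 0 \<and> poly (map_poly of_int (Poly l)) x = 0})"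
  proof (rule countable_UN)
    fix l :: "int list"
    have "finite {x::complex. Poly l \<noteq> 0 \<and> poly (map_poly of_int (Poly l)) x = 0}"
      by (cases "Poly l = 0") (auto intro!: poly_roots_finite)
    then show "countable {x::complex. Poly l \<noteq> 0 \<and> poly (map_poly of_int (Poly l)) x = 0}"
      by (rule countable_finite)
  qed simp
  ultimately show ?thesis by (rule countable_subset)
qed

lemma countable_fixed_field_support:
  assumes K: "number_field K" and \<PP>: "finite \<PP>"
  shows "countable {\<Phi> \<in> Sdual. inv_over K \<Phi> \<and> vanishes_off \<PP> \<Phi>}" (is "countable ?A")
proof -
  interpret nfield K using K by unfold_locales
  define T where "T = {P \<in> places K. prime_below P \<in> \<PP>}"
  have finT: "finite T" unfolding T_def by (rule finite_places_over[OF \<PP>])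
  \<comment> \<open>Values outside the finite set \<open>T\<close> are made undefined, so that the
    data lie in a countable extensional function space.\<close>
  define F where "F \<Phi> = restrict (\<lambda>P. \<Phi> (gam P)) T" for \<Phi> :: "complex \<Rightarrow> rat"
  have "inj_on F ?A"
  proof (rule inj_onI)
    fix \<Phi> \<Psi> assume \<Phi>: "\<Phi> \<in> ?A" and \<Psi>: "\<Psi> \<in> ?A" and eq: "F \<Phi> = F \<Psi>"
    have g: "\<Phi> (gam P) = \<Psi> (gam P)" if P: "P \<in> places K" for P
    proof (cases "P \<in> T")
      case True
      then show ?thesis using fun_cong[OF eq, of P] by (simp add: F_def)
    next
      case False
      then show ?thesis using vanishes_off_gam[of \<PP> \<Phi> P] vanishes_off_gam[of \<PP> \<Psi> P] \<Phi> \<Psi> P by (simp add: T_def)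
    qed
    show "\<Phi> = \<Psi>"
    proof
      fix \<alpha>
      show "\<Phi> \<alpha> = \<Psi> \<alpha>"
      proof (cases "\<alpha> \<in> Qbar_units")
        case False
        then show ?thesis using SdualD(3)[of \<Phi> \<alpha>] SdualD(3)[of \<Psi> \<alpha>] \<Phi> \<Psi> by simp
      next
        case True
        then have aQ: "\<alpha> \<in> Qbar" "\<alpha> \<noteq> 0" by (auto simp: Qbar_units_def)
        let ?x = "relnorm K \<alpha>"
        have x: "?x \<in> K" "?x \<noteq> 0" using relnorm_mem[OF sf KQ aQ(1)] relnorm_nonzero[OF aQ] by auto
        define S where "S = {P \<in> places K. ordv K P ?x \<noteq> 0}"
        have S: "finite S" "S \<subseteq> places K" "\<And>P. P \<in> places K \<Longrightarrow> ordv K P ?x \<noteq> 0 \<Longrightarrow> P \<in> S"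
          using finite_support[of ?x] x by (auto simp: S_def)
        have "\<Phi> ?x = (\<Sum>P\<in>S. of_int (ordv K P ?x) * \<Phi> (gam P) / of_nat (hh P))"
          by (rule Sdual_decomposition[OF _ x S]) (use \<Phi> in simp)
        also have "\<dots> = (\<Sum>P\<in>S. of_int (ordv K P ?x) * \<Psi> (gam P) / of_nat (hh P))"
          using g S(2) by (intro sum.cong) auto
        also have "\<dots> = \<Psi> ?x"
          by (rule Sdual_decomposition[symmetric, OF _ x S]) (use \<Psi> in simp)
        finally have "of_nat (card (conj_orb K \<alpha>)) * \<Phi> \<alpha> = of_nat (card (conj_orb K \<alpha>)) * \<Psi> \<alpha>"
          using inv_over_relnorm[of \<Phi> K \<alpha>] inv_over_relnorm[of \<Psi> K \<alpha>] True \<Phi> \<Psi> by auto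
        then show ?thesis using card_conj_orb_pos[OF aQ(1), of K] by simp
      qed
    qed
  qed
  moreover have "countable (F ` ?A)"
  proof (rule countable_subset)
    show "F ` ?A \<subseteq> T \<rightarrow>\<^sub>E UNIV" by (auto simp: F_def)
    show "countable (T \<rightarrow>\<^sub>E (UNIV :: rat set))" by (intro countable_PiE finT) simp
  qed
  ultimately show ?thesis by (metis countable_image_inj_on)
qed

text \<open>Number fields are coded by finite subsets of \<open>Qbar\<close>, with one chosen field
  \<open>KF F\<close> for each. The field chosen for a basis of \<open>K\<close> contains
  \<open>K\<close>, and invariance over \<open>K\<close> implies invariance over it.\<close>

lemma countable_Cstar: "countable Cstar"
proof -
  define KF where "KF F = (SOME K. number_field K \<and> F \<subseteq> K)" for F
  have KF: "number_field (KF F) \<and> F \<subseteq> KF F" if F: "finite F" "F \<subseteq> Qbar" for F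
    unfolding KF_def by (rule someI_ex) (use ex_number_field_superset[OF F] in blast)
  let ?I = "{F. finite F \<and> F \<subseteq> Qbar}" and ?J = "{\<PP> :: nat set. finite \<PP>}"
  let ?U = "\<Union>F\<in>?I. \<Union>\<PP>\<in>?J. {\<Phi> \<in> Sdual. inv_over (KF F) \<Phi> \<and> vanishes_off \<PP> \<Phi>}"
  have "Cstar \<subseteq> ?U"
  proof
    fix \<Phi> assume "\<Phi> \<in> Cstar"
    then obtain K \<PP> where \<Phi>: "\<Phi> \<in> Sdual" "number_field K" "inv_over K \<Phi>" "finite \<PP>" "vanishes_off \<PP> \<Phi>"
      unfolding Cstar_iff by blast
    interpret nfield K using \<Phi>(2) by unfold_locales
    let ?F = "ib ` {..<deg}"
    have F: "?F \<in> ?I" using ib_image by blast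
    then have "K \<subseteq> KF ?F" using KF[of ?F] number_field_subfield by (intro superfield_if_ib) auto
    then have "inv_over (KF ?F) \<Phi>" using \<Phi>(3) GalOver_antimono unfolding inv_over_def by blast
    then have "\<Phi> \<in> {\<Phi> \<in> Sdual. inv_over (KF ?F) \<Phi> \<and> vanishes_off \<PP> \<Phi>}" using \<Phi> by blast
    then show "\<Phi> \<in> ?U" using F \<Phi>(4) by blast
  qed
  moreover have "countable ?U"
  proof (intro countable_UN)
    show "countable ?I" using countable_Collect_finite_subset[OF countable_Qbar] by simp
    show "countable ?J" using countable_Collect_finite by simp
    show "countable {\<Phi> \<in> Sdual. inv_over (KF F) \<Phi> \<and> vanishes_off \<PP> \<Phi>}" if "F \<in> ?I" "\<PP> \<in> ?J" for F \<PP>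
      using that KF by (intro countable_fixed_field_support) auto
  qed
  ultimately show ?thesis by (rule countable_subset)
qed

section \<open>Density\<close>

lemma relnorm_AUnits:
  assumes "u \<in> AUnits"
  shows "relnorm K u \<in> AUnits"
proof -
  note u = AUnitsD[OF assms]
  have uQ: "u \<in> Qbar" using alg_int_imp_Qbar[OF u(1)] .
  have "inverse (relnorm K u) = (\<Prod>y\<in>conj_orb K u. inverse y)" 
    unfolding relnorm_def using prod_inversef[of "\<lambda>y. y" "conj_orb K u"] by (simp add: o_def)
  moreover have "alg_int (inverse y)" if "y \<in> conj_orb K u" for y
    using that GalQ_inverse[OF _ uQ] GalQ_alg_int[OF _ u(3)] by (auto simp: conj_orb_def dest!: GalOver_GalQ)
  ultimately have "alg_int (inverse (relnorm K u))" by (simp add: alg_int_prod)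
  then show ?thesis using alg_int_relnorm[OF u(1)] relnorm_nonzero[OF uQ u(2)] by (simp add: AUnits_def)
qed

text \<open>Conjugation fixes \<open>p^k\<close>, so every conjugate of \<open>a\<close> divides
  \<open>p^k\<close>, and their product divides a larger power of \<open>p\<close>.\<close>

lemma pelem_relnorm:
  assumes "pelem p a"
  shows "pelem p (relnorm K a)"
proof -
  obtain k where k: "alg_int a" "a \<noteq> 0" "alg_int (of_nat p ^ k / a)" using assms by (auto simp: pelem_def)
  have aQ: "a \<in> Qbar" by (rule alg_int_imp_Qbar[OF k(1)])
  have "(\<Prod>y\<in>conj_orb K a. of_nat p ^ k / y) = of_nat p ^ (k * card (conj_orb K a)) / relnorm K a"
    by (simp add: relnorm_def prod_dividef power_mult)
  moreover have "alg_int (of_nat p ^ k / y)" if y: "y \<in> conj_orb K a" for y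
  proof -
    obtain \<sigma> where s: "\<sigma> \<in> GalQ" "y = \<sigma> a" using y by (auto simp: conj_orb_def dest: GalOver_GalQ)
    have pQ: "of_nat p ^ k \<in> \<rat>" by simp
    then have "\<sigma> (of_nat p ^ k / a) = of_nat p ^ k / y"
      using s aQ Rats_Qbar
      by (simp add: divide_inverse GalQ_D GalQ_inverse GalQ_Rats subfield_closed[OF subfield_Qbar] subset_eq)
    then show ?thesis using GalQ_alg_int[OF s(1) k(3)] by simp
  qed
  ultimately have "alg_int (of_nat p ^ (k * card (conj_orb K a)) / relnorm K a)" by (metis alg_int_prod)
  then show ?thesis
    using alg_int_relnorm[OF k(1)] relnorm_nonzero[OF aQ k(2)] by (auto simp: pelem_def)
qed

section \<open>Truncated and averaged functionals\<close>

context nfield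
begin

text \<open>The expansion of \<Phi> on \<open>K\<close> without the places over primes larger than
  \<open>n\<close>. The index set is finite and independent of \<open>x\<close>, which makes
  additivity immediate.\<close>

definition trunc :: "nat \<Rightarrow> (complex \<Rightarrow> rat) \<Rightarrow> complex \<Rightarrow> rat" where
  "trunc n \<Phi> x = (\<Sum>P\<in>{P \<in> places K. prime_below P \<in> {..n}}. of_int (ordv K P x) * \<Phi> (gam P) / of_nat (hh P))"

text \<open>Averaging extends the truncation from \<open>K\<close> to \<open>Qbar\<close> without
  changing it on \<open>K\<close>; it makes the result invariant over \<open>K\<close>. Off
  \<open>Qbar_units\<close> the value is 0, as \<open>Sdual\<close> requires.\<close>

definition approx :: "nat \<Rightarrow> (complex \<Rightarrow> rat) \<Rightarrow> complex \<Rightarrow> rat" where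
  "approx n \<Phi> \<alpha> = (if \<alpha> \<in> Qbar_units then normalized_trace K (trunc n \<Phi>) \<alpha> else 0)"

lemma trunc_eq_0: "(\<And>P. P \<in> places K \<Longrightarrow> prime_below P \<le> n \<Longrightarrow> ordv K P x = 0) \<Longrightarrow> trunc n \<Phi> x = 0"
  unfolding trunc_def by (intro sum.neutral) auto

lemma approx_Cstar: "approx n \<Phi> \<in> Cstar"
  unfolding Cstar_iff
proof (intro conjI)
  have "approx n \<Phi> (x * y) = approx n \<Phi> x + approx n \<Phi> y" if xy: "x \<in> Qbar_units" "y \<in> Qbar_units" for x y
  proof -
    have "normalized_trace K (trunc n \<Phi>) (x * y) = normalized_trace K (trunc n \<Phi>) x + normalized_trace K (trunc n \<Phi>) y"
    proof (rule normalized_trace_mult[OF sf KQ _ xy])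
      fix x y assume "x \<in> K - {0}" "y \<in> K - {0}"
      then show "trunc n \<Phi> (x * y) = trunc n \<Phi> x + trunc n \<Phi> y"
        unfolding trunc_def sum.distrib[symmetric]
        by (intro sum.cong) (auto simp: ordv_mult distrib_right add_divide_distrib)
    qed
    then show ?thesis using xy Qbar_units_closed(1)[OF xy] by (simp add: approx_def)
  qed
  moreover have "approx n \<Phi> u = 0" if u: "u \<in> AUnits" for u
  proof -
    have "relnorm K u \<in> K" using relnorm_mem[OF sf KQ] alg_int_imp_Qbar AUnitsD(1)[OF u] by blast
    then have "trunc n \<Phi> (relnorm K u) = 0"
      using AUnits_imp_ordv_zero relnorm_AUnits[OF u] by (intro trunc_eq_0) blast
    then show ?thesis by (simp add: approx_def normalized_trace_def)
  qed
  ultimately show "approx n \<Phi> \<in> Sdual" unfolding Sdual_def by (auto simp: approx_def)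
  have "approx n \<Phi> (\<sigma> x) = approx n \<Phi> x" if s: "\<sigma> \<in> GalOver K" for \<sigma> x
    using GalQ_Qbar[OF GalOver_GalQ[OF s], of x] GalQ_eq_0[OF GalOver_GalQ[OF s], of x]
    by (simp add: approx_def normalized_trace_GalOver[OF s] Qbar_units_def)
  then show "\<exists>K. number_field K \<and> inv_over K (approx n \<Phi>)" using nf unfolding inv_over_def by blast
  have "approx n \<Phi> a = 0" if p: "prime p" "p \<notin> {..n}" and a: "pelem p a" for p a
  proof -
    have "a \<in> Qbar" using a alg_int_imp_Qbar by (simp add: pelem_def)
    then have "relnorm K a \<in> K" using relnorm_mem[OF sf KQ] by blast
    then have "trunc n \<Phi> (relnorm K a) = 0"
      using p pelem_ordv[OF _ p(1) _ pelem_relnorm[OF a]] by (intro trunc_eq_0) auto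
    then show ?thesis by (simp add: approx_def normalized_trace_def)
  qed
  then show "\<exists>\<PP>. finite \<PP> \<and> vanishes_off \<PP> (approx n \<Phi>)"
    unfolding vanishes_off_def by (intro exI[of _ "{..n}"]) auto
qed

text \<open>Every prime below a place in the support of \<open>x\<close> divides \<open>m\<close>,
  hence is at most \<open>n\<close>, and the truncation discards nothing.\<close>

lemma approx_eq:
  assumes \<Phi>: "\<Phi> \<in> Sdual" and x: "x \<in> K" "x \<noteq> 0"
    and m: "m > 0" "alg_int (of_nat m * x)" "alg_int (of_nat m / x)" "m \<le> n"
  shows "approx n \<Phi> x = \<Phi> x"
proof -
  have "\<Phi> x = (\<Sum>P\<in>{P \<in> places K. prime_below P \<in> {..n}}. of_int (ordv K P x) * \<Phi> (gam P) / of_nat (hh P))"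
  proof (rule Sdual_decomposition[OF \<Phi> x])
    show "finite {P \<in> places K. prime_below P \<in> {..n}}" by (rule finite_places_over) simp
    fix P assume P: "P \<in> places K" "ordv K P x \<noteq> 0"
    then have "prime_below P dvd m" using ordv_eq_0_if_dvd_nat[OF P(1) x m(1) _ m(2,3)] by blast
    then have "prime_below P \<le> m" using m(1) by (rule dvd_imp_le)
    then have "prime_below P \<le> n" using m(4) by linarith
    then show "P \<in> {P \<in> places K. prime_below P \<in> {..n}}" using P by simp
  qed auto
  then show ?thesis using K_units[OF x] by (simp add: approx_def normalized_trace_in[OF x(1)] trunc_def)
qed

end

text \<open>The field \<open>Kn n\<close> contains the members of an enumeration of
  \<open>Qbar\<close> up to index \<open>n\<close>. Equality at \<alpha> begins once
  \<open>n\<close> reaches both its index and an integer controlling its prime divisors.\<close>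

lemma Cstar_dense:
  assumes \<Phi>: "\<Phi> \<in> Sdual"
  shows "\<exists>\<Phi>s :: nat \<Rightarrow> complex \<Rightarrow> rat. (\<forall>n. \<Phi>s n \<in> Cstar)
          \<and> (\<forall>\<alpha>\<in>Qbar_units. \<forall>\<^sub>F n in sequentially. \<Phi>s n \<alpha> = \<Phi> \<alpha>)"
proof -
  have ne: "Qbar \<noteq> {}" using subfield_closed(1)[OF subfield_Qbar] by blast
  have "\<exists>K. number_field K \<and> from_nat_into Qbar ` {..n} \<subseteq> K" for n
  proof -
    have "from_nat_into Qbar ` {..n} \<subseteq> Qbar" using from_nat_into[OF ne] by blast
    then obtain K where "number_field K" "from_nat_into Qbar ` {..n} \<subseteq> K"
      using ex_number_field_superset[of "from_nat_into Qbar ` {..n}"] by blast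
    then show ?thesis by blast
  qed
  then obtain Kn where Kn: "\<And>n. number_field (Kn n)" "\<And>n. from_nat_into Qbar ` {..n} \<subseteq> Kn n" by metis
  have loc: "nfield (Kn n)" for n using Kn(1) by (rule nfield.intro)
  define \<Phi>s where "\<Phi>s n = nfield.approx (Kn n) n \<Phi>" for n
  have "\<forall>n. \<Phi>s n \<in> Cstar" unfolding \<Phi>s_def using nfield.approx_Cstar[OF loc] by blast
  moreover have "\<forall>\<^sub>F n in sequentially. \<Phi>s n \<alpha> = \<Phi> \<alpha>" if a: "\<alpha> \<in> Qbar_units" for \<alpha>
  proof -
    have aQ: "\<alpha> \<in> Qbar" "\<alpha> \<noteq> 0" "inverse \<alpha> \<in> Qbar" using a Qbar_units_closed(3)[OF a] by (auto simp: Qbar_units_def)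
    obtain i where i: "from_nat_into Qbar i = \<alpha>" using from_nat_into_surj[OF countable_Qbar aQ(1)] by blast
    obtain m1 :: nat where m1: "m1 > 0" "alg_int (of_nat m1 * \<alpha>)" using ex_multiple_alg_int[OF aQ(1)] by blast
    obtain m2 :: nat where m2: "m2 > 0" "alg_int (of_nat m2 * inverse \<alpha>)" using ex_multiple_alg_int[OF aQ(3)] by blast
    \<comment> \<open>The product clears the denominators of \<alpha> and of its inverse at
      once.\<close>
    define m where "m = m1 * m2"
    have "of_nat m * \<alpha> = of_nat m2 * (of_nat m1 * \<alpha>)" "of_nat m / \<alpha> = of_nat m1 * (of_nat m2 * inverse \<alpha>)"
      by (simp_all add: m_def divide_inverse)
    moreover have "alg_int (of_nat m2 * (of_nat m1 * \<alpha>))" "alg_int (of_nat m1 * (of_nat m2 * inverse \<alpha>))"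
      by (intro alg_int_mult alg_int_of_nat m1 m2)+
    moreover have "m > 0" using m1 m2 by (simp add: m_def)
    ultimately have m: "m > 0" "alg_int (of_nat m * \<alpha>)" "alg_int (of_nat m / \<alpha>)" by metis+
    have "\<Phi>s n \<alpha> = \<Phi> \<alpha>" if n: "n \<ge> max i m" for n
    proof -
      have "\<alpha> \<in> Kn n" using Kn(2)[of n] i n by auto
      then show ?thesis unfolding \<Phi>s_def using nfield.approx_eq[OF loc \<Phi> _ aQ(2) m] n by simp
    qed
    then show ?thesis unfolding eventually_sequentially by blast
  qed
  ultimately show ?thesis by blast
qed

theorem theorem2p3:
  shows "countable Cstar \<and> Cstar \<subseteq> Sprime \<and> (\<lambda>_. 0) \<in> Cstar
     \<and> (\<forall>\<Phi>\<in>Cstar. \<forall>\<Psi>\<in>Cstar. (\<lambda>z. \<Phi> z + \<Psi> z) \<in> Cstar)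
     \<and> (\<forall>r::rat. \<forall>\<Phi>\<in>Cstar. (\<lambda>z. r * \<Phi> z) \<in> Cstar)
     \<and> (\<forall>\<Phi>\<in>Sdual. \<exists>\<Phi>s :: nat \<Rightarrow> complex \<Rightarrow> rat. (\<forall>n. \<Phi>s n \<in> Cstar)
          \<and> (\<forall>\<alpha>\<in>Qbar_units. \<forall>\<^sub>F n in sequentially. \<Phi>s n \<alpha> = \<Phi> \<alpha>))"
  using countable_Cstar Cstar_subset_Sprime Cstar_zero Cstar_add Cstar_scale Cstar_dense by blast

end
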